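(* Let $T$ be a lifted graph, $F\colon T\to T$ a $\sigma$-like map, and $X_{\infty}=\{x\in X_F\mid \forall n\geq 1,\ F^n(x)\in X_F+\mathbb{Z}\}$. Let $N\ge 0$ be an integer for which there are subintervals $X_1,\dots,X_N$ of $X_F$ and integers $p_1,\dots,p_N$ forming a partition datum for $F$ (as defined in the context). Then there exist an integer $k\geq 0$ and compact non-empty intervals $I_0,\ldots, I_k$ in $\mathbb{R}$ such that: \begin{itemize} \item $I_0=\mathrm{Rot}_{\mathbb{R}}(F)=\mathrm{Rot}_{T_{\mathbb{R}}}(F)$; \item $\mathrm{Rot}(F)=\mathrm{Rot}^+(F)=\mathrm{Rot}^-(F)=I_0\cup\cdots\cup I_k$; \item for all $1\leq i\leq k$ and all $r\in I_i\cap\mathbb{Q}$, there exists a periodic (mod 1) point $x\in X_{\infty}$ with $\rho_F(x)=r$; \item for all $1\leq i\leq k$, $I_i\cap\mathbb{Z}\neq\emptyset$. \end{itemize} Moreover, $k\leq N$.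
   Context: Finite graph: a compact connected set $G$ containing a finite subset $V$ such that each connected component of $G\setminus V$ is homeomorphic to an open interval. Lifted graph: a connected closed topological space $T$ for which there exist a homeomorphism $h$ from $\mathbb{R}$ into $T$ (onto its image) and a homeomorphism $\tau\colon T\to T$ such that (i) $\tau(h(x))=h(x+1)$ for all $x\in\mathbb{R}$; (ii) the closure of each connected component of $T\setminus h(\mathbb{R})$ is a finite graph that intersects $h(\mathbb{R})$ at a single point; (iii) the number of connected components $C$ of $T\setminus h(\mathbb{R})$ such that $\overline{C}\cap h([0,1])\neq\emptyset$ is finite. One identifies $h(\mathbb{R})$ with $\mathbb{R}$ and writes $x+m$ for $\tau^m(x)$, $x\in T$, $m\in\mathbb{Z}$. For $A\subset T$, $A+m=\{x+m\mid x\in A\}$ and $A+\mathbb{Z}=\bigcup_{m\in\mathbb{Z}}(A+m)$. Retraction $r\colon T\to\mathbb{R}$: $r(x)=x$ if $x\in\mathbb{R}$; otherwise $r(x)$ is the unique point of $\overline{C}\cap\mathbb{R}$, where $C$ is the connected component of $T\setminus\mathbb{R}$ containing $x$. A continuous map $F\colon T\to T$ is of degree $1$ if $F(x+1)=F(x)+1$ for all $x\in T$. A point $x$ is periodic (mod 1) for $F$ if $F^n(x)\in x+\mathbb{Z}$ for some integer $n\ge1$. Rotation numbers: $\overline{\rho}_F(x)=\limsup_{n\to+\infty}\frac{r(F^n(x))-r(x)}{n}$ and $\underline{\rho}_F(x)=\liminf_{n\to+\infty}\frac{r(F^n(x))-r(x)}{n}$; when they are equal, the common value is $\rho_F(x)$.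 For $S\subset T$: $\mathrm{Rot}^+_S(F)=\{\overline{\rho}_F(x)\mid x\in S\}$, $\mathrm{Rot}^-_S(F)=\{\underline{\rho}_F(x)\mid x\in S\}$, $\mathrm{Rot}_S(F)=\{\rho_F(x)\mid x\in S,\ \rho_F(x)\text{ exists}\}$. The subscript is omitted when $S=T$. $\sigma$-like maps: for $F$ continuous of degree $1$, put $T_{\mathbb{R}}=\overline{\bigcup_{n\ge0}F^n(\mathbb{R})}$ and $X_F=\overline{T\setminus T_{\mathbb{R}}}\cap r^{-1}([0,1))$; one has $T=T_{\mathbb{R}}\cup(X_F+\mathbb{Z})$. $F$ is $\sigma$-like if $F$ is continuous of degree $1$ and $X_F$ is either empty, or a non-empty interval such that $X_F\cap T_{\mathbb{R}}$ is one of the endpoints of $X_F$. When non-empty, $X_F$ is ordered so that $\min X_F$ is the unique point of $X_F\cap T_{\mathbb{R}}$; $A<B$ for subintervals means every point of $A$ is less than every point of $B$. Partition datum for $F$: an integer $N\ge 0$, non-empty compact subintervals $X_1,\dots,X_N$ of $X_F$ and integers $p_1,\dots,p_N$ such that (i) $X_1<X_2<\cdots<X_N$; (ii) $F(X_i)\subset(X_F+p_i)\cup T_{\mathbb{R}}$ for $1\le i\le N$; (iii) $F(\min X_i)=\min X_F+p_i$ for $1\le i\le N$; (iv) $p_{i+1}\ne p_i$ for $1\le i\le N-1$; (v) $F(X_F\setminus(X_1\cup\cdots\cup X_N))\cap(X_F+\mathbb{Z})=\emptyset$. (Such a datum always exists.)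
   Formalization: Lifted graphs are taken to be Hausdorff, the set G∖V in the definition of a finite graph is required to have only finitely many connected components, and the retraction r is required to be continuous; without such conditions Rot_R(F)=Rot_{T_R}(F) can fail. *)

theory Defs
  imports "HOL-Analysis.Analysis"
begin

section \<open>Lifted graphs\<close>

text \<open>The finiteness of the set of components of \<open>G - V\<close> is what \<open>finite\<close> refers to. It is not
  automatic: the suspension of a Cantor set is compact and connected, and removing its two poles
  leaves open arcs as components.\<close>

definition finite_graph :: "'a::topological_space set \<Rightarrow> bool" where
  "finite_graph G \<longleftrightarrow> compact G \<and> connected G \<and>
     (\<exists>V. finite V \<and> V \<subseteq> G \<and> finite (components (G - V)) \<and>
        (\<forall>C \<in> components (G - V). C homeomorphic {0<..<1::real}))"

text \<open>The lifted graph \<open>T\<close> is the whole type \<open>'a\<close>. The map \<open>h\<close> is the parametrisation of the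
  embedded real line, which is \<open>range h\<close>; \<open>retr h\<close> takes values in the parameter line.\<close>

definition retr :: "(real \<Rightarrow> 'a::topological_space) \<Rightarrow> 'a \<Rightarrow> real" where
  "retr h x = (if x \<in> range h then inv h x
     else (THE t. closure (connected_component_set (- range h) x) \<inter> range h = {h t}))"

text \<open>Two conventions are made explicit: spaces are Hausdorff (class \<open>t2_space\<close>), and \<open>retr h\<close> is a
  retraction in the topological sense, that is, continuous (last condition). Continuity does not
  follow from the other conditions, which do not prevent a sequence of points attached to the
  line at parameters tending to infinity from converging in \<open>T\<close>.\<close>

definition lifted_graph :: "(real \<Rightarrow> 'a::t2_space) \<Rightarrow> ('a \<Rightarrow> 'a) \<Rightarrow> bool" where
  "lifted_graph h \<tau> \<longleftrightarrow>
     connected (UNIV :: 'a set) \<and>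
     (\<exists>g. homeomorphism UNIV (range h) h g) \<and>
     (\<exists>g. homeomorphism UNIV UNIV \<tau> g) \<and>
     (\<forall>x. \<tau> (h x) = h (x + 1)) \<and>
     (\<forall>C \<in> components (- range h).
        finite_graph (closure C) \<and> (\<exists>t. closure C \<inter> range h = {h t})) \<and>
     finite {C \<in> components (- range h). closure C \<inter> h ` {0..1} \<noteq> {}} \<and>
     retraction UNIV (range h) (h \<circ> retr h)"

text \<open>\<open>shift \<tau> m x\<close> is \<open>x + m\<close>.\<close>

definition shift :: "('a \<Rightarrow> 'a) \<Rightarrow> int \<Rightarrow> 'a \<Rightarrow> 'a" where
  "shift \<tau> m x = (if 0 \<le> m then (\<tau> ^^ nat m) x else (inv \<tau> ^^ nat (- m)) x)"

definition plus_ints :: "('a \<Rightarrow> 'a) \<Rightarrow> 'a set \<Rightarrow> 'a set" where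
  "plus_ints \<tau> A = (\<Union>m. shift \<tau> m ` A)"

definition degree_one :: "('a \<Rightarrow> 'a) \<Rightarrow> ('a \<Rightarrow> 'a) \<Rightarrow> bool" where
  "degree_one \<tau> F \<longleftrightarrow> (\<forall>x. F (\<tau> x) = \<tau> (F x))"

definition periodic_mod1 :: "('a \<Rightarrow> 'a) \<Rightarrow> ('a \<Rightarrow> 'a) \<Rightarrow> 'a \<Rightarrow> bool" where
  "periodic_mod1 \<tau> F x \<longleftrightarrow> (\<exists>n\<ge>1. (F ^^ n) x \<in> plus_ints \<tau> {x})"

section \<open>Rotation numbers and rotation sets\<close>

text \<open>Upper and lower limits are taken in \<open>ereal\<close>, so that all rotation sets are sets of extended
  reals and no point is lost from them a priori.\<close>

definition upper_rot :: "(real \<Rightarrow> 'a::topological_space) \<Rightarrow> ('a \<Rightarrow> 'a) \<Rightarrow> 'a \<Rightarrow> ereal" where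
  "upper_rot h F x = limsup (\<lambda>n. ereal ((retr h ((F ^^ n) x) - retr h x) / real n))"

definition lower_rot :: "(real \<Rightarrow> 'a::topological_space) \<Rightarrow> ('a \<Rightarrow> 'a) \<Rightarrow> 'a \<Rightarrow> ereal" where
  "lower_rot h F x = liminf (\<lambda>n. ereal ((retr h ((F ^^ n) x) - retr h x) / real n))"

definition has_rot ::
  "(real \<Rightarrow> 'a::topological_space) \<Rightarrow> ('a \<Rightarrow> 'a) \<Rightarrow> 'a \<Rightarrow> ereal \<Rightarrow> bool" where
  "has_rot h F x \<rho> \<longleftrightarrow> upper_rot h F x = \<rho> \<and> lower_rot h F x = \<rho>"

definition Rot_upper ::
  "(real \<Rightarrow> 'a::topological_space) \<Rightarrow> ('a \<Rightarrow> 'a) \<Rightarrow> 'a set \<Rightarrow> ereal set" where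
  "Rot_upper h F S = upper_rot h F ` S"

definition Rot_lower ::
  "(real \<Rightarrow> 'a::topological_space) \<Rightarrow> ('a \<Rightarrow> 'a) \<Rightarrow> 'a set \<Rightarrow> ereal set" where
  "Rot_lower h F S = lower_rot h F ` S"

definition Rot ::
  "(real \<Rightarrow> 'a::topological_space) \<Rightarrow> ('a \<Rightarrow> 'a) \<Rightarrow> 'a set \<Rightarrow> ereal set" where
  "Rot h F S = {\<rho>. \<exists>x\<in>S. has_rot h F x \<rho>}"

section \<open>Sigma-like maps\<close>

definition TR :: "(real \<Rightarrow> 'a::topological_space) \<Rightarrow> ('a \<Rightarrow> 'a) \<Rightarrow> 'a set" where
  "TR h F = closure (\<Union>n. (F ^^ n) ` range h)"

definition XF :: "(real \<Rightarrow> 'a::topological_space) \<Rightarrow> ('a \<Rightarrow> 'a) \<Rightarrow> 'a set" where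
  "XF h F = closure (- TR h F) \<inter> retr h -` {0..<1}"

definition Xinf ::
  "(real \<Rightarrow> 'a::topological_space) \<Rightarrow> ('a \<Rightarrow> 'a) \<Rightarrow> ('a \<Rightarrow> 'a) \<Rightarrow> 'a set" where
  "Xinf h \<tau> F = {x \<in> XF h F. \<forall>n\<ge>1. (F ^^ n) x \<in> plus_ints \<tau> (XF h F)}"

text \<open>An interval in \<open>T\<close> is a set \<open>A\<close> with a homeomorphism \<open>\<phi>\<close> from a real interval \<open>J\<close> onto \<open>A\<close>.\<close>

definition interval_chart :: "real set \<Rightarrow> (real \<Rightarrow> 'a::topological_space) \<Rightarrow> 'a set \<Rightarrow> bool" where
  "interval_chart J \<phi> A \<longleftrightarrow> is_interval J \<and> (\<exists>g. homeomorphism J A \<phi> g)"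

definition sigma_like ::
  "(real \<Rightarrow> 'a::topological_space) \<Rightarrow> ('a \<Rightarrow> 'a) \<Rightarrow> ('a \<Rightarrow> 'a) \<Rightarrow> bool" where
  "sigma_like h \<tau> F \<longleftrightarrow> continuous_on UNIV F \<and> degree_one \<tau> F \<and>
     (XF h F = {} \<or>
      (\<exists>J \<phi> e. interval_chart J \<phi> (XF h F) \<and>
         e \<in> J \<and> ((\<forall>t\<in>J. e \<le> t) \<or> (\<forall>t\<in>J. t \<le> e)) \<and>
         XF h F \<inter> TR h F = {\<phi> e}))"

section \<open>The order of \<open>X_F\<close> and partition data\<close>

text \<open>Charts of \<open>X_F\<close> oriented so that the unique point of \<open>X_F \<inter> T_R\<close> is the least one. Any two of
  them differ by an increasing homeomorphism, so they all induce the same order on \<open>X_F\<close>.\<close>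

definition XF_chart ::
  "(real \<Rightarrow> 'a::topological_space) \<Rightarrow> ('a \<Rightarrow> 'a) \<Rightarrow> real set \<Rightarrow> (real \<Rightarrow> 'a) \<Rightarrow> bool" where
  "XF_chart h F J \<phi> \<longleftrightarrow> interval_chart J \<phi> (XF h F) \<and>
     (\<exists>e\<in>J. (\<forall>t\<in>J. e \<le> t) \<and> XF h F \<inter> TR h F = {\<phi> e})"

definition XF_less ::
  "(real \<Rightarrow> 'a::topological_space) \<Rightarrow> ('a \<Rightarrow> 'a) \<Rightarrow> 'a \<Rightarrow> 'a \<Rightarrow> bool" where
  "XF_less h F x y \<longleftrightarrow>
     (\<exists>J \<phi>. XF_chart h F J \<phi> \<and> (\<exists>s\<in>J. \<exists>t\<in>J. x = \<phi> s \<and> y = \<phi> t \<and> s < t))"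

definition XF_min :: "(real \<Rightarrow> 'a::topological_space) \<Rightarrow> ('a \<Rightarrow> 'a) \<Rightarrow> 'a set \<Rightarrow> 'a" where
  "XF_min h F A = (THE m. m \<in> A \<and> (\<forall>x\<in>A. x = m \<or> XF_less h F m x))"

text \<open>Non-empty compact subintervals of \<open>X_F\<close>, possibly reduced to one point.\<close>

definition XF_subinterval ::
  "(real \<Rightarrow> 'a::topological_space) \<Rightarrow> ('a \<Rightarrow> 'a) \<Rightarrow> 'a set \<Rightarrow> bool" where
  "XF_subinterval h F A \<longleftrightarrow>
     (\<exists>J \<phi> a b. XF_chart h F J \<phi> \<and> a \<in> J \<and> b \<in> J \<and> a \<le> b \<and> A = \<phi> ` {a..b})"

definition partition_datum ::
  "(real \<Rightarrow> 'a::topological_space) \<Rightarrow> ('a \<Rightarrow> 'a) \<Rightarrow> ('a \<Rightarrow> 'a) \<Rightarrow>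
     nat \<Rightarrow> (nat \<Rightarrow> 'a set) \<Rightarrow> (nat \<Rightarrow> int) \<Rightarrow> bool" where
  "partition_datum h \<tau> F N X p \<longleftrightarrow>
     (\<forall>i\<in>{1..N}. XF_subinterval h F (X i)) \<and>
     (\<forall>i\<in>{1..<N}. \<forall>x\<in>X i. \<forall>y\<in>X (i + 1). XF_less h F x y) \<and>
     (\<forall>i\<in>{1..N}. F ` X i \<subseteq> shift \<tau> (p i) ` XF h F \<union> TR h F) \<and>
     (\<forall>i\<in>{1..N}. F (XF_min h F (X i)) = shift \<tau> (p i) (XF_min h F (XF h F))) \<and>
     (\<forall>i\<in>{1..<N}. p (i + 1) \<noteq> p i) \<and>
     F ` (XF h F - (\<Union>i\<in>{1..N}. X i)) \<inter> plus_ints \<tau> (XF h F) = {}"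

end

theory Submission
  imports Defs
begin

text \<open>The orbits that enter \<open>T_R\<close> give the interval \<open>I_0\<close>; those that stay for ever in the translates of
\<open>X_F\<close> give the other intervals. In both cases the point is that pieces of orbits can be
concatenated, so that a rotation number is obtained by concatenating longer and longer pieces whose
mean displacements approach it (\<open>block_average\<close>).

A point \<open>h t\<close> cuts the space: a connected set with points on both sides of it contains it
(\<open>separation\<close>). Hence \<open>F ^^ n\<close> maps a unit segment of the line over a unit segment of the line, even
if it moves points off the line at intermediate times. Any piece of orbit issued from the line can
thus be followed by any other one, with an error at most 1 in the displacement (\<open>line_cover\<close>). This
makes the set of all limits of mean displacements of points of the line a compact interval, each
element of which is the rotation number of a point of the line.

Let \<open>Q\<close> be the union of the images of the line (\<open>line_images\<close>). A point of \<open>Q\<close> lies on the orbit of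
a point of the line. Since \<open>Q\<close> is connected and the branches of \<open>T\<close> are graphs, \<open>T_R - Q\<close> is finite
modulo translations; as \<open>F\<close> maps \<open>T_R\<close> onto itself, it permutes these points modulo translations. Each of
them is therefore a fixed point \<open>y\<close> of some \<open>G = F ^^ q - m\<close>, and its only preimage in \<open>T_R\<close> under
\<open>G\<close> is \<open>y\<close>. Orbits that go from the line to points very close to \<open>y\<close> must then spend a long time
near \<open>y\<close>, and a limit of the places where they come near \<open>y\<close> is a point of \<open>Q\<close> whose orbit stays
near \<open>y\<close> for ever (\<open>shadow\<close>). So \<open>T_R\<close> has no other rotation numbers than the line (\<open>TR_rates\<close>).

On \<open>X_F\<close>, seen as an interval, the branch \<open>F - p_i\<close> on \<open>X_i\<close> maps the left end of \<open>X_i\<close> to the minimum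
of \<open>X_F\<close>. By the intermediate value theorem, if this branch takes a value, it takes every smaller
value further left (\<open>branch_lower\<close>). For the set \<open>S\<close> of itineraries this means: the tail of an
itinerary may be replaced by any lexicographically smaller itinerary (locale \<open>lower_shift\<close>). From
here on everything is combinatorics of words. Call a word a loop at the letter \<open>m\<close> if it may be
inserted after \<open>m\<close> in every itinerary. Loops at \<open>m\<close> can be concatenated freely, so the means of \<open>p\<close>
over them fill an interval \<open>I_m\<close>, up to the irrational values and the end points. It is considered
for the letters \<open>m\<close> with \<open>m m m ...\<close> in \<open>S\<close> only; then the word \<open>m\<close> is a loop, so the integer
\<open>p_m\<close> lies in \<open>I_m\<close>, and there are at most \<open>N\<close> such intervals. Three facts finish the proof:
each element of \<open>I_m\<close> is the mean of an itinerary (\<open>realise_rate\<close>); each limit of means along any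
itinerary lies in some \<open>I_m\<close>, because its prefixes are loops at a suitable letter up to a bounded
correction (\<open>cluster_rate_mem\<close>); each rational element of \<open>I_m\<close>, end points included, is the mean of a
periodic itinerary (\<open>rational_cycle\<close>), which yields a periodic point (\<open>periodic_orbit\<close>).\<close>

section \<open>Mean displacements along sequences\<close>

text \<open>The number \<open>\<alpha>\<close> is a limit of \<open>a n / n\<close> along some subsequence.\<close>

definition cluster_rate :: "(nat \<Rightarrow> real) \<Rightarrow> real \<Rightarrow> bool" where
  "cluster_rate a \<alpha> \<longleftrightarrow> (\<forall>\<epsilon>>0. \<forall>n0. \<exists>n\<ge>n0. \<bar>a n - \<alpha> * real n\<bar> \<le> \<epsilon> * real n)"

text \<open>Bounded errors and shifts of the index are negligible against \<open>n\<close>.\<close>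

lemma cluster_rate_shift:
  assumes "cluster_rate a \<alpha>" and ab: "\<And>n. \<bar>b n - a (n + k)\<bar> \<le> C"
  shows "cluster_rate b \<alpha>"
  unfolding cluster_rate_def
proof (intro allI impI)
  fix \<epsilon> :: real and n0 :: nat assume e: "\<epsilon> > 0"
  obtain K :: nat where K: "real K * \<epsilon> \<ge> 2 * (C + (\<bar>\<alpha>\<bar> + \<epsilon>) * real k)"
    by (metis e mult.commute pos_divide_le_eq real_arch_simple)
  obtain n where n: "n \<ge> n0 + k + K" "\<bar>a n - \<alpha> * real n\<bar> \<le> \<epsilon>/2 * real n"
    using assms(1) e unfolding cluster_rate_def by (metis half_gt_zero)
  define i where "i = n - k"
  have ni: "n = i + k" using n(1) i_def by simp
  have "\<bar>b i - \<alpha> * real i\<bar> \<le> \<bar>b i - a (i+k)\<bar> + \<bar>a n - \<alpha> * real n\<bar> + \<bar>\<alpha>\<bar> * real k"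
  proof -
    have "b i - \<alpha> * real i = (b i - a (i+k)) + (a n - \<alpha> * real n) + \<alpha> * real k"
      using ni by (simp add: algebra_simps)
    moreover have "\<bar>\<alpha> * real k\<bar> = \<bar>\<alpha>\<bar> * real k" by (simp add: abs_mult)
    ultimately show ?thesis by linarith
  qed
  also have "\<dots> \<le> C + \<epsilon>/2 * (real i + real k) + \<bar>\<alpha>\<bar> * real k"
    using ab[of i] n(2) ni by simp
  also have "\<dots> \<le> \<epsilon> * real i"
  proof -
    have "real K * \<epsilon> \<le> real i * \<epsilon>" using n(1) ni e by (intro mult_right_mono) auto
    moreover have "\<epsilon> * real k \<ge> 0" using e by simp
    moreover have "\<bar>\<alpha>\<bar> * real k \<ge> 0" by (rule mult_nonneg_nonneg) auto
    ultimately show ?thesis using K unfolding distrib_left distrib_right mult.commute[of _ \<epsilon>] by linarith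
  qed
  finally show "\<exists>n\<ge>n0. \<bar>b n - \<alpha> * real n\<bar> \<le> \<epsilon> * real n" using n(1) ni by (intro exI[of _ i]) auto
qed

lemma cluster_rate_of_tendsto:
  assumes r: "strict_mono r" and lim: "(\<lambda>j. a (r j) / real (r j)) \<longlonglongrightarrow> \<alpha>"
  shows "cluster_rate a \<alpha>"
  unfolding cluster_rate_def
proof (intro allI impI)
  fix \<epsilon> :: real and n0 :: nat assume e: "\<epsilon> > 0"
  obtain j0 where j0: "\<And>j. j \<ge> j0 \<Longrightarrow> \<bar>a (r j) / real (r j) - \<alpha>\<bar> < \<epsilon>"
    using LIMSEQ_D[OF lim e] by auto
  define j where "j = Suc (max j0 n0)"
  have rj: "r j \<ge> j" using r by (rule strict_mono_imp_increasing)
  then have pos: "real (r j) > 0" unfolding j_def by linarith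
  have "\<bar>a (r j) / real (r j) - \<alpha>\<bar> < \<epsilon>" using j0 unfolding j_def by simp
  then have "\<bar>a (r j) / real (r j) - \<alpha>\<bar> * real (r j) \<le> \<epsilon> * real (r j)"
    using pos by (intro mult_right_mono) auto
  also have "\<bar>a (r j) / real (r j) - \<alpha>\<bar> * real (r j) = \<bar>(a (r j) / real (r j) - \<alpha>) * real (r j)\<bar>"
    using pos by (simp add: abs_mult)
  also have "(a (r j) / real (r j) - \<alpha>) * real (r j) = a (r j) - \<alpha> * real (r j)"
    using pos by (simp add: field_simps)
  finally show "\<exists>n\<ge>n0. \<bar>a n - \<alpha> * real n\<bar> \<le> \<epsilon> * real n"
    using rj unfolding j_def by (intro exI[of _ "r j"]) (auto simp: j_def)
qed

text \<open>Bounded speed keeps the upper and the lower limit real, and both are limits along subsequences.\<close>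

lemma extreme_rates:
  assumes "\<And>n. \<bar>a n\<bar> \<le> C * real n"
  shows "\<exists>\<alpha>. limsup (\<lambda>n. ereal (a n / real n)) = ereal \<alpha> \<and> cluster_rate a \<alpha>"
    and "\<exists>\<alpha>. liminf (\<lambda>n. ereal (a n / real n)) = ereal \<alpha> \<and> cluster_rate a \<alpha>"
proof -
  let ?u = "\<lambda>n. ereal (a n / real n)"
  have C: "C \<ge> 0" using assms[of 1] by simp
  have b: "\<bar>a n / real n\<bar> \<le> C" for n
    using assms[of n] C by (cases "n = 0") (auto simp: abs_divide field_simps)
  have key: "\<exists>\<alpha>. l = ereal \<alpha> \<and> cluster_rate a \<alpha>"
    if "strict_mono r" "(?u \<circ> r) \<longlonglongrightarrow> l" for r :: "nat \<Rightarrow> nat" and l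
  proof -
    have b': "a n / real n \<le> C" "- C \<le> a n / real n" for n using b[of n] unfolding abs_le_iff by linarith+
    have 1: "l \<le> ereal C" using that(2)
      by (rule LIMSEQ_le_const2) (use b' in simp)
    have 2: "ereal (- C) \<le> l" using that(2)
      by (rule LIMSEQ_le_const) (use b' in simp)
    obtain \<alpha> where al: "l = ereal \<alpha>" using 1 2 by (cases l) auto
    have "(\<lambda>j. a (r j) / real (r j)) \<longlonglongrightarrow> \<alpha>" using that(2) al by (simp add: comp_def)
    then show ?thesis using cluster_rate_of_tendsto[OF that(1)] al by blast
  qed
  show "\<exists>\<alpha>. limsup ?u = ereal \<alpha> \<and> cluster_rate a \<alpha>"
    using limsup_subseq_lim[of ?u] key by metis
  show "\<exists>\<alpha>. liminf ?u = ereal \<alpha> \<and> cluster_rate a \<alpha>"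
    using liminf_subseq_lim[of ?u] key by metis
qed

lemma rates_cong:
  assumes ab: "\<And>n. \<bar>a n - b n\<bar> \<le> C"
  shows "limsup (\<lambda>n. ereal (a n / real n)) = limsup (\<lambda>n. ereal (b n / real n))"
    and "liminf (\<lambda>n. ereal (a n / real n)) = liminf (\<lambda>n. ereal (b n / real n))"
    and "(\<lambda>n. a n / real n) \<longlonglongrightarrow> \<alpha> \<longleftrightarrow> (\<lambda>n. b n / real n) \<longlonglongrightarrow> \<alpha>"
proof -
  let ?d = "\<lambda>n. b n / real n - a n / real n"
  have C: "C \<ge> 0" using ab[of 0] by simp
  have d: "?d \<longlonglongrightarrow> 0"
  proof (rule Lim_null_comparison)
    show "\<forall>\<^sub>F n in sequentially. norm (?d n) \<le> C / real n"
    proof (rule always_eventually, rule allI)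
      fix n show "norm (?d n) \<le> C / real n"
        using ab[of n] by (simp add: abs_minus_commute divide_right_mono flip: diff_divide_distrib)
    qed
    show "(\<lambda>n. C / real n) \<longlonglongrightarrow> 0" by (rule lim_const_over_n)
  qed
  then have d': "(\<lambda>n. ereal (?d n)) \<longlonglongrightarrow> 0" by (simp add: zero_ereal_def)
  have eq: "(\<lambda>n. ereal (b n / real n)) = (\<lambda>n. ereal (?d n) + ereal (a n / real n))" by auto
  show "limsup (\<lambda>n. ereal (a n / real n)) = limsup (\<lambda>n. ereal (b n / real n))"
    unfolding eq by (subst ereal_limsup_lim_add[OF d']) auto
  show "liminf (\<lambda>n. ereal (a n / real n)) = liminf (\<lambda>n. ereal (b n / real n))"
    unfolding eq by (subst ereal_liminf_lim_add[OF d']) auto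
  show "(\<lambda>n. a n / real n) \<longlonglongrightarrow> \<alpha> \<longleftrightarrow> (\<lambda>n. b n / real n) \<longlonglongrightarrow> \<alpha>"
  proof
    assume "(\<lambda>n. a n / real n) \<longlonglongrightarrow> \<alpha>"
    from tendsto_add[OF d this] show "(\<lambda>n. b n / real n) \<longlonglongrightarrow> \<alpha>" by simp
  next
    assume "(\<lambda>n. b n / real n) \<longlonglongrightarrow> \<alpha>"
    from tendsto_diff[OF this d] show "(\<lambda>n. a n / real n) \<longlonglongrightarrow> \<alpha>" by simp
  qed
qed

text \<open>The sequence \<open>a\<close> is cut into blocks, and block number \<open>i\<close>, of type \<open>\<rho> i\<close>, has mean increment \<open>\<alpha>\<close>
  up to \<open>\<epsilon> (\<rho> i)\<close>. The types must tend to infinity for the errors to vanish, but so slowly that a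
  single block is short compared with its past; otherwise the mean could oscillate inside long
  blocks. The choice of \<open>\<rho>\<close> depends on the lengths alone, so that it can be made before the sequence
  is constructed.\<close>

lemma block_average:
  fixes len :: "nat \<Rightarrow> nat" and \<epsilon> :: "nat \<Rightarrow> real"
  assumes len: "\<And>j. len j \<ge> 1" and eps: "\<epsilon> \<longlonglongrightarrow> 0"
  shows "\<exists>\<rho>. \<forall>a C \<alpha>.
    (\<forall>n. \<bar>a (Suc n) - a n\<bar> \<le> C) \<longrightarrow>
    (\<forall>i. \<bar>a (\<Sum>l<Suc i. len (\<rho> l)) - a (\<Sum>l<i. len (\<rho> l)) - \<alpha> * real (len (\<rho> i))\<bar>
           \<le> \<epsilon> (\<rho> i) * real (len (\<rho> i))) \<longrightarrow>
    (\<lambda>n. a n / real n) \<longlonglongrightarrow> \<alpha>"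
proof -
  \<comment> \<open>Block \<open>i\<close> starts at time \<open>T i\<close>, which is at least \<open>i\<close>, hence at least \<open>\<rho> i\<close> times its length.\<close>
  define \<rho> where "\<rho> i = Max {j. j \<le> i \<and> j * len j \<le> i}" for i
  define T where "T i = (\<Sum>l<i. len (\<rho> l))" for i
  have fin: "finite {j. j \<le> i \<and> j * len j \<le> i}" for i
    by (rule finite_subset[of _ "{..i}"]) auto
  have ne: "{j. j \<le> i \<and> j * len j \<le> i} \<noteq> {}" for i by (auto intro: exI[of _ 0])
  have rho1: "\<rho> i * len (\<rho> i) \<le> i" for i
    using Max_in[OF fin ne, of i] unfolding \<rho>_def by blast
  have rho2: "\<rho> i \<ge> j" if "i \<ge> j" "i \<ge> j * len j" for i j
    unfolding \<rho>_def using that by (intro Max_ge[OF fin]) auto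
  have rho_lim: "filterlim \<rho> at_top sequentially"
    unfolding filterlim_at_top
  proof
    fix Z show "\<forall>\<^sub>F i in sequentially. Z \<le> \<rho> i"
      using rho2 by (intro eventually_sequentiallyI[of "max Z (Z * len Z)"]) auto
  qed
  have TS: "T (Suc i) = T i + len (\<rho> i)" for i unfolding T_def by simp
  have Ti: "T i \<ge> i" for i
  proof (induction i)
    case (Suc i) then show ?case using TS[of i] len[of "\<rho> i"] by linarith
  qed simp
  have Tmono: "mono T" unfolding mono_iff_le_Suc using TS by simp
  have "(\<lambda>n. a n / real n) \<longlonglongrightarrow> \<alpha>"
    if a1: "\<And>n. \<bar>a (Suc n) - a n\<bar> \<le> C"
      and a2: "\<And>i. \<bar>a (T (Suc i)) - a (T i) - \<alpha> * real (len (\<rho> i))\<bar> \<le> \<epsilon> (\<rho> i) * real (len (\<rho> i))"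
    for a :: "nat \<Rightarrow> real" and C \<alpha>
  proof -
    define b where "b n = a n - \<alpha> * real n" for n
    define C' where "C' = C + \<bar>\<alpha>\<bar>"
    have b1: "\<bar>b (Suc n) - b n\<bar> \<le> C'" for n
      using a1[of n] unfolding b_def C'_def by (simp add: algebra_simps)
    have C'0: "C' \<ge> 0" using b1[of 0] by linarith
    have b1': "\<bar>b (n + k) - b n\<bar> \<le> C' * real k" for n k
    proof (induction k)
      case (Suc k) then show ?case using b1[of "n+k"] by (simp add: algebra_simps)
    qed simp
    have b2: "\<bar>b (T (Suc i)) - b (T i)\<bar> \<le> \<epsilon> (\<rho> i) * real (len (\<rho> i))" for i
      using a2[of i] unfolding b_def TS by (simp add: algebra_simps)
    have "(\<lambda>n. b n / real n) \<longlonglongrightarrow> 0"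
    proof (rule LIMSEQ_I)
      fix r :: real assume r: "r > 0"
      define \<delta> where "\<delta> = r / 4"
      have \<delta>: "\<delta> > 0" using r \<delta>_def by simp
      have "(\<lambda>i. \<epsilon> (\<rho> i)) \<longlonglongrightarrow> 0" using filterlim_compose[OF eps rho_lim] .
      then have ev1: "\<forall>\<^sub>F i in sequentially. \<epsilon> (\<rho> i) < \<delta>" using \<delta> by (rule order_tendstoD)
      obtain Z :: nat where Z: "real Z * \<delta> \<ge> C'" using \<delta> by (metis pos_divide_le_eq real_arch_simple)
      have ev2: "\<forall>\<^sub>F i in sequentially. Suc Z \<le> \<rho> i"
        using rho_lim unfolding filterlim_at_top by blast
      from eventually_conj[OF ev1 ev2] obtain i0 where
        i0: "\<And>i. i \<ge> i0 \<Longrightarrow> \<epsilon> (\<rho> i) < \<delta> \<and> Suc Z \<le> \<rho> i"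
        unfolding eventually_sequentially by blast
      have bT: "\<bar>b (T (i0 + k))\<bar> \<le> \<bar>b (T i0)\<bar> + \<delta> * real (T (i0 + k) - T i0)" for k
      proof (induction k)
        case (Suc k)
        have "\<bar>b (T (Suc (i0 + k)))\<bar> \<le> \<bar>b (T (i0 + k))\<bar> + \<delta> * real (len (\<rho> (i0 + k)))"
        proof -
          have "\<epsilon> (\<rho> (i0 + k)) * real (len (\<rho> (i0 + k))) \<le> \<delta> * real (len (\<rho> (i0 + k)))"
            using i0[of "i0+k"] by (intro mult_right_mono) auto
          then show ?thesis using b2[of "i0+k"] by linarith
        qed
        moreover have "T i0 \<le> T (i0 + k)" using Tmono by (simp add: monoD)
        ultimately show ?case using Suc TS[of "i0+k"]
          by (simp add: of_nat_diff algebra_simps)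
      qed simp
      obtain M :: nat where M: "real M * \<delta> \<ge> \<bar>b (T i0)\<bar>" using \<delta> by (metis pos_divide_le_eq real_arch_simple)
      show "\<exists>no. \<forall>n\<ge>no. norm (b n / real n - 0) < r"
      proof (intro exI allI impI)
        fix n assume n: "n \<ge> Suc (T i0 + M)"
        define i where "i = (GREATEST i. T i \<le> n)"
        have bnd: "\<forall>y. T y \<le> n \<longrightarrow> y \<le> n" using Ti by (meson le_trans)
        have Ti0: "T i0 \<le> n" using n by linarith
        have T1: "T i \<le> n" unfolding i_def
          by (rule GreatestI_nat[where P = "\<lambda>i. T i \<le> n", OF Ti0]) (use bnd in blast)
        have T2: "n < T (Suc i)"
        proof (rule ccontr)
          assume "\<not> n < T (Suc i)"
          then have "T (Suc i) \<le> n" by simp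
          then have "Suc i \<le> (GREATEST i. T i \<le> n)"
            by (rule Greatest_le_nat[where P = "\<lambda>i. T i \<le> n"]) (use bnd in blast)
          then show False by (simp add: i_def)
        qed
        have i0i: "i0 \<le> i" unfolding i_def
          by (rule Greatest_le_nat[where P = "\<lambda>i. T i \<le> n", OF Ti0]) (use bnd in blast)
        obtain k where k: "i = i0 + k" using i0i le_Suc_ex by blast
        have len_small: "C' * real (len (\<rho> i)) \<le> \<delta> * real n"
        proof -
          have "Z * len (\<rho> i) \<le> \<rho> i * len (\<rho> i)" using i0[OF i0i] by (intro mult_right_mono) auto
          also have "\<dots> \<le> n" using rho1[of i] Ti[of i] T1 by linarith
          finally have z: "real Z * real (len (\<rho> i)) \<le> real n" by (metis of_nat_le_iff of_nat_mult)
          have "C' * real (len (\<rho> i)) \<le> (real Z * \<delta>) * real (len (\<rho> i))"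
            using Z by (intro mult_right_mono) auto
          also have "\<dots> = \<delta> * (real Z * real (len (\<rho> i)))" by simp
          also have "\<dots> \<le> \<delta> * real n" using z \<delta> by (intro mult_left_mono) auto
          finally show ?thesis .
        qed
        have "\<bar>b n\<bar> \<le> \<bar>b (T i)\<bar> + C' * real (n - T i)"
          using b1'[of "T i" "n - T i"] T1 by simp
        also have "C' * real (n - T i) \<le> C' * real (len (\<rho> i))"
          using T2 TS[of i] C'0 by (intro mult_left_mono) auto
        also have "\<dots> \<le> \<delta> * real n" by (rule len_small)
        also have "\<bar>b (T i)\<bar> \<le> \<bar>b (T i0)\<bar> + \<delta> * real n"
        proof -
          have "\<delta> * real (T i - T i0) \<le> \<delta> * real n" using T1 \<delta> by (intro mult_left_mono) auto
          then show ?thesis using bT[of k] k by simp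
        qed
        also have "\<bar>b (T i0)\<bar> \<le> \<delta> * real n"
        proof -
          have "real M * \<delta> \<le> real n * \<delta>" using n \<delta> by (intro mult_right_mono) auto
          then show ?thesis using M by (simp add: mult.commute)
        qed
        finally have "\<bar>b n\<bar> \<le> 3 * \<delta> * real n" by simp
        moreover have "n > 0" using n by simp
        ultimately have "\<bar>b n / real n\<bar> \<le> 3 * \<delta>" by (simp add: abs_divide field_simps)
        moreover have "3 * \<delta> < r" using r unfolding \<delta>_def by simp
        ultimately show "norm (b n / real n - 0) < r" by (simp only: real_norm_def diff_0_right)
      qed
    qed
    then have "(\<lambda>n. b n / real n + \<alpha>) \<longlonglongrightarrow> 0 + \<alpha>" by (intro tendsto_add) auto
    moreover have "\<forall>\<^sub>F n in sequentially. b n / real n + \<alpha> = a n / real n"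
      unfolding b_def by (intro eventually_sequentiallyI[of 1]) (auto simp: field_simps)
    ultimately show ?thesis by (simp add: tendsto_cong)
  qed
  then show ?thesis unfolding T_def by blast
qed

section \<open>Words and sequences in lexicographic order\<close>

definition cat :: "nat list \<Rightarrow> (nat \<Rightarrow> nat) \<Rightarrow> nat \<Rightarrow> nat" where
  "cat w s n = (if n < length w then w ! n else s (n - length w))"

definition drp :: "nat \<Rightarrow> (nat \<Rightarrow> nat) \<Rightarrow> nat \<Rightarrow> nat" where
  "drp k s n = s (k + n)"

definition tk :: "nat \<Rightarrow> (nat \<Rightarrow> nat) \<Rightarrow> nat list" where
  "tk n s = map s [0..<n]"

definition per :: "nat list \<Rightarrow> nat \<Rightarrow> nat" where
  "per u n = u ! (n mod length u)"

definition lexless :: "(nat \<Rightarrow> nat) \<Rightarrow> (nat \<Rightarrow> nat) \<Rightarrow> bool" where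
  "lexless s t \<longleftrightarrow> (\<exists>j. (\<forall>i<j. s i = t i) \<and> s j < t j)"

definition lexle :: "(nat \<Rightarrow> nat) \<Rightarrow> (nat \<Rightarrow> nat) \<Rightarrow> bool" where
  "lexle s t \<longleftrightarrow> s = t \<or> lexless s t"

lemma cat_Nil [simp]: "cat [] s = s" by (auto simp: cat_def)

lemma cat_append: "cat (u @ v) s = cat u (cat v s)"
  by (auto simp: cat_def fun_eq_iff nth_append)

lemma cat_Cons: "cat (a # w) s = cat [a] (cat w s)"
  using cat_append[of "[a]" w s] by simp

lemma cat_single_0 [simp]: "cat (a # w) s 0 = a" by (simp add: cat_def)

lemma drp_0 [simp]: "drp 0 s = s" by (simp add: drp_def fun_eq_iff)

lemma drp_drp: "drp i (drp j s) = drp (j + i) s" by (simp add: drp_def fun_eq_iff add.assoc)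

lemma drp_cat [simp]: "drp (length w) (cat w s) = s" by (simp add: drp_def cat_def fun_eq_iff)

lemma length_tk [simp]: "length (tk n s) = n" by (simp add: tk_def)

lemma nth_tk [simp]: "i < n \<Longrightarrow> tk n s ! i = s i" by (simp add: tk_def)

lemma cat_tk: "cat (tk n s) (drp n s) = s" by (auto simp: cat_def drp_def fun_eq_iff)

lemma cat_tk_drp: "cat (tk n (drp k s)) (drp (k + n) s) = drp k s"
  using cat_tk[of n "drp k s"] by (simp add: drp_drp)

lemma cat_eq_iff [simp]: "cat w s = cat w t \<longleftrightarrow> s = t"
  by (metis drp_cat)

lemma cat_agree: "i < length w \<Longrightarrow> cat w s i = w ! i" by (simp add: cat_def)

lemma set_tk: "set (tk n s) = s ` {..<n}" by (auto simp: tk_def)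

lemma per_cat: "u \<noteq> [] \<Longrightarrow> cat u (per u) = per u"
  by (auto simp: cat_def per_def fun_eq_iff mod_if)

lemma per_replicate: "n > 0 \<Longrightarrow> per (replicate n a) = (\<lambda>_. a)"
  by (auto simp: per_def fun_eq_iff)

lemma per_single: "per [a] = (\<lambda>_. a)" by (auto simp: per_def fun_eq_iff)

lemma lexless_irrefl [simp]: "\<not> lexless s s" by (auto simp: lexless_def)

lemma lexle_refl [simp]: "lexle s s" by (simp add: lexle_def)

lemma lexless_imp_le: "lexless s t \<Longrightarrow> lexle s t" by (simp add: lexle_def)

lemma lexless_trans: "lexless s t \<Longrightarrow> lexless t u \<Longrightarrow> lexless s u"
  unfolding lexless_def
proof (elim exE conjE)
  fix j k assume *: "\<forall>i<j. s i = t i" "s j < t j" "\<forall>i<k. t i = u i" "t k < u k"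
  show "\<exists>j. (\<forall>i<j. s i = u i) \<and> s j < u j"
  proof (cases "j \<le> k")
    case True
    then have "s j < u j" using * by (cases "j = k") auto
    moreover have "\<forall>i<j. s i = u i" using * True by auto
    ultimately show ?thesis by blast
  next
    case False
    then have "s k < u k" using * by auto
    moreover have "\<forall>i<k. s i = u i" using * False by auto
    ultimately show ?thesis by blast
  qed
qed

lemma lexle_trans: "lexle s t \<Longrightarrow> lexle t u \<Longrightarrow> lexle s u"
  unfolding lexle_def using lexless_trans by blast

lemma lexless_le_trans: "lexless s t \<Longrightarrow> lexle t u \<Longrightarrow> lexless s u"
  unfolding lexle_def using lexless_trans by blast

lemma lexless_linear: "lexless s t \<or> s = t \<or> lexless t s"
proof (cases "s = t")
  case False
  then obtain n where "s n \<noteq> t n" by blast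
  define j where "j = (LEAST n. s n \<noteq> t n)"
  have "s j \<noteq> t j" unfolding j_def by (rule LeastI[of _ n]) fact
  moreover have "\<forall>i<j. s i = t i" unfolding j_def using not_less_Least by blast
  ultimately show ?thesis unfolding lexless_def by (metis linorder_neqE_nat)
qed simp

lemma lexle_linear: "lexle s t \<or> lexless t s" using lexless_linear lexle_def by blast

lemma lexless_0: "s 0 < t 0 \<Longrightarrow> lexless s t" by (auto simp: lexless_def intro!: exI[of _ 0])

lemma lexless_cat [simp]: "lexless (cat w s) (cat w t) \<longleftrightarrow> lexless s t"
proof
  assume "lexless (cat w s) (cat w t)"
  then obtain j where j: "\<forall>i<j. cat w s i = cat w t i" "cat w s j < cat w t j"
    unfolding lexless_def by blast
  have ge: "j \<ge> length w" using j(2) by (auto simp: cat_def split: if_splits)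
  have "\<forall>i<j - length w. s i = t i"
  proof (intro allI impI)
    fix i assume "i < j - length w"
    then have "cat w s (i + length w) = cat w t (i + length w)" using j(1) by simp
    then show "s i = t i" by (simp add: cat_def)
  qed
  then show "lexless s t" using j(2) ge unfolding lexless_def by (auto simp: cat_def)
next
  assume "lexless s t"
  then obtain j where j: "\<forall>i<j. s i = t i" "s j < t j" unfolding lexless_def by blast
  show "lexless (cat w s) (cat w t)" unfolding lexless_def
    by (rule exI[of _ "j + length w"]) (use j in \<open>auto simp: cat_def\<close>)
qed

lemma lexle_cat [simp]: "lexle (cat w s) (cat w t) \<longleftrightarrow> lexle s t"
  by (simp add: lexle_def)

text \<open>The first place where \<open>t\<close> leaves \<open>per u\<close> is also the first place where it leaves \<open>cat u t\<close>, and
  \<open>cat u t\<close> still agrees with \<open>per u\<close> there. So inserting \<open>u\<close> in front of \<open>t\<close> moves it towards \<open>per u\<close>.\<close>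

lemma per_compare:
  assumes u: "u \<noteq> []"
  shows "lexless (per u) t \<Longrightarrow> lexless (cat u t) t"
    and "lexless t (per u) \<Longrightarrow> lexless t (cat u t)"
proof -
  have eq: "cat u t j = per u j" if "\<forall>i<j. t i = per u i" for j
  proof (cases "j < length u")
    case False
    then have "j - length u < j" using u by (cases u) auto
    then have "cat u t j = per u (j - length u)" using that False by (simp add: cat_def)
    also have "\<dots> = cat u (per u) j" using False by (simp add: cat_def)
    finally show ?thesis using per_cat[OF u] by simp
  qed (simp add: cat_def per_def)
  have eq': "\<forall>i<j. cat u t i = t i" if "\<forall>i<j. t i = per u i" for j
  proof (intro allI impI)
    fix i assume i: "i < j"
    then have "\<forall>k<i. t k = per u k" using that by auto
    then have "cat u t i = per u i" by (rule eq)
    then show "cat u t i = t i" using that i by metis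
  qed
  show "lexless (cat u t) t" if less: "lexless (per u) t"
  proof -
    obtain j where j: "\<forall>i<j. per u i = t i" "per u j < t j" using less unfolding lexless_def by blast
    have s: "\<forall>i<j. t i = per u i" using j(1) by metis
    have "cat u t j < t j" using eq[OF s] j(2) by metis
    then show ?thesis unfolding lexless_def using eq'[OF s] by blast
  qed
  show "lexless t (cat u t)" if less: "lexless t (per u)"
  proof -
    obtain j where s: "\<forall>i<j. t i = per u i" "t j < per u j" using less unfolding lexless_def by blast
    have "t j < cat u t j" using eq[OF s(1)] s(2) by metis
    moreover have "\<forall>i<j. t i = cat u t i" using eq'[OF s(1)] by metis
    ultimately show ?thesis unfolding lexless_def by blast
  qed
qed

lemma per_le_cat: "u \<noteq> [] \<Longrightarrow> lexle (per u) t \<Longrightarrow> lexle (cat u t) t"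
  unfolding lexle_def using per_compare(1)[of u t] per_cat[of u] by auto

lemma le_cat_per:
  assumes "u \<noteq> []" "lexle (cat u t) t"
  shows "lexle (per u) t"
proof (rule ccontr)
  assume "\<not> lexle (per u) t"
  then have "lexless t (per u)" using lexle_linear by blast
  then have "lexless t (cat u t)" by (rule per_compare(2)[OF assms(1)])
  from lexless_le_trans[OF this assms(2)] show False by simp
qed

definition pow :: "nat list \<Rightarrow> nat \<Rightarrow> nat list" where
  "pow u n = concat (replicate n u)"

lemma pow_0 [simp]: "pow u 0 = []" by (simp add: pow_def)
lemma pow_Suc: "pow u (Suc n) = u @ pow u n" by (simp add: pow_def)
lemma length_pow [simp]: "length (pow u n) = n * length u"
  by (induction n) (simp_all add: pow_Suc)

lemma pow_per: "u \<noteq> [] \<Longrightarrow> cat (pow u n) (per u) = per u"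
  by (induction n) (simp_all add: pow_Suc cat_append per_cat)

lemma cat_pow_le: "u \<noteq> [] \<Longrightarrow> lexle (per u) t \<Longrightarrow> lexle (cat (pow u n) t) t"
proof (induction n)
  case (Suc n)
  have "lexle (cat u (cat (pow u n) t)) (cat u t)" using Suc by simp
  from lexle_trans[OF this per_le_cat[OF Suc.prems]] show ?case by (simp add: pow_Suc cat_append)
qed simp

lemma pow_agree: "u \<noteq> [] \<Longrightarrow> i < n \<Longrightarrow> cat (pow u n) t i = per u i"
proof -
  assume u: "u \<noteq> []" and i: "i < n"
  have l: "i < length (pow u n)" using u i
    by (cases u) (auto intro: less_le_trans)
  have "cat (pow u n) t i = cat (pow u n) (per u) i" using l by (simp add: cat_def)
  then show ?thesis using pow_per[OF u] by simp
qed

section \<open>Weights of words\<close>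

definition wsum :: "(nat \<Rightarrow> int) \<Rightarrow> nat list \<Rightarrow> int" where
  "wsum p w = sum_list (map p w)"

definition psum :: "(nat \<Rightarrow> int) \<Rightarrow> (nat \<Rightarrow> nat) \<Rightarrow> nat \<Rightarrow> int" where
  "psum p s n = (\<Sum>k<n. p (s k))"

lemma wsum_simps [simp]: "wsum p [] = 0" "wsum p (a # w) = p a + wsum p w"
  "wsum p (u @ v) = wsum p u + wsum p v"
  by (simp_all add: wsum_def)

lemma wsum_pow [simp]: "wsum p (pow u n) = int n * wsum p u"
  by (induction n) (simp_all add: pow_Suc algebra_simps)

lemma wsum_replicate [simp]: "wsum p (replicate n a) = int n * p a"
  by (induction n) (simp_all add: algebra_simps)

lemma wsum_tk: "wsum p (tk n s) = psum p s n"
  by (induction n) (simp_all add: tk_def psum_def)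

lemma wsum_uminus: "wsum (\<lambda>a. - p a) w = - wsum p w" by (induction w) simp_all

lemma wsum_affine: "wsum (\<lambda>a. x * p a - y) w = x * wsum p w - y * int (length w)"
  by (induction w) (simp_all add: algebra_simps)

lemma wsum_bound: "(\<And>a. a \<in> set w \<Longrightarrow> \<bar>p a\<bar> \<le> C) \<Longrightarrow> \<bar>wsum p w\<bar> \<le> C * int (length w)"
proof (induction w)
  case (Cons a w)
  then have "\<bar>p a\<bar> \<le> C" "\<bar>wsum p w\<bar> \<le> C * int (length w)" by simp_all
  then show ?case by (simp add: algebra_simps)
qed simp

lemma psum_add: "psum p s (m + n) = psum p s m + psum p (drp m s) n"
  by (induction n) (simp_all add: psum_def drp_def)

lemma psum_Suc [simp]: "psum p s (Suc n) = psum p s n + p (s n)" by (simp add: psum_def)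
lemma psum_0 [simp]: "psum p s 0 = 0" by (simp add: psum_def)

lemma tk_add: "tk (m + n) s = tk m s @ tk n (drp m s)"
  by (rule nth_equalityI) (auto simp: nth_append drp_def)

lemma tk_Suc: "tk (Suc n) s = tk n s @ [s n]" by (simp add: tk_def)

lemma tk_cat: "tk (length w) (cat w s) = w"
  by (rule nth_equalityI) (auto simp: cat_def)

section \<open>Subshifts closed under lowering the tail\<close>

text \<open>In the last axiom the first letter \<open>s 0\<close> may be followed by any sequence that is at most the one
  that follows it in \<open>s\<close>. This is the property that itineraries inherit from branches that all start
  at the minimum of the interval.\<close>

locale lower_shift =
  fixes S :: "(nat \<Rightarrow> nat) set" and L :: "nat set"
  assumes finite_letters: "finite L"
    and letters: "s \<in> S \<Longrightarrow> s n \<in> L"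
    and closed: "(\<And>n. \<exists>t\<in>S. \<forall>i<n. t i = s i) \<Longrightarrow> s \<in> S"
    and shift: "s \<in> S \<Longrightarrow> drp 1 s \<in> S"
    and lower: "s \<in> S \<Longrightarrow> t \<in> S \<Longrightarrow> lexle t (drp 1 s) \<Longrightarrow> cat [s 0] t \<in> S"
begin

lemma drp_in: "s \<in> S \<Longrightarrow> drp k s \<in> S"
proof (induction k)
  case (Suc k)
  then have "drp 1 (drp k s) \<in> S" by (intro shift) auto
  then show ?case by (simp add: drp_drp)
qed simp

lemma cat_in_tail: "cat w s \<in> S \<Longrightarrow> s \<in> S"
  using drp_in[of "cat w s" "length w"] by simp

text \<open>The letters of \<open>w\<close> are put back one by one, the last letter first.\<close>

lemma lower_word: "cat w y \<in> S \<Longrightarrow> t \<in> S \<Longrightarrow> lexle t y \<Longrightarrow> cat w t \<in> S"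
proof (induction w)
  case (Cons a w)
  have S1: "cat [a] (cat w y) \<in> S" using Cons.prems(1) by (simp only: cat_Cons[of a w])
  have "cat w t \<in> S" using cat_in_tail[OF S1] Cons by blast
  moreover have "drp 1 (cat [a] (cat w y)) = cat w y" using drp_cat[of "[a]"] by simp
  ultimately have "cat [cat [a] (cat w y) 0] (cat w t) \<in> S"
    using lower[OF S1] Cons.prems(3) by simp
  then show ?case by (simp add: cat_Cons[of a w])
qed simp

definition follow :: "nat \<Rightarrow> (nat \<Rightarrow> nat) set" where
  "follow m = {t. cat [m] t \<in> S}"

text \<open>The condition does not refer to a single sequence but to everything that may follow \<open>m\<close>, which is
  what makes concatenations of loops trivially loops.\<close>

definition loops :: "nat \<Rightarrow> nat list set" where
  "loops m = {w. w \<noteq> [] \<and> (\<forall>t\<in>follow m. cat w t \<in> follow m)}"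

lemma loopsI: "w \<noteq> [] \<Longrightarrow> (\<And>t. cat [m] t \<in> S \<Longrightarrow> cat (m # w) t \<in> S) \<Longrightarrow> w \<in> loops m"
  by (auto simp: loops_def follow_def cat_Cons[of m w])

lemma loopsD: "w \<in> loops m \<Longrightarrow> cat [m] t \<in> S \<Longrightarrow> cat (m # w) t \<in> S"
  by (auto simp: loops_def follow_def cat_Cons[of m w])

lemma loops_nonempty: "w \<in> loops m \<Longrightarrow> w \<noteq> []" by (simp add: loops_def)

lemma loops_append: "u \<in> loops m \<Longrightarrow> v \<in> loops m \<Longrightarrow> u @ v \<in> loops m"
  by (auto simp: loops_def cat_append)

lemma loops_pow: "u \<in> loops m \<Longrightarrow> n \<ge> 1 \<Longrightarrow> pow u n \<in> loops m"
proof (induction n)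
  case (Suc n)
  then show ?case using loops_append by (cases "n = 0") (auto simp: pow_Suc)
qed simp

text \<open>Finite concatenations of loops are allowed after \<open>m\<close>, and \<open>S\<close> is closed.\<close>

lemma infinite_concat:
  assumes W: "\<And>i. W i \<in> loops m" and ne: "follow m \<noteq> {}"
  shows "\<exists>s\<in>S. \<forall>i. tk (\<Sum>l<i. length (W l)) s = concat (map W [0..<i])"
proof -
  define c where "c i = concat (map W [0..<i])" for i
  have cS: "c (Suc i) = c i @ W i" for i by (simp add: c_def)
  have lc: "length (c i) = (\<Sum>l<i. length (W l))" for i
    by (induction i) (simp_all add: cS, simp add: c_def)
  have li: "length (c i) \<ge> i" for i
  proof (induction i)
    case (Suc i)
    have "length (W i) \<ge> 1" using loops_nonempty[OF W] by (simp add: Suc_leI)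
    then show ?case using Suc by (simp add: cS)
  qed simp
  define s where "s n = c (Suc n) ! n" for n
  have cc: "c (i + k) ! n = c i ! n" if "n < length (c i)" for i k n
  proof (induction k)
    case (Suc k)
    have "length (c i) \<le> length (c (i + k))" by (simp add: lc sum_mono2)
    then show ?case using Suc that by (simp add: cS nth_append)
  qed simp
  have sc: "s n = c i ! n" if "n < length (c i)" for i n
  proof (cases "i \<le> Suc n")
    case True
    then obtain k where "Suc n = i + k" using le_Suc_ex by blast
    then show ?thesis unfolding s_def using cc[OF that, of k] by simp
  next
    case False
    then obtain k where k: "i = Suc n + k" by (metis le_Suc_ex nat_le_linear)
    have "n < length (c (Suc n))" using li[of "Suc n"] by simp
    then show ?thesis unfolding s_def k using cc by metis
  qed
  obtain t where t: "t \<in> follow m" using ne by blast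
  have ct: "cat (c i) t \<in> follow m" if "t \<in> follow m" for i t using that
  proof (induction i arbitrary: t)
    case 0 then show ?case by (simp add: c_def)
  next
    case (Suc i)
    have "cat (W i) t \<in> follow m" using W[of i] Suc.prems by (simp add: loops_def)
    then show ?case using Suc.IH by (simp add: cS cat_append)
  qed
  have "s \<in> S"
  proof (rule closed)
    fix n
    have "cat (c n) t \<in> S" using ct[OF t, of n] cat_in_tail unfolding follow_def by blast
    moreover have "\<forall>i<n. cat (c n) t i = s i"
    proof (intro allI impI)
      fix i assume "i < n"
      then have "i < length (c n)" using li[of n] by simp
      then show "cat (c n) t i = s i" using sc by (simp add: cat_agree)
    qed
    ultimately show "\<exists>t\<in>S. \<forall>i<n. t i = s i" by blast
  qed
  moreover have "tk (\<Sum>l<i. length (W l)) s = c i" for i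
    by (rule nth_equalityI) (simp_all add: lc[symmetric] sc)
  ultimately show ?thesis unfolding c_def by blast
qed

lemma per_in_of_pow:
  assumes u: "u \<noteq> []" and "\<And>n. \<exists>t. cat (w @ pow u n) t \<in> S"
  shows "cat w (per u) \<in> S"
proof (rule closed)
  fix n
  obtain t where t: "cat (w @ pow u n) t \<in> S" using assms(2) by blast
  have "cat (w @ pow u n) t i = cat w (per u) i" if "i < n" for i
  proof (cases "i < length w")
    case False
    then have "cat (w @ pow u n) t i = cat (pow u n) t (i - length w)"
      by (simp add: cat_append) (simp add: cat_def)
    also have "\<dots> = per u (i - length w)" using that by (intro pow_agree[OF u]) simp
    finally show ?thesis using False by (simp add: cat_def)
  qed (simp add: cat_append, simp add: cat_def)
  then show "\<exists>t\<in>S. \<forall>i<n. t i = cat w (per u) i" using t by blast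
qed

lemma per_loop_in:
  assumes w: "w \<in> loops m" and ne: "follow m \<noteq> {}"
  shows "cat [m] (per w) \<in> S"
proof (rule per_in_of_pow[OF loops_nonempty[OF w]])
  fix n
  obtain t where t: "cat [m] t \<in> S" using ne by (auto simp: follow_def)
  have "cat ([m] @ pow w n) t \<in> S"
  proof (cases "n = 0")
    case False
    then show ?thesis using loopsD[OF loops_pow[OF w] t, of n] by simp
  qed (use t in simp)
  then show "\<exists>t. cat ([m] @ pow w n) t \<in> S" by blast
qed

text \<open>If \<open>t\<close> is at least the constant sequence, then inserting one more \<open>m\<close> lowers \<open>m t\<close>; otherwise the
  result stays below the constant sequence. Both are allowed after \<open>m\<close>.\<close>

lemma self_loop:
  assumes "(\<lambda>_. m) \<in> S"
  shows "[m] \<in> loops m"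
proof (rule loopsI)
  fix t assume t: "cat [m] t \<in> S"
  let ?c = "\<lambda>_::nat. m"
  have c: "cat [m] ?c = ?c" using per_cat[of "[m]"] by (simp add: per_single)
  have "cat [m] (cat [m] t) \<in> S"
  proof (cases "lexle ?c t")
    case True
    then have "lexle (cat [m] t) t" using per_le_cat[of "[m]" t] by (simp add: per_single)
    then show ?thesis using lower_word[OF t t] by blast
  next
    case False
    then have "lexle t ?c" using lexle_linear lexless_imp_le by blast
    then have "lexle (cat [m] t) ?c" using lexle_cat[of "[m]" t ?c] c by metis
    moreover have "cat [m] ?c \<in> S" using assms c by simp
    ultimately show ?thesis using lower_word[OF _ t] by blast
  qed
  then show "cat [m, m] t \<in> S" by (simp add: cat_Cons[of m "[m]"])
qed simp

lemma follow_const: "(\<lambda>_. m) \<in> S \<Longrightarrow> (\<lambda>_. m) \<in> follow m"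
  using per_cat[of "[m]"] by (simp add: per_single follow_def)

section \<open>Rotation intervals of a letter\<close>

definition avgs :: "(nat \<Rightarrow> int) \<Rightarrow> nat \<Rightarrow> real set" where
  "avgs p m = (\<lambda>w. of_int (wsum p w) / real (length w)) ` loops m"

definition rot_interval :: "(nat \<Rightarrow> int) \<Rightarrow> nat \<Rightarrow> real set" where
  "rot_interval p m = {Inf (avgs p m)..Sup (avgs p m)}"

lemma loop_letters:
  assumes "follow m \<noteq> {}" "A @ w @ B \<in> loops m" shows "set w \<subseteq> L"
proof -
  obtain t where "cat [m] t \<in> S" using assms(1) by (auto simp: follow_def)
  then have "cat ((m # A) @ w @ B) t \<in> S" using loopsD[OF assms(2)] by simp
  then have wS: "cat w (cat B t) \<in> S" unfolding cat_append by (rule cat_in_tail)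
  show ?thesis
  proof
    fix a assume "a \<in> set w"
    then obtain i where "i < length w" "w ! i = a" by (auto simp: in_set_conv_nth)
    then show "a \<in> L" using letters[OF wS, of i] by (simp add: cat_def)
  qed
qed

lemma weight_bound: "\<exists>C. \<forall>a\<in>L. \<bar>p a\<bar> \<le> (C::int)"
proof -
  have "finite ((\<lambda>a. \<bar>p a\<bar>) ` L)" using finite_letters by simp
  then show ?thesis by (meson Max_ge finite_imageI imageI)
qed

lemma avgs_bounded:
  assumes "follow m \<noteq> {}"
  shows "\<exists>C. \<forall>x\<in>avgs p m. \<bar>x\<bar> \<le> C"
proof -
  obtain C where C: "\<forall>a\<in>L. \<bar>p a\<bar> \<le> C" using weight_bound by blast
  have "\<bar>of_int (wsum p w) / real (length w)\<bar> \<le> of_int C" if w: "w \<in> loops m" for w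
  proof -
    have "\<bar>wsum p w\<bar> \<le> C * int (length w)"
      using loop_letters[OF assms, of "[]" w "[]"] w C by (intro wsum_bound) auto
    then have "real_of_int \<bar>wsum p w\<bar> \<le> of_int (C * int (length w))" by (simp only: of_int_le_iff)
    then show ?thesis using loops_nonempty[OF w] by (simp add: abs_divide field_simps)
  qed
  then show ?thesis unfolding avgs_def by (intro exI[of _ "of_int C"]) auto
qed

lemma avg_mem:
  assumes "follow m \<noteq> {}" "w \<in> loops m"
  shows "of_int (wsum p w) / real (length w) \<in> rot_interval p m"
proof -
  have m: "of_int (wsum p w) / real (length w) \<in> avgs p m" using assms(2) by (simp add: avgs_def)
  obtain C where "\<forall>x\<in>avgs p m. \<bar>x\<bar> \<le> C" using avgs_bounded[OF assms(1)] by blast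
  then have "bdd_above (avgs p m)" "bdd_below (avgs p m)"
    by (auto simp: bdd_above_def bdd_below_def abs_le_iff intro: exI[of _ C] exI[of _ "-C"])
      (metis minus_le_iff)
  then show ?thesis unfolding rot_interval_def using m cInf_lower cSup_upper by auto
qed

text \<open>The number of repetitions of each loop is the deviation of the other one, so that the deviations
  cancel.\<close>

lemma mix_loops:
  assumes u: "u \<in> loops m" and v: "v \<in> loops m" and q: "(q::int) > 0"
    and le: "q * wsum p u \<le> a * int (length u)" "a * int (length v) \<le> q * wsum p v"
  shows "\<exists>w\<in>loops m. q * wsum p w = a * int (length w)"
proof (cases "q * wsum p u = a * int (length u) \<or> q * wsum p v = a * int (length v)")
  case True then show ?thesis using u v by blast
next
  case False
  define x where "x = nat (q * wsum p v - a * int (length v))"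
  define y where "y = nat (a * int (length u) - q * wsum p u)"
  have xy: "int x = q * wsum p v - a * int (length v)" "int y = a * int (length u) - q * wsum p u"
    using le unfolding x_def y_def by auto
  have "x \<ge> 1" "y \<ge> 1" using False le unfolding x_def y_def by auto
  then have "pow u x @ pow v y \<in> loops m" using u v loops_pow loops_append by blast
  moreover have "q * wsum p (pow u x @ pow v y) = a * int (length (pow u x @ pow v y))"
    by (simp add: xy algebra_simps)
  ultimately show ?thesis by blast
qed

text \<open>If the means of loops avoided a neighbourhood of \<open>\<alpha>\<close>, there would be means on both sides of it and
  a rational in it, which some mixture attains.\<close>

lemma loop_approx:
  assumes ne: "follow m \<noteq> {}" "loops m \<noteq> {}" and al: "\<alpha> \<in> rot_interval p m" and e: "\<epsilon> > 0"
  shows "\<exists>w\<in>loops m. \<bar>of_int (wsum p w) - \<alpha> * real (length w)\<bar> \<le> \<epsilon> * real (length w)"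
proof (rule ccontr)
  assume neg: "\<not> ?thesis"
  have far: "\<epsilon> < \<bar>x - \<alpha>\<bar>" if "x \<in> avgs p m" for x
  proof -
    obtain w where w: "w \<in> loops m" "x = of_int (wsum p w) / real (length w)"
      using \<open>x \<in> avgs p m\<close> unfolding avgs_def by blast
    have l: "real (length w) > 0" using loops_nonempty[OF w(1)] by simp
    have "\<bar>x - \<alpha>\<bar> * real (length w) = \<bar>(x - \<alpha>) * real (length w)\<bar>" using l by (simp add: abs_mult)
    also have "(x - \<alpha>) * real (length w) = of_int (wsum p w) - \<alpha> * real (length w)"
      using l w(2) by (simp add: field_simps)
    also have "\<bar>\<dots>\<bar> > \<epsilon> * real (length w)" using neg w(1) by (simp add: not_le)
    finally show ?thesis using l by simp
  qed
  have A: "avgs p m \<noteq> {}" using ne(2) by (simp add: avgs_def)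
  obtain x1 where x1: "x1 \<in> avgs p m" "x1 < \<alpha> + \<epsilon>"
  proof -
    have "Inf (avgs p m) < \<alpha> + \<epsilon>" using al e by (simp add: rot_interval_def)
    from cInf_lessD[OF A this] show ?thesis using that by blast
  qed
  obtain x2 where x2: "x2 \<in> avgs p m" "\<alpha> - \<epsilon> < x2"
  proof -
    have "\<alpha> - \<epsilon> < Sup (avgs p m)" using al e by (simp add: rot_interval_def)
    from less_cSupD[OF A this] show ?thesis using that by blast
  qed
  have x12: "x1 < \<alpha> - \<epsilon>" "\<alpha> + \<epsilon> < x2" using far[OF x1(1)] far[OF x2(1)] x1 x2 e by (auto simp: abs_if split: if_splits)
  obtain r where r: "r \<in> \<rat>" "\<alpha> < r" "r < \<alpha> + \<epsilon>" using Rats_dense_in_real[of \<alpha> "\<alpha> + \<epsilon>"] e by auto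
  obtain a q where aq: "q > 0" "r = of_int a / of_int q" using r(1) by (rule Rats_cases')
  obtain u where u: "u \<in> loops m" "x1 = of_int (wsum p u) / real (length u)"
    using x1(1) unfolding avgs_def by blast
  obtain v where v: "v \<in> loops m" "x2 = of_int (wsum p v) / real (length v)"
    using x2(1) unfolding avgs_def by blast
  have lu: "real (length u) > 0" "real (length v) > 0" "real_of_int q > 0"
    using loops_nonempty u(1) v(1) aq by auto
  have "x1 < r" "r < x2" using x12 r e by auto
  then have "real_of_int (q * wsum p u) \<le> of_int (a * int (length u))"
    "real_of_int (a * int (length v)) \<le> of_int (q * wsum p v)"
    using lu unfolding u(2) v(2) aq(2) by (simp_all add: field_simps)
  then have "q * wsum p u \<le> a * int (length u)" "a * int (length v) \<le> q * wsum p v"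
    by (simp_all only: of_int_le_iff)
  from mix_loops[OF u(1) v(1) aq(1) this] obtain w where
    w: "w \<in> loops m" "q * wsum p w = a * int (length w)" by blast
  have lw: "real (length w) > 0" using loops_nonempty[OF w(1)] by simp
  have "real_of_int q * of_int (wsum p w) = of_int a * real (length w)"
    using w(2) by (metis of_int_mult of_int_of_nat_eq)
  then have "r = of_int (wsum p w) / real (length w)" using lw lu unfolding aq(2)
    by (subst frac_eq_eq) (auto simp: mult.commute)
  then have "r \<in> avgs p m" using w(1) by (simp add: avgs_def)
  then show False using far[of r] r by simp
qed

lemma closure_mem:
  assumes ne: "follow m \<noteq> {}"
    and "\<And>\<epsilon>. \<epsilon> > 0 \<Longrightarrow> \<exists>w\<in>loops m. \<bar>of_int (wsum p w) - \<alpha> * real (length w)\<bar> \<le> \<epsilon> * real (length w)"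
  shows "\<alpha> \<in> rot_interval p m"
proof -
  have "Inf (avgs p m) \<le> \<alpha> + \<epsilon> \<and> \<alpha> - \<epsilon> \<le> Sup (avgs p m)" if e: "\<epsilon> > 0" for \<epsilon>
  proof -
    obtain w where w: "w \<in> loops m" "\<bar>of_int (wsum p w) - \<alpha> * real (length w)\<bar> \<le> \<epsilon> * real (length w)"
      using assms(2)[OF e] by blast
    have l: "real (length w) > 0" using loops_nonempty[OF w(1)] by simp
    have "of_int (wsum p w) / real (length w) \<le> \<alpha> + \<epsilon>" "\<alpha> - \<epsilon> \<le> of_int (wsum p w) / real (length w)"
      using w(2) l unfolding abs_le_iff by (simp_all add: field_simps)
    then show ?thesis using avg_mem[OF ne w(1), of p] unfolding rot_interval_def by auto
  qed
  then have "Inf (avgs p m) \<le> \<alpha>" "\<alpha> \<le> Sup (avgs p m)"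
    by (meson field_le_epsilon, meson diff_le_eq field_le_epsilon)
  then show ?thesis by (simp add: rot_interval_def)
qed

lemma realise_rate:
  assumes ne: "follow m \<noteq> {}" "loops m \<noteq> {}" and al: "\<alpha> \<in> rot_interval p m"
  shows "\<exists>s\<in>S. (\<lambda>n. of_int (psum p s n) / real n) \<longlonglongrightarrow> \<alpha>"
proof -
  have "\<exists>w\<in>loops m. \<bar>of_int (wsum p w) - \<alpha> * real (length w)\<bar> \<le> 1 / real (Suc j) * real (length w)" for j
    by (rule loop_approx[OF ne al]) simp
  then obtain W where W: "\<And>j. W j \<in> loops m"
    "\<And>j. \<bar>of_int (wsum p (W j)) - \<alpha> * real (length (W j))\<bar> \<le> 1 / real (Suc j) * real (length (W j))"
    by metis
  have len: "length (W j) \<ge> 1" for j using loops_nonempty[OF W(1)] by (simp add: Suc_leI)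
  have eps: "(\<lambda>j. 1 / real (Suc j)) \<longlonglongrightarrow> 0"
    using lim_const_over_n[of "1::real"] LIMSEQ_Suc by fastforce
  obtain \<rho> where rho: "\<forall>a C \<alpha>.
    (\<forall>n. \<bar>a (Suc n) - a n\<bar> \<le> C) \<longrightarrow>
    (\<forall>i. \<bar>a (\<Sum>l<Suc i. length (W (\<rho> l))) - a (\<Sum>l<i. length (W (\<rho> l))) - \<alpha> * real (length (W (\<rho> i)))\<bar>
           \<le> 1 / real (Suc (\<rho> i)) * real (length (W (\<rho> i)))) \<longrightarrow>
    (\<lambda>n. a n / real n) \<longlonglongrightarrow> \<alpha>"
    by (rule exE[OF block_average[OF len eps]])
  obtain s where s: "s \<in> S"
    "\<And>i. tk (\<Sum>l<i. length (W (\<rho> l))) s = concat (map (W \<circ> \<rho>) [0..<i])"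
    using infinite_concat[of "W \<circ> \<rho>" m] W(1) ne by auto
  obtain C where C: "\<forall>a\<in>L. \<bar>p a\<bar> \<le> C" using weight_bound by blast
  have "(\<lambda>n. of_int (psum p s n) / real n) \<longlonglongrightarrow> \<alpha>"
  proof (rule rho[THEN spec, THEN spec, THEN spec, THEN mp, THEN mp])
    show "\<forall>n. \<bar>real_of_int (psum p s (Suc n)) - of_int (psum p s n)\<bar> \<le> of_int C"
    proof
      fix n have "\<bar>p (s n)\<bar> \<le> C" using C letters[OF s(1)] by blast
      then show "\<bar>real_of_int (psum p s (Suc n)) - of_int (psum p s n)\<bar> \<le> of_int C"
        by (simp add: of_int_abs[symmetric] del: of_int_abs)
    qed
    show "\<forall>i. \<bar>real_of_int (psum p s (\<Sum>l<Suc i. length (W (\<rho> l)))) - of_int (psum p s (\<Sum>l<i. length (W (\<rho> l))))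
       - \<alpha> * real (length (W (\<rho> i)))\<bar> \<le> 1 / real (Suc (\<rho> i)) * real (length (W (\<rho> i)))"
    proof
      fix i
      have "psum p s (\<Sum>l<Suc i. length (W (\<rho> l))) = psum p s (\<Sum>l<i. length (W (\<rho> l))) + wsum p (W (\<rho> i))"
        unfolding wsum_tk[symmetric] s(2) by simp
      then show "\<bar>real_of_int (psum p s (\<Sum>l<Suc i. length (W (\<rho> l)))) - of_int (psum p s (\<Sum>l<i. length (W (\<rho> l))))
       - \<alpha> * real (length (W (\<rho> i)))\<bar> \<le> 1 / real (Suc (\<rho> i)) * real (length (W (\<rho> i)))"
        using W(2)[of "\<rho> i"] by simp
    qed
  qed
  then show ?thesis using s(1) by blast
qed

end

section \<open>Means along arbitrary sequences\<close>

lemma const_less_cat: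
  assumes "\<forall>a\<in>set v. b \<le> a" "\<exists>a\<in>set v. b < a"
  shows "lexless (\<lambda>_. b) (cat v t)"
  using assms
proof (induction v)
  case (Cons a v)
  show ?case
  proof (cases "b < a")
    case False
    then have ab: "a = b" using Cons.prems(1) by force
    have "lexless (\<lambda>_. b) (cat v t)" using Cons False by auto
    then have "lexless (cat [b] (\<lambda>_. b)) (cat [b] (cat v t))" by simp
    moreover have "cat [b] (\<lambda>_. b) = (\<lambda>_. b)" using per_cat[of "[b]"] by (simp add: per_single)
    ultimately show ?thesis by (simp add: ab cat_Cons[of b v])
  qed (simp add: lexless_0)
qed simp

lemma cat_pow_single_0: "k \<ge> 1 \<Longrightarrow> cat (pow [b] k) y 0 = b"
  using pow_agree[of "[b]" 0 k y] by (simp add: per_def)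

context lower_shift
begin

text \<open>Every prefix of \<open>x\<close> is a loop at \<open>m\<close> up to a bounded change of length and weight. In the prefix,
  the last letter different from \<open>b\<close> is lowered to \<open>b\<close>; after this the past allows
  every continuation in \<open>S\<close> that starts with this \<open>b\<close>. From there a word \<open>B\<close> read off \<open>x\<close>, preceded by as many \<open>b\<close>'s as needed, leads
  to \<open>m\<close>: it stops just before an occurrence of \<open>c\<close>, and \<open>c\<close> may be lowered to \<open>m\<close>. The word \<open>B\<close>
  itself contains a letter above \<open>b\<close>, so that more \<open>b\<close>'s in front of it only lower the sequence.\<close>

lemma exit_loop:
  assumes mx: "cat [m] x \<in> S" and bc: "\<And>n. b \<le> x n" "\<And>n. x n \<le> c"
    and m: "m < c" and b: "b < c" and x0: "x 0 = c"
    and q: "x q = b" "q < q1" "q1 < q2" "x q1 = c" "x q2 = c"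
  shows "\<exists>K K'. \<forall>n\<ge>1. \<exists>w\<in>loops m. length w = n + K' \<and> \<bar>wsum p w - psum p x n\<bar> \<le> K"
proof -
  \<comment> \<open>The letters of \<open>x\<close> strictly between the places \<open>q\<close> and \<open>q2\<close>; one of them, at \<open>q1\<close>, is \<open>c\<close>.\<close>
  define B where "B = tk (q2 - Suc q) (drp (Suc q) x)"
  have xS: "x \<in> S" using mx by (rule cat_in_tail)
  have dS: "cat [b] (cat B (drp q2 x)) \<in> S"
  proof -
    have "cat B (drp q2 x) = drp (Suc q) x"
      using cat_tk_drp[of "q2 - Suc q" "Suc q" x] q unfolding B_def by simp
    moreover have "cat [b] (drp (Suc q) x) = drp q x"
      using q(1) by (auto simp: cat_def drp_def fun_eq_iff)
    ultimately show ?thesis using drp_in[OF xS, of q] by simp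
  qed
  have Bge: "\<forall>a\<in>set (B @ [c]). b \<le> a" unfolding B_def set_append set_tk using bc b by (auto simp: drp_def)
  have Bc: "c \<in> set B" unfolding B_def set_tk
  proof (rule image_eqI)
    show "c = drp (Suc q) x (q1 - Suc q)" using q by (simp add: drp_def)
    show "q1 - Suc q \<in> {..<q2 - Suc q}" using q by auto
  qed
  have y: "cat (pow [b] (Suc k)) (cat (B @ [m]) t) \<in> S" if t: "cat [m] t \<in> S" for k t
  proof -
    let ?y = "cat (B @ [m]) t"
    have yS: "cat [b] ?y \<in> S"
    proof -
      have "lexle (cat [m] t) (drp q2 x)"
        using m q(5) by (intro lexless_imp_le lexless_0) (simp add: drp_def)
      moreover have "cat ([b] @ B) (drp q2 x) \<in> S" using dS by (simp only: cat_append)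
      ultimately have "cat ([b] @ B) (cat [m] t) \<in> S" using lower_word t by blast
      then show ?thesis by (simp only: cat_append)
    qed
    have "lexless (\<lambda>_. b) (cat B (cat [m] t))" using Bge Bc b by (intro const_less_cat) auto
    then have "lexle (per [b]) ?y" by (simp add: per_single cat_append lexless_imp_le)
    then have le: "lexle (cat (pow [b] k) ?y) ?y" for k by (intro cat_pow_le) simp_all
    show ?thesis
    proof (induction k)
      case 0 then show ?case using yS by (simp add: pow_Suc)
    next
      case (Suc k)
      have "cat [b] (cat (pow [b] (Suc k)) ?y) \<in> S" using lower_word[OF yS Suc le] .
      then show ?case by (simp only: pow_Suc[of "[b]" "Suc k"] cat_append)
    qed
  qed
  obtain C where C: "\<forall>a\<in>L. \<bar>p a\<bar> \<le> C" using weight_bound by blast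
  define K where "K = \<bar>p b\<bar> + C + \<bar>wsum p (B @ [m])\<bar>"
  have "\<exists>w\<in>loops m. length w = n + length (B @ [m]) \<and> \<bar>wsum p w - psum p x n\<bar> \<le> K" if n: "n \<ge> 1" for n
  proof -
    define h where "h = Max {k. k < n \<and> x k \<noteq> b}"
    have fin: "finite {k. k < n \<and> x k \<noteq> b}" by simp
    have "0 \<in> {k. k < n \<and> x k \<noteq> b}" using n x0 b by simp
    then have "h \<in> {k. k < n \<and> x k \<noteq> b}" unfolding h_def using Max_in[OF fin] by blast
    then have h: "h < n" "x h \<noteq> b" by auto
    have hb: "x k = b" if "h < k" "k < n" for k
    proof (rule ccontr)
      assume "x k \<noteq> b"
      then have "k \<le> h" unfolding h_def using that(2) by (intro Max_ge[OF fin]) simp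
      then show False using that(1) by simp
    qed
    obtain k where k: "n = h + Suc k" using h(1) less_imp_Suc_add by fastforce
    define w where "w = tk h x @ pow [b] (Suc k) @ B @ [m]"
    have "w \<in> loops m"
    proof (rule loopsI)
      fix t assume t: "cat [m] t \<in> S"
      have "lexle (cat (pow [b] (Suc k)) (cat (B @ [m]) t)) (drp h x)"
        using bc(1)[of h] h(2) by (intro lexless_imp_le lexless_0) (simp add: cat_pow_single_0 drp_def)
      moreover have "cat ([m] @ tk h x) (drp h x) \<in> S" unfolding cat_append cat_tk by (rule mx)
      ultimately have "cat ([m] @ tk h x) (cat (pow [b] (Suc k)) (cat (B @ [m]) t)) \<in> S"
        using y[OF t] lower_word by blast
      then show "cat (m # w) t \<in> S" by (simp add: w_def flip: cat_append)
    qed (simp add: w_def)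
    moreover have "length w = n + length (B @ [m])" by (simp add: w_def k)
    moreover have "psum p x n = psum p x h + p (x h) + int k * p b"
    proof -
      have 1: "psum p x n = psum p x (Suc h) + psum p (drp (Suc h) x) k"
        unfolding psum_add[symmetric] k by simp
      have "psum p (drp (Suc h) x) k = (\<Sum>i<k. p b)"
        unfolding psum_def by (rule sum.cong) (use hb k in \<open>auto simp: drp_def\<close>)
      then show ?thesis using 1 by simp
    qed
    then have "wsum p w - psum p x n = p b - p (x h) + wsum p (B @ [m])"
      by (simp add: w_def wsum_tk algebra_simps)
    then have "\<bar>wsum p w - psum p x n\<bar> \<le> K"
      using C letters[OF xS, of h] unfolding K_def by (smt (verit))
    ultimately show ?thesis by blast
  qed
  then show ?thesis by blast
qed

lemma psum_drp_rate:
  assumes "cluster_rate (\<lambda>n. of_int (psum p s n)) \<alpha>"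
  shows "cluster_rate (\<lambda>n. of_int (psum p (drp k s) n)) \<alpha>"
proof (rule cluster_rate_shift[OF assms])
  fix n show "\<bar>real_of_int (psum p (drp k s) n) - of_int (psum p s (n + k))\<bar> \<le> \<bar>of_int (psum p s k)\<bar>"
    using psum_add[of p s k n] by (simp add: add.commute)
qed

text \<open>Unless \<open>s\<close> is constant from some place on, the least and the greatest letter that occur infinitely
  often differ, and the greatest one is preceded at some late place by a smaller letter \<open>m\<close>. Behind that
  place \<open>exit_loop\<close> applies.\<close>

lemma cluster_rate_mem:
  assumes s: "s \<in> S" and cl: "cluster_rate (\<lambda>n. of_int (psum p s n)) \<alpha>"
  shows "\<exists>m. (\<lambda>_. m) \<in> S \<and> \<alpha> \<in> rot_interval p m"
proof -
  define R where "R = {a. \<forall>n0. \<exists>n\<ge>n0. s n = a}"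
  have RL: "R \<subseteq> L" using letters[OF s] unfolding R_def by blast
  then have finR: "finite R" using finite_letters finite_subset by blast
  obtain n0 where n0: "\<And>n. n \<ge> n0 \<Longrightarrow> s n \<in> R"
  proof -
    have "\<exists>N. \<forall>n\<ge>N. s n \<noteq> a" if "a \<in> L - R" for a using that unfolding R_def by blast
    then obtain N where N: "\<And>a n. a \<in> L - R \<Longrightarrow> n \<ge> N a \<Longrightarrow> s n \<noteq> a" by metis
    define n0 where "n0 = (\<Sum>a\<in>L - R. N a)"
    have "s n \<in> R" if "n \<ge> n0" for n
    proof (rule ccontr)
      assume "s n \<notin> R"
      then have a: "s n \<in> L - R" using letters[OF s] by blast
      then have "N (s n) \<le> n0" unfolding n0_def by (intro member_le_sum) (auto simp: finite_letters)
      then show False using N[OF a, of n] that by simp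
    qed
    then show ?thesis using that by blast
  qed
  define b c where "b = Min R" and "c = Max R"
  have Rne: "R \<noteq> {}" using n0 by blast
  have bR: "b \<in> R" "c \<in> R" unfolding b_def c_def using finR Rne by auto
  have rng: "b \<le> s n" "s n \<le> c" if "n \<ge> n0" for n
    unfolding b_def c_def using n0[OF that] finR by auto
  show ?thesis
  proof (cases "b = c")
    case True
    have const: "drp n0 s = (\<lambda>_. b)" 
    proof (rule ext)
      fix k
      have "b \<le> s (n0 + k)" "s (n0 + k) \<le> c" using rng[of "n0 + k"] by simp_all
      then show "drp n0 s k = b" using True by (simp add: drp_def)
    qed
    then have bS: "(\<lambda>_. b) \<in> S" using drp_in[OF s] by metis
    have "\<alpha> \<in> rot_interval p b"
    proof (rule closure_mem)
      show "follow b \<noteq> {}" using follow_const[OF bS] by blast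
      fix \<epsilon> :: real assume e: "\<epsilon> > 0"
      obtain n where n: "n \<ge> 1" "\<bar>of_int (psum p (drp n0 s) n) - \<alpha> * real n\<bar> \<le> \<epsilon> * real n"
        using psum_drp_rate[OF cl, of n0] e unfolding cluster_rate_def by blast
      have "psum p (drp n0 s) n = int n * p b" unfolding const psum_def by simp
      then have "\<bar>of_int (wsum p (pow [b] n)) - \<alpha> * real (length (pow [b] n))\<bar> \<le> \<epsilon> * real (length (pow [b] n))"
        using n(2) by simp
      then show "\<exists>w\<in>loops b. \<bar>of_int (wsum p w) - \<alpha> * real (length w)\<bar> \<le> \<epsilon> * real (length w)"
        using loops_pow[OF self_loop[OF bS] n(1)] by blast
    qed
    then show ?thesis using bS by blast
  next
    case False
    then have bc: "b < c" using rng[of n0] by simp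
    have inf: "\<exists>n\<ge>k. s n = b" "\<exists>n\<ge>k. s n = c" for k using bR unfolding R_def by blast+
    obtain n where n: "n \<ge> n0" "s n = b" using inf(1) by blast
    define n' where "n' = (LEAST k. k > n \<and> s k = c)"
    have ex: "\<exists>k. k > n \<and> s k = c" using inf(2)[of "Suc n"] by (auto simp: Suc_le_eq)
    have n': "n' > n" "s n' = c" unfolding n'_def using LeastI_ex[OF ex] by auto
    define m where "m = s (n' - 1)"
    have mc: "m < c"
    proof (cases "n' - 1 = n")
      case False
      then have "s (n' - 1) \<noteq> c" using not_less_Least[of "n' - 1" "\<lambda>k. k > n \<and> s k = c"] n'(1)
        unfolding n'_def[symmetric] by auto
      moreover have "s (n' - 1) \<le> c" using rng(2)[of "n' - 1"] n'(1) n(1) by simp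
      ultimately show ?thesis unfolding m_def by simp
    qed (simp add: m_def n bc)
    define x where "x = drp n' s"
    have mx: "cat [m] x \<in> S"
    proof -
      have "cat [m] x = drp (n' - 1) s" unfolding x_def m_def
        using n'(1) by (auto simp: cat_def drp_def fun_eq_iff)
      then show ?thesis using drp_in[OF s] by simp
    qed
    have xr: "b \<le> x k" "x k \<le> c" for k using rng[of "n' + k"] n'(1) n(1) by (simp_all add: x_def drp_def)
    have x0: "x 0 = c" by (simp add: x_def drp_def n')
    have xinf: "\<exists>n\<ge>k. x n = a" if a: "a = b \<or> a = c" for k a
    proof -
      obtain i where "i \<ge> n' + k" "s i = a" using inf[of "n' + k"] a by blast
      then show ?thesis by (intro exI[of _ "i - n'"]) (auto simp: x_def drp_def)
    qed
    obtain q where q: "x q = b" using xinf by blast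
    obtain q1 where q1: "q1 \<ge> Suc q" "x q1 = c" using xinf by blast
    obtain q2 where q2: "q2 \<ge> Suc q1" "x q2 = c" using xinf by blast
    have "q < q1" "q1 < q2" using q1(1) q2(1) by simp_all
    from exit_loop[OF mx xr mc bc x0 q this q1(2) q2(2), of p]
    obtain K K' where K: "\<forall>n\<ge>1. \<exists>w\<in>loops m. length w = n + K' \<and> \<bar>wsum p w - psum p x n\<bar> \<le> K"
      by blast
    have fne: "follow m \<noteq> {}" using mx by (auto simp: follow_def)
    have "\<alpha> \<in> rot_interval p m"
    proof (rule closure_mem[OF fne])
      fix \<epsilon> :: real assume e: "\<epsilon> > 0"
      obtain M :: nat where M: "real M * \<epsilon> \<ge> 2 * (of_int K + \<bar>\<alpha>\<bar> * real K')"
        using e by (metis pos_divide_le_eq real_arch_simple)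
      obtain n where n: "n \<ge> Suc M" "\<bar>of_int (psum p x n) - \<alpha> * real n\<bar> \<le> \<epsilon> / 2 * real n"
        using psum_drp_rate[OF cl, of n'] e unfolding cluster_rate_def x_def by (metis half_gt_zero)
      have "n \<ge> 1" using n(1) by simp
      then obtain w where w: "w \<in> loops m" "length w = n + K'" "\<bar>wsum p w - psum p x n\<bar> \<le> K"
        using K by blast
      have "real_of_int \<bar>wsum p w - psum p x n\<bar> \<le> of_int K" using w(3) by (simp only: of_int_le_iff)
      then have 1: "\<bar>real_of_int (wsum p w) - of_int (psum p x n)\<bar> \<le> of_int K" by simp
      have 2: "\<bar>of_int (wsum p w) - \<alpha> * real (length w)\<bar>
          \<le> of_int K + \<epsilon> / 2 * real n + \<bar>\<alpha>\<bar> * real K'"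
      proof -
        have "of_int (wsum p w) - \<alpha> * real (length w) = (of_int (wsum p w) - of_int (psum p x n))
          + (of_int (psum p x n) - \<alpha> * real n) - \<alpha> * real K'" by (simp add: w algebra_simps)
        moreover have "\<bar>\<alpha> * real K'\<bar> = \<bar>\<alpha>\<bar> * real K'" by (simp add: abs_mult)
        ultimately show ?thesis using 1 n(2) by linarith
      qed
      have 3: "2 * (of_int K + \<bar>\<alpha>\<bar> * real K') \<le> \<epsilon> * real n"
      proof -
        have "real M * \<epsilon> \<le> real n * \<epsilon>" using n e by (intro mult_right_mono) auto
        then show ?thesis using M by (simp add: mult.commute)
      qed
      have 4: "\<epsilon> * real n \<le> \<epsilon> * real (length w)" using e by (simp add: w)
      have "\<bar>of_int (wsum p w) - \<alpha> * real (length w)\<bar> \<le> \<epsilon> * real (length w)"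
        using 2 3 4 by simp
      then show "\<exists>w\<in>loops m. \<bar>of_int (wsum p w) - \<alpha> * real (length w)\<bar> \<le> \<epsilon> * real (length w)"
        using w(1) by blast
    qed
    moreover have "(\<lambda>_. m) \<in> S"
    proof -
      have "[m] \<in> loops m"
      proof (rule loopsI)
        fix t assume t: "cat [m] t \<in> S"
        have "lexle (cat [m] t) x" using mc x0 by (intro lexless_imp_le lexless_0) simp
        from lower_word[OF mx t this] show "cat [m, m] t \<in> S" by (simp add: cat_Cons[of m "[m]"])
      qed simp
      from cat_in_tail[OF per_loop_in[OF this fne]] show ?thesis by (simp add: per_single)
    qed
    ultimately show ?thesis by blast
  qed
qed

end

section \<open>Periodic sequences of rational mean\<close>

lemma pow_single: "pow [a] n = replicate n a"
  by (induction n) (simp_all add: pow_Suc)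

lemma take_tk: "k \<le> n \<Longrightarrow> take k (tk n s) = tk k s"
  by (rule nth_equalityI) auto

lemma tk_per: "u \<noteq> [] \<Longrightarrow> tk (n * length u) (per u) = pow u n"
  using tk_cat[of "pow u n" "per u"] by (simp add: pow_per)

lemma drp_per: "u \<noteq> [] \<Longrightarrow> drp (n * length u) (per u) = per u"
  using drp_cat[of "pow u n" "per u"] by (simp add: pow_per)

text \<open>The sum \<open>psum p (per w) i + \<epsilon> * i\<close> with \<open>\<epsilon> = 1 / (n + 1)\<close> does not decrease when \<open>i\<close> grows by a period,
  hence has a minimum. From the minimising place on, partial sums of length at most \<open>n\<close> exceed \<open>- 1\<close>,
  and they are integers.\<close>

lemma best_rotation:
  assumes w: "w \<noteq> []" and ge: "- (1 / real (Suc n)) * real (length w) \<le> of_int (wsum p w)"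
  shows "\<exists>i. \<forall>k\<le>n. 0 \<le> psum p (drp i (per w)) k"
proof -
  define \<epsilon> where "\<epsilon> = 1 / real (Suc n)"
  define \<Phi> where "\<Phi> i = of_int (psum p (per w) i) + \<epsilon> * real i" for i
  have step: "\<Phi> (k * length w + r) \<ge> \<Phi> r" for k r
  proof -
    have "psum p (per w) (k * length w + r) = int k * wsum p w + psum p (per w) r"
      using wsum_tk[of p "k * length w" "per w"] tk_per[OF w, of k]
      by (simp add: psum_add drp_per[OF w])
    then have "\<Phi> (k * length w + r) = \<Phi> r + real k * (of_int (wsum p w) + \<epsilon> * real (length w))"
      unfolding \<Phi>_def by (simp add: algebra_simps)
    moreover have "of_int (wsum p w) + \<epsilon> * real (length w) \<ge> 0" using ge unfolding \<epsilon>_def by simp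
    ultimately show ?thesis by simp
  qed
  define i where "i = arg_min_on \<Phi> {..<length w}"
  have min: "\<Phi> i \<le> \<Phi> r" if "r < length w" for r
    unfolding i_def by (rule arg_min_least) (use that w in auto)
  have glob: "\<Phi> i \<le> \<Phi> j" for j
  proof -
    have "\<Phi> i \<le> \<Phi> (j mod length w)" by (rule min) (use w in simp)
    also have "\<dots> \<le> \<Phi> (j div length w * length w + j mod length w)" by (rule step)
    finally show ?thesis by simp
  qed
  have "0 \<le> psum p (drp i (per w)) k" if k: "k \<le> n" for k
  proof -
    have "of_int (psum p (drp i (per w)) k) + \<epsilon> * real k \<ge> 0"
      using glob[of "i + k"] unfolding \<Phi>_def psum_add by (simp add: algebra_simps)
    moreover have "\<epsilon> * real k < 1" using k unfolding \<epsilon>_def by (simp add: field_simps)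
    ultimately have "of_int (psum p (drp i (per w)) k) > (-1 :: real)" by linarith
    then show ?thesis by linarith
  qed
  then show ?thesis by blast
qed

text \<open>This is Koenig's lemma combined with the choice of the least infinite branch: at each step the
  least letter is taken for which arbitrarily long extensions exist.\<close>

lemma least_branch:
  fixes V :: "nat list set"
  assumes prefix: "\<And>v v'. v @ v' \<in> V \<Longrightarrow> v \<in> V"
    and fin: "finite L" "\<And>v. v \<in> V \<Longrightarrow> set v \<subseteq> L"
    and long: "\<And>n. \<exists>v\<in>V. length v = n"
  shows "\<exists>e. (\<forall>n. tk n e \<in> V) \<and> (\<forall>s. (\<forall>n. tk n s \<in> V) \<longrightarrow> lexle e s)"
proof -
  define Ext where "Ext v \<longleftrightarrow> (\<forall>n. \<exists>v'. length v' = n \<and> v @ v' \<in> V)" for v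
  have E0: "Ext []" unfolding Ext_def using long by auto
  have ES: "\<exists>a. Ext (v @ [a])" if v: "Ext v" for v
  proof (rule ccontr)
    assume "\<nexists>a. Ext (v @ [a])"
    then have "\<forall>a. \<exists>n. \<forall>v'. length v' = n \<longrightarrow> (v @ [a]) @ v' \<notin> V" unfolding Ext_def by blast
    then obtain M where M: "\<And>a v'. length v' = M a \<Longrightarrow> (v @ [a]) @ v' \<notin> V" by metis
    obtain v1 where v1: "length v1 = Suc (\<Sum>a\<in>L. M a)" "v @ v1 \<in> V" using v unfolding Ext_def by blast
    then obtain a v2 where av: "v1 = a # v2" "length v2 = (\<Sum>a\<in>L. M a)" by (cases v1) auto
    have "a \<in> L" using fin(2)[OF v1(2)] av by simp
    then have Ma: "M a \<le> length v2" unfolding av(2) using fin(1) by (intro member_le_sum) auto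
    have "((v @ [a]) @ take (M a) v2) @ drop (M a) v2 \<in> V" using v1(2) av by simp
    then have "(v @ [a]) @ take (M a) v2 \<in> V" by (rule prefix)
    then show False using M[of "take (M a) v2" a] Ma by simp
  qed
  define pre where "pre = rec_nat [] (\<lambda>_ v. v @ [LEAST a. Ext (v @ [a])])"
  have pre0: "pre 0 = []" and preS: "pre (Suc n) = pre n @ [LEAST a. Ext (pre n @ [a])]" for n
    by (simp_all add: pre_def)
  define e where "e n = (LEAST a. Ext (pre n @ [a]))" for n
  have tke: "pre n = tk n e" for n by (induction n) (simp_all add: pre0 preS tk_Suc e_def, simp add: tk_def)
  have eL: "e n = (LEAST a. Ext (tk n e @ [a]))" for n
    unfolding tke[symmetric] by (rule e_def)
  have Epre: "Ext (tk n e)" for n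
  proof (induction n)
    case 0 then show ?case using E0 by (simp add: tk_def)
  next
    case (Suc n)
    have "Ext (tk n e @ [e n])" unfolding eL[of n] using ES[OF Suc] by (rule LeastI_ex)
    then show ?case by (simp add: tk_Suc)
  qed
  have 1: "tk n e \<in> V" for n
  proof -
    obtain v' where "length v' = 0" "tk n e @ v' \<in> V" using Epre[of n] unfolding Ext_def by blast
    then show ?thesis by simp
  qed
  have 2: "lexle e s" if s: "\<forall>n. tk n s \<in> V" for s
  proof (rule ccontr)
    assume "\<not> lexle e s"
    then have "lexless s e" using lexle_linear by blast
    then obtain j where j: "\<forall>i<j. s i = e i" "s j < e j" unfolding lexless_def by blast
    have "tk j s = tk j e" unfolding tk_def using j(1) by simp
    then have "tk j e @ [s j] = tk (Suc j) s" by (simp add: tk_Suc)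
    moreover have "Ext (tk (Suc j) s)" unfolding Ext_def
    proof
      fix n show "\<exists>v'. length v' = n \<and> tk (Suc j) s @ v' \<in> V"
        using s by (intro exI[of _ "tk n (drp (Suc j) s)"]) (simp add: tk_add[symmetric])
    qed
    ultimately have "e j \<le> s j" unfolding eL[of j] by (simp add: Least_le)
    then show False using j(2) by simp
  qed
  show ?thesis using 1 2 by blast
qed

context lower_shift
begin

lemma loops_factor_in:
  assumes m: "(\<lambda>_. m) \<in> S" and w: "A @ v @ B \<in> loops m"
  shows "\<exists>t. cat v t \<in> S"
proof -
  have "cat [m] (\<lambda>_. m) \<in> S" using follow_const[OF m] by (simp add: follow_def)
  from loopsD[OF w this] have "cat ((m # A) @ v @ B) (\<lambda>_. m) \<in> S" by simp
  then have "cat v (cat B (\<lambda>_. m)) \<in> S" unfolding cat_append by (rule cat_in_tail)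
  then show ?thesis by blast
qed

text \<open>A cycle \<open>u\<close> that occurs in a loop can be repeated. What counts is whether the continuation \<open>B t\<close>
  is below or above \<open>per u\<close>. If it is always below, then \<open>pow u i\<close> followed by \<open>B t\<close> is below \<open>per u\<close>, hence
  may follow \<open>D\<close>. If it is above for some \<open>t0\<close>, then repeating \<open>u\<close> lowers the sequence, so this may be
  done at the place where \<open>u\<close> occurs, for \<open>t0\<close> and everything above it, and then for smaller \<open>t\<close> too.\<close>

lemma insert_cycle:
  assumes u: "u \<noteq> []" and per: "per u \<in> S"
    and D: "cat (m # D) (per u) \<in> S" and w: "A @ u @ B \<in> loops m"
  shows "\<exists>D' B'. \<forall>i\<ge>1. D' @ pow u i @ B' \<in> loops m"
proof (cases "\<forall>t\<in>follow m. lexle (cat B t) (per u)")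
  case True
  have "D @ pow u i @ B \<in> loops m" if i: "i \<ge> 1" for i
  proof (rule loopsI)
    show "D @ pow u i @ B \<noteq> []" using u i by (cases i) (simp_all add: pow_Suc)
    fix t assume t: "cat [m] t \<in> S"
    have "cat ((m # A @ u) @ B) t \<in> S" using loopsD[OF w t] by simp
    then have BS: "cat B t \<in> S" unfolding cat_append by (rule cat_in_tail)
    have le: "lexle (cat B t) (per u)" using True t by (simp add: follow_def)
    have "cat (pow u i) (per u) \<in> S" using per by (simp add: pow_per[OF u])
    then have "cat (pow u i) (cat B t) \<in> S" using lower_word BS le by blast
    moreover have "lexle (cat (pow u i) (cat B t)) (per u)"
      using le lexle_cat[of "pow u i" "cat B t" "per u"] pow_per[OF u] by simp
    ultimately have "cat (m # D) (cat (pow u i) (cat B t)) \<in> S" using lower_word D by blast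
    then show "cat (m # D @ pow u i @ B) t \<in> S" by (simp flip: cat_append)
  qed
  then show ?thesis by blast
next
  case False
  then obtain t0 where t0: "t0 \<in> follow m" "lexle (per u) (cat B t0)"
    using lexle_linear lexless_imp_le by blast
  have "(A @ u) @ pow u i @ B \<in> loops m" for i
  proof (rule loopsI)
    show "(A @ u) @ pow u i @ B \<noteq> []" using u by simp
    fix t assume t: "cat [m] t \<in> S"
    obtain t' where t': "t' \<in> follow m" "lexle t t'" "lexle (per u) (cat B t')"
    proof (cases "lexle t t0")
      case True then show ?thesis using t0 that by blast
    next
      case False
      then have "lexle t0 t" using lexle_linear lexless_imp_le by blast
      then have "lexle (per u) (cat B t)" using lexle_trans[OF t0(2)] by simp
      then show ?thesis using t that[of t] by (simp add: follow_def)
    qed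
    let ?y = "cat B t'"
    have yS: "cat (m # A @ u) ?y \<in> S"
      using loopsD[OF w, of t'] t'(1) by (simp add: follow_def flip: cat_append)
    have le: "lexle (cat (pow u i) ?y) ?y" for i by (rule cat_pow_le[OF u t'(3)])
    have uy: "cat u ?y \<in> S" by (rule cat_in_tail[of "m # A"]) (use yS in \<open>simp flip: cat_append\<close>)
    have "cat (pow u i) ?y \<in> S" for i
    proof (induction i)
      case 0 then show ?case using cat_in_tail[OF uy] by simp
    next
      case (Suc i)
      from lower_word[OF uy Suc le] show ?case by (simp add: pow_Suc cat_append)
    qed
    from lower_word[OF yS this le] have "cat (m # (A @ u) @ pow u i @ B) t' \<in> S"
      by (simp flip: cat_append)
    moreover have "t \<in> S" using t by (rule cat_in_tail)
    ultimately show "cat (m # (A @ u) @ pow u i @ B) t \<in> S" using lower_word t'(2) by blast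
  qed
  then show ?thesis by blast
qed

text \<open>Here 0 is the supremum of the means of loops, but no loop attains it. Among the sequences all of
  whose prefixes occur in loops and have sums at least 0, let \<open>e\<close> be the least one. Cut after
  the nonempty prefix \<open>u\<close> of least sum: then \<open>e = u e'\<close> with \<open>e'\<close> again in this class, so \<open>e\<close> is at most
  \<open>e'\<close>, and this makes \<open>per u\<close> a sequence of \<open>S\<close> of nonnegative mean. If the mean were positive,
  inserting many copies of \<open>u\<close> in a loop would give a loop of nonnegative sum. The insertion needs a way from \<open>m\<close> to \<open>per u\<close>:
  it is found by lowering the greatest letter \<open>c\<close> that occurs in loops to a smaller letter of \<open>u\<close>, or,
  if \<open>u\<close> consists of \<open>c\<close>'s only, to a smaller letter that can be followed by \<open>c\<close>'s for ever.\<close>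

lemma zero_cycle:
  assumes m: "(\<lambda>_. m) \<in> S"
    and neg: "\<And>w. w \<in> loops m \<Longrightarrow> wsum p w < 0"
    and sup: "\<And>\<epsilon>::real. \<epsilon> > 0 \<Longrightarrow> \<exists>w\<in>loops m. - \<epsilon> * real (length w) \<le> of_int (wsum p w)"
  shows "\<exists>u. u \<noteq> [] \<and> per u \<in> S \<and> wsum p u = 0"
proof -
  have fne: "follow m \<noteq> {}" using follow_const[OF m] by blast
  \<comment> \<open>Words that occur in loops and all of whose partial sums are nonnegative.\<close>
  define V where "V = {v. (\<exists>A B. A @ v @ B \<in> loops m) \<and> (\<forall>k\<le>length v. 0 \<le> wsum p (take k v))}"
  have "\<exists>e. (\<forall>n. tk n e \<in> V) \<and> (\<forall>s. (\<forall>n. tk n s \<in> V) \<longrightarrow> lexle e s)"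
  proof (rule least_branch[OF _ finite_letters])
    fix v v' assume vv: "v @ v' \<in> V"
    then obtain A B where "A @ v @ (v' @ B) \<in> loops m" unfolding V_def by auto
    moreover have "0 \<le> wsum p (take k v)" if "k \<le> length v" for k
    proof -
      have "\<forall>k\<le>length (v @ v'). 0 \<le> wsum p (take k (v @ v'))" using vv unfolding V_def by blast
      from this[rule_format, of k] that show ?thesis by simp
    qed
    ultimately show "v \<in> V" unfolding V_def by blast
  next
    fix v assume "v \<in> V"
    then show "set v \<subseteq> L" using loop_letters[OF fne] unfolding V_def by blast
  next
    fix n
    obtain w where w: "w \<in> loops m" "- (1 / real (Suc n)) * real (length w) \<le> of_int (wsum p w)"
      using sup[of "1 / real (Suc n)"] by auto
    have wne: "w \<noteq> []" using loops_nonempty w(1) .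
    obtain i where i: "\<forall>k\<le>n. 0 \<le> psum p (drp i (per w)) k" using best_rotation[OF wne w(2)] by blast
    define v where "v = tk n (drp i (per w))"
    have "tk i (per w) @ v @ tk ((i + n + 1) * length w - (i + n)) (drp n (drp i (per w))) \<in> loops m"
    proof -
      have "i + n \<le> (i + n + 1) * length w" using wne by (cases w) auto
      then have "(i + n + 1) * length w = i + (n + ((i + n + 1) * length w - (i + n)))" by simp
      then have "pow w (i + n + 1) = tk (i + (n + ((i + n + 1) * length w - (i + n)))) (per w)"
        using tk_per[OF wne, of "i + n + 1"] by simp
      also have "\<dots> = tk i (per w) @ v @ tk ((i + n + 1) * length w - (i + n)) (drp n (drp i (per w)))"
        unfolding v_def by (simp only: tk_add append_assoc)
      finally show ?thesis using loops_pow[OF w(1), of "i + n + 1"] by simp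
    qed
    moreover have "0 \<le> wsum p (take k v)" if "k \<le> length v" for k
      using i that unfolding v_def by (simp add: take_tk wsum_tk)
    ultimately have "v \<in> V" unfolding V_def by blast
    then show "\<exists>v\<in>V. length v = n" unfolding v_def by (intro bexI) auto
  qed
  then obtain e where eV: "\<And>n. tk n e \<in> V" and emin: "\<And>s. (\<And>n. tk n s \<in> V) \<Longrightarrow> lexle e s" by blast
  have efac: "\<exists>A B. A @ tk n e @ B \<in> loops m" for n using eV[of n] unfolding V_def by blast
  have epos: "0 \<le> psum p e n" for n
  proof -
    have "\<forall>k\<le>length (tk n e). 0 \<le> wsum p (take k (tk n e))" using eV[of n] unfolding V_def by blast
    from this[rule_format, of n] show ?thesis by (simp add: take_tk wsum_tk)
  qed
  have eS: "e \<in> S"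
  proof (rule closed)
    fix n
    obtain A B where "A @ tk n e @ B \<in> loops m" using efac by blast
    then obtain t where "cat (tk n e) t \<in> S" using loops_factor_in[OF m] by blast
    then show "\<exists>t\<in>S. \<forall>i<n. t i = e i" by (intro bexI[of _ "cat (tk n e) t"]) (simp_all add: cat_def)
  qed
  obtain k where k: "k \<ge> 1" "\<And>l. l \<ge> 1 \<Longrightarrow> psum p e k \<le> psum p e l"
  proof -
    define k where "k = (ARG_MIN (\<lambda>k. nat (psum p e k)) k. k \<ge> 1)"
    have 1: "k \<ge> 1" unfolding k_def by (rule arg_min_natI[of "\<lambda>k. k \<ge> 1" 1]) simp
    have "psum p e k \<le> psum p e l" if "l \<ge> 1" for l
    proof -
      have "nat (psum p e k) \<le> nat (psum p e l)" unfolding k_def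
        by (rule arg_min_nat_le[of "\<lambda>k. k \<ge> 1"]) (use \<open>l \<ge> 1\<close> in simp)
      then show ?thesis using epos[of l] by linarith
    qed
    then show ?thesis using 1 that by blast
  qed
  define e' u where "e' = drp k e" and "u = tk k e"
  have une: "u \<noteq> []" using k(1) unfolding u_def by (metis length_tk list.size(3) not_one_le_zero)
  have ue: "cat u e' = e" unfolding u_def e'_def by (rule cat_tk)
  have "tk n e' \<in> V" for n
  proof -
    obtain A B where "A @ tk (k + n) e @ B \<in> loops m" using efac by blast
    then have "(A @ u) @ tk n e' @ B \<in> loops m" unfolding u_def e'_def by (simp add: tk_add)
    moreover have "0 \<le> wsum p (take i (tk n e'))" if "i \<le> length (tk n e')" for i
    proof -
      have "psum p e k \<le> psum p e (k + i)" using k by simp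
      then show ?thesis using that by (simp add: take_tk wsum_tk e'_def psum_add)
    qed
    ultimately show ?thesis unfolding V_def by blast
  qed
  then have ee': "lexle e e'" by (rule emin)
  have upos: "0 \<le> wsum p u" unfolding u_def wsum_tk by (rule epos)
  have perS: "per u \<in> S"
  proof -
    have "cat (pow u n) e \<in> S \<and> lexle (cat (pow u n) e) e'" for n
    proof (induction n)
      case 0 then show ?case using eS ee' by simp
    next
      case (Suc n)
      have "cat u (cat (pow u n) e) \<in> S" by (rule lower_word[of u e']) (use ue eS Suc in simp_all)
      moreover have "lexle (cat u (cat (pow u n) e)) e'"
      proof -
        have "lexle (cat u (cat (pow u n) e)) (cat u e')" using Suc by simp
        then show ?thesis unfolding ue using ee' by (rule lexle_trans)
      qed
      ultimately show ?case by (simp add: pow_Suc cat_append)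
    qed
    then have "cat [] (per u) \<in> S" by (intro per_in_of_pow[OF une]) auto
    then show ?thesis by simp
  qed
  have "wsum p u = 0"
  proof (rule ccontr)
    assume "wsum p u \<noteq> 0"
    then have pos: "wsum p u > 0" using upos by simp
    obtain A B where AB: "A @ u @ B \<in> loops m" using efac unfolding u_def by blast
    define R where "R = {a. \<exists>w\<in>loops m. a \<in> set w}"
    define c where "c = Max R"
    have RI: "a \<in> R" if "w \<in> loops m" "a \<in> set w" for a w using that unfolding R_def by blast
    have RL: "R \<subseteq> L"
    proof
      fix a assume "a \<in> R"
      then obtain w where "w \<in> loops m" "a \<in> set w" unfolding R_def by blast
      then show "a \<in> L" using loop_letters[OF fne, of "[]" w "[]"] by auto
    qed
    then have finR: "finite R" using finite_letters finite_subset by blast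
    have mR: "m \<in> R" using RI[OF self_loop[OF m]] by simp
    have c: "c \<in> R" "\<And>a. a \<in> R \<Longrightarrow> a \<le> c" unfolding c_def using finR mR Max_in by auto
    obtain w0 where "w0 \<in> loops m" "c \<in> set w0" using c(1) unfolding R_def by blast
    then obtain A0 B0 where w0: "A0 @ c # B0 \<in> loops m" by (metis split_list)
    have mm: "cat [m] (\<lambda>_. m) \<in> S" using follow_const[OF m] by (simp add: follow_def)
    \<comment> \<open>Whatever starts with a letter below \<open>c\<close> can be reached from \<open>m\<close>.\<close>
    have low: "cat (m # A0 @ [a]) s' \<in> S" if a: "a < c" "cat [a] s' \<in> S" for a s'
    proof -
      have "cat (m # A0) (cat (c # B0) (\<lambda>_. m)) \<in> S"
        using loopsD[OF w0 mm] by (simp flip: cat_append)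
      moreover have "lexle (cat [a] s') (cat (c # B0) (\<lambda>_. m))"
        using a(1) by (intro lexless_imp_le lexless_0) simp
      ultimately have "cat (m # A0) (cat [a] s') \<in> S" using lower_word a(2) by blast
      then show ?thesis by (simp flip: cat_append)
    qed
    have eR: "e i \<in> R" for i
    proof -
      obtain A B where "A @ tk (Suc i) e @ B \<in> loops m" using efac by blast
      from RI[OF this] show ?thesis by (simp add: set_tk)
    qed
    have "\<exists>D. cat (m # D) (per u) \<in> S"
    proof (cases "\<exists>a\<in>set u. a < c")
      case True
      then obtain a u1 u2 where a: "a < c" "u = u1 @ a # u2" by (metis split_list)
      have "cat u1 (cat (a # u2) (per u)) \<in> S" using perS per_cat[OF une] a(2) cat_append by metis
      then have "cat [a] (cat u2 (per u)) \<in> S" unfolding cat_Cons[of a u2] by (rule cat_in_tail)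
      from low[OF a(1) this] have "cat (m # (A0 @ a # u2)) (per u) \<in> S" by (simp flip: cat_append)
      then show ?thesis by blast
    next
      case False
      have uc: "u = replicate k c"
      proof -
        have "a = c" if "a \<in> set u" for a
        proof -
          have "a \<in> R" using that eR unfolding u_def set_tk by blast
          then show ?thesis using c(2)[of a] False that by (meson antisym_conv1)
        qed
        then show ?thesis using replicate_length_same[of u c] unfolding u_def by simp
      qed
      have pu: "per u = (\<lambda>_. c)" unfolding uc using k(1) by (intro per_replicate) simp
      have "lexle (per u) e'" by (rule le_cat_per[OF une]) (use ue ee' in simp)
      moreover have "\<not> lexless (\<lambda>_. c) e'"
      proof
        assume "lexless (\<lambda>_. c) e'"
        then obtain j where "c < e' j" unfolding lexless_def by blast
        then show False using c(2)[OF eR, of "k + j"] by (simp add: e'_def drp_def)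
      qed
      ultimately have "e' = (\<lambda>_. c)" unfolding pu lexle_def by auto
      then have ec: "e = (\<lambda>_. c)" using ue per_cat[OF une] pu by simp
      have "m \<noteq> c"
      proof
        assume "m = c"
        then have "p c < 0" using neg[OF self_loop[OF m]] by simp
        then show False using pos unfolding uc by (simp add: zero_less_mult_iff)
      qed
      \<comment> \<open>The last letter different from \<open>c\<close> before a long run of \<open>c\<close>; it exists as the word starts with \<open>m\<close>.\<close>
      have ex: "\<exists>l. l < c \<and> l \<in> L \<and> (\<exists>t. cat (l # replicate j c) t \<in> S)" for j
      proof -
        obtain A B where "A @ tk j e @ B \<in> loops m" using efac by blast
        then have w: "A @ replicate j c @ B \<in> loops m" unfolding ec by (simp add: tk_def map_replicate_const)
        have "\<exists>x\<in>set (m # A). x \<noteq> c" using \<open>m \<noteq> c\<close> by simp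
        then obtain ys x zs where x: "m # A = ys @ x # zs" "x \<noteq> c" "\<forall>z\<in>set zs. \<not> z \<noteq> c"
          using split_list_last_prop[of "m # A" "\<lambda>x. x \<noteq> c"] by blast
        have zs: "zs = replicate (length zs) c" using x(3) replicate_length_same[of zs c] by simp
        have "x \<in> set (m # A)" unfolding x(1) by simp
        then have "x = m \<or> x \<in> set (A @ replicate j c @ B)" by auto
        then have "x \<in> R" using mR RI[OF w] by blast
        then have xc: "x < c" "x \<in> L" using c(2)[of x] x(2) RL by auto
        have "cat ((m # A) @ replicate j c @ B) (\<lambda>_. m) \<in> S" using loopsD[OF w mm] by simp
        then have "cat (ys @ (x # zs @ replicate j c) @ B) (\<lambda>_. m) \<in> S" unfolding x(1) by simp
        then have "cat (x # zs @ replicate j c) (cat B (\<lambda>_. m)) \<in> S"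
          unfolding cat_append[of ys] cat_append[of _ B] by (rule cat_in_tail)
        moreover have "zs @ replicate j c = replicate j c @ zs"
          by (subst zs, subst (2) zs) (simp add: replicate_add[symmetric] add.commute)
        ultimately have "cat ((x # replicate j c) @ zs) (cat B (\<lambda>_. m)) \<in> S" by simp
        then show ?thesis using xc unfolding cat_append[of _ zs] by blast
      qed
      have "\<exists>l. l < c \<and> (\<forall>j. \<exists>t. cat (l # replicate j c) t \<in> S)"
      proof (rule ccontr)
        assume "\<not> ?thesis"
        then obtain J where J: "\<And>l t. l < c \<Longrightarrow> cat (l # replicate (J l) c) t \<notin> S" by metis
        obtain l t where l: "l < c" "l \<in> L" "cat (l # replicate (\<Sum>l\<in>L. J l) c) t \<in> S" using ex by blast
        have "J l \<le> (\<Sum>l\<in>L. J l)" using l(2) finite_letters by (intro member_le_sum) auto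
        then obtain d where d: "(\<Sum>l\<in>L. J l) = J l + d" using le_Suc_ex by blast
        have "cat ((l # replicate (J l) c) @ replicate d c) t \<in> S"
          using l(3) unfolding d by (simp add: replicate_add)
        then show False using J[OF l(1)] unfolding cat_append by blast
      qed
      then obtain l where l: "l < c" "\<And>j. \<exists>t. cat (l # replicate j c) t \<in> S" by blast
      have "cat [l] (per [c]) \<in> S" by (rule per_in_of_pow) (use l(2) in \<open>auto simp: pow_single\<close>)
      then have "cat (m # (A0 @ [l])) (per u) \<in> S" using low[OF l(1)] by (simp add: per_single pu)
      then show ?thesis by blast
    qed
    then obtain D where D: "cat (m # D) (per u) \<in> S" by blast
    obtain D' B' where DB: "\<And>i. i \<ge> 1 \<Longrightarrow> D' @ pow u i @ B' \<in> loops m"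
      using insert_cycle[OF une perS D AB] by blast
    define i where "i = Suc (nat (\<bar>wsum p D'\<bar> + \<bar>wsum p B'\<bar>))"
    have "wsum p D' + int i * wsum p u + wsum p B' < 0" using neg[OF DB[of i]] by (simp add: i_def)
    moreover have "int i * wsum p u \<ge> int i * 1" using pos by (intro mult_left_mono) auto
    ultimately show False unfolding i_def by simp
  qed
  then show ?thesis using une perS by blast
qed

text \<open>If there are loops on both sides of \<open>\<alpha>\<close>, a mixture has mean \<open>\<alpha>\<close>. Otherwise \<open>\<alpha>\<close> is an end point that
  is not attained by loops, and \<open>zero_cycle\<close> applies to the normalised weights \<open>q p - a\<close> or to their
  negatives.\<close>

theorem rational_cycle:
  assumes m: "(\<lambda>_. m) \<in> S" and al: "\<alpha> \<in> rot_interval p m" "\<alpha> \<in> \<rat>"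
  shows "\<exists>u. u \<noteq> [] \<and> per u \<in> S \<and> of_int (wsum p u) = \<alpha> * real (length u)"
proof -
  have fne: "follow m \<noteq> {}" using follow_const[OF m] by blast
  have lne: "loops m \<noteq> {}" using self_loop[OF m] by blast
  obtain a q where aq: "q > 0" "\<alpha> = of_int a / of_int q" using al(2) by (rule Rats_cases')
  define p' where "p' b = q * p b - a" for b
  have w': "wsum p' w = q * wsum p w - a * int (length w)" for w
    unfolding p'_def by (rule wsum_affine)
  have zero: "of_int (wsum p u) = \<alpha> * real (length u)" if "q * wsum p u = a * int (length u)" for u
  proof -
    have "real_of_int q * of_int (wsum p u) = of_int a * real (length u)"
      using that by (metis of_int_mult of_int_of_nat_eq)
    then show ?thesis unfolding aq(2) using aq(1) by (simp add: field_simps)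
  qed
  have near: "\<exists>w\<in>loops m. \<bar>of_int (wsum p' w)\<bar> \<le> \<epsilon> * real (length w)" if e: "\<epsilon> > 0" for \<epsilon> :: real
  proof -
    have "\<epsilon> / of_int q > 0" using e aq(1) by simp
    from loop_approx[OF fne lne al(1) this] obtain w where
      w: "w \<in> loops m" "\<bar>of_int (wsum p w) - \<alpha> * real (length w)\<bar> \<le> \<epsilon> / of_int q * real (length w)" by blast
    have q: "real_of_int q > 0" using aq(1) by simp
    have "of_int (wsum p' w) = of_int q * (of_int (wsum p w) - \<alpha> * real (length w))"
      unfolding w' aq(2) using q by (simp add: field_simps)
    then have "\<bar>of_int (wsum p' w)\<bar> = of_int q * \<bar>of_int (wsum p w) - \<alpha> * real (length w)\<bar>"
      using q by (simp add: abs_mult)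
    also have "\<dots> \<le> of_int q * (\<epsilon> / of_int q * real (length w))" using w(2) q by (intro mult_left_mono) auto
    also have "\<dots> = \<epsilon> * real (length w)" using q by simp
    finally show ?thesis using w(1) by blast
  qed
  consider (mix) u v where "u \<in> loops m" "v \<in> loops m" "wsum p' u \<le> 0" "0 \<le> wsum p' v"
    | (neg) "\<And>w. w \<in> loops m \<Longrightarrow> wsum p' w < 0"
    | (pos) "\<And>w. w \<in> loops m \<Longrightarrow> wsum p' w > 0"
    by (meson not_le)
  then show ?thesis
  proof cases
    case mix
    obtain w where w: "w \<in> loops m" "q * wsum p w = a * int (length w)"
      using mix_loops[OF mix(1,2) aq(1), of p a] mix(3,4) unfolding w' by auto
    show ?thesis using loops_nonempty[OF w(1)] cat_in_tail[OF per_loop_in[OF w(1) fne]] zero[OF w(2)] by blast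
  next
    case neg
    have "\<exists>u. u \<noteq> [] \<and> per u \<in> S \<and> wsum p' u = 0"
    proof (rule zero_cycle[OF m neg])
      fix \<epsilon> :: real assume "\<epsilon> > 0"
      from near[OF this] show "\<exists>w\<in>loops m. - \<epsilon> * real (length w) \<le> of_int (wsum p' w)"
        by (auto simp: abs_le_iff minus_le_iff)
    qed
    then show ?thesis using zero unfolding w' by auto
  next
    case pos
    have "\<exists>u. u \<noteq> [] \<and> per u \<in> S \<and> wsum (\<lambda>b. - p' b) u = 0"
    proof (rule zero_cycle[OF m])
      fix w assume "w \<in> loops m" then show "wsum (\<lambda>b. - p' b) w < 0" using pos by (simp add: wsum_uminus)
    next
      fix \<epsilon> :: real assume "\<epsilon> > 0"
      from near[OF this] show "\<exists>w\<in>loops m. - \<epsilon> * real (length w) \<le> of_int (wsum (\<lambda>b. - p' b) w)"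
        by (auto simp: abs_le_iff wsum_uminus)
    qed
    then show ?thesis using zero unfolding wsum_uminus w' by auto
  qed
qed

end

section \<open>Itineraries of interval branches\<close>

lemma compact_nested:
  fixes K :: "'b::topological_space set"
  assumes K: "compact K" and cl: "\<And>n::nat. closed (C n)" and dec: "\<And>n. C (Suc n) \<subseteq> C n"
    and ne: "\<And>n. K \<inter> C n \<noteq> {}"
  shows "\<exists>x\<in>K. \<forall>n. x \<in> C n"
proof -
  have mono: "C n \<subseteq> C m" if "m \<le> n" for m n using that
  proof (induction rule: dec_induct)
    case (step n) then show ?case using dec[of n] by blast
  qed simp
  have "K \<inter> (\<Inter>n\<in>UNIV. C n) \<noteq> {}"
  proof (rule compact_imp_fip_image[OF K])
    fix I' :: "nat set" assume "finite I'"
    then obtain n where "\<forall>i\<in>I'. i \<le> n" using finite_nat_set_iff_bounded_le by blast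
    then have "C n \<subseteq> (\<Inter>i\<in>I'. C i)" using mono by blast
    then show "K \<inter> (\<Inter>i\<in>I'. C i) \<noteq> {}" using ne[of n] by blast
  qed (rule cl)
  then show ?thesis by blast
qed

lemma compact_box: "compact {\<xi> :: nat \<Rightarrow> real. \<forall>n. \<xi> n \<in> {lo..hi}}"
proof -
  have "compactin (product_topology (\<lambda>_. euclidean) UNIV) (PiE UNIV (\<lambda>_::nat. {lo..hi::real}))"
    unfolding compactin_PiE by simp
  then have "compact (PiE UNIV (\<lambda>_::nat. {lo..hi::real}))"
    by (simp add: euclidean_product_topology)
  moreover have "PiE UNIV (\<lambda>_::nat. {lo..hi}) = {\<xi>. \<forall>n. \<xi> n \<in> {lo..hi}}"
    by (auto simp: PiE_def Pi_def extensional_def)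
  ultimately show ?thesis by metis
qed

text \<open>The relation \<open>E i\<close> is the graph of the \<open>i\<close>-th branch, with compact domain in \<open>{a i..b i}\<close>. The last
  axiom is what the intermediate value theorem yields for a branch that maps \<open>a i\<close> to \<open>lo\<close>.\<close>

locale interval_branches =
  fixes lo hi :: real and a b :: "nat \<Rightarrow> real" and E :: "nat \<Rightarrow> real \<Rightarrow> real \<Rightarrow> bool" and L :: "nat set"
  assumes finite_L: "finite L"
    and dom: "i \<in> L \<Longrightarrow> E i t t' \<Longrightarrow> a i \<le> t \<and> t \<le> b i \<and> t \<in> {lo..hi} \<and> t' \<in> {lo..hi}"
    and order: "i \<in> L \<Longrightarrow> j \<in> L \<Longrightarrow> i < j \<Longrightarrow> b i < a j"
    and closed_E: "i \<in> L \<Longrightarrow> closed {(t, t'). E i t t'}"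
    and lower_E: "i \<in> L \<Longrightarrow> E i t t1 \<Longrightarrow> lo \<le> t2 \<Longrightarrow> t2 \<le> t1 \<Longrightarrow> \<exists>t'\<le>t. E i t' t2"
begin

definition orbit :: "(nat \<Rightarrow> nat) \<Rightarrow> (nat \<Rightarrow> real) \<Rightarrow> bool" where
  "orbit s \<xi> \<longleftrightarrow> (\<forall>n. s n \<in> L \<and> E (s n) (\<xi> n) (\<xi> (Suc n)))"

definition itineraries :: "(nat \<Rightarrow> nat) set" where
  "itineraries = {s. \<exists>\<xi>. orbit s \<xi>}"

definition box :: "(nat \<Rightarrow> real) set" where "box = {\<xi>. \<forall>n. \<xi> n \<in> {lo..hi}}"

lemma orbit_box: "orbit s \<xi> \<Longrightarrow> \<xi> \<in> box"
  unfolding orbit_def box_def using dom by blast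

lemma closed_step: "i \<in> L \<Longrightarrow> closed {\<xi> :: nat \<Rightarrow> real. E i (\<xi> k) (\<xi> (Suc k))}"
proof -
  assume i: "i \<in> L"
  have "continuous_on UNIV (\<lambda>\<xi> :: nat \<Rightarrow> real. (\<xi> k, \<xi> (Suc k)))"
    by (intro continuous_on_Pair continuous_on_product_coordinates)
  from closed_vimage[OF closed_E[OF i] this]
  have "closed ((\<lambda>\<xi> :: nat \<Rightarrow> real. (\<xi> k, \<xi> (Suc k))) -` {(t, t'). E i t t'})" .
  moreover have "(\<lambda>\<xi> :: nat \<Rightarrow> real. (\<xi> k, \<xi> (Suc k))) -` {(t, t'). E i t t'} = {\<xi>. E i (\<xi> k) (\<xi> (Suc k))}"
    by auto
  ultimately show ?thesis by simp
qed

lemma orbit_drp: "orbit s \<xi> \<Longrightarrow> orbit (drp k s) (\<lambda>n. \<xi> (k + n))"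
  by (simp add: orbit_def drp_def)

text \<open>Preimages are chosen from the end of the path backwards; each lies to the left of the original
  point.\<close>

lemma lower_path:
  assumes "\<And>k. k < n \<Longrightarrow> s k \<in> L \<and> E (s k) (\<xi> k) (\<xi> (Suc k))" and "lo \<le> y" "y \<le> \<xi> n"
  shows "\<exists>\<zeta>. \<zeta> n = y \<and> \<zeta> 0 \<le> \<xi> 0 \<and> (\<forall>k<n. E (s k) (\<zeta> k) (\<zeta> (Suc k)))"
  using assms
proof (induction n arbitrary: y)
  case 0 then show ?case by auto
next
  case (Suc n)
  obtain t' where t': "t' \<le> \<xi> n" "E (s n) t' y" using lower_E Suc.prems by blast
  have "s n \<in> L" using Suc.prems(1) by blast
  from dom[OF this t'(2)] have "lo \<le> t'" by simp
  then obtain \<zeta> where z: "\<zeta> n = t'" "\<zeta> 0 \<le> \<xi> 0" "\<forall>k<n. E (s k) (\<zeta> k) (\<zeta> (Suc k))"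
    using Suc.IH[of t'] t'(1) Suc.prems(1) by (meson less_Suc_eq)
  define \<zeta>' where "\<zeta>' k = (if k \<le> n then \<zeta> k else y)" for k
  have "E (s k) (\<zeta>' k) (\<zeta>' (Suc k))" if "k < Suc n" for k
  proof (cases "k = n")
    case True then show ?thesis using t' z(1) by (simp add: \<zeta>'_def)
  next
    case False then show ?thesis using z(3) that by (simp add: \<zeta>'_def)
  qed
  then show ?case using z(2) by (intro exI[of _ \<zeta>']) (simp add: \<zeta>'_def)
qed

lemma glue:
  assumes "\<And>k. k < n \<Longrightarrow> s k \<in> L \<and> E (s k) (\<zeta> k) (\<zeta> (Suc k))" and "orbit t \<eta>" and "\<eta> 0 = \<zeta> n"
  shows "orbit (cat (tk n s) t) (\<lambda>k. if k < n then \<zeta> k else \<eta> (k - n))"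
  unfolding orbit_def
proof
  fix k
  consider "k < n" "Suc k < n" | "k < n" "Suc k = n" | "\<not> k < n" by linarith
  then show "cat (tk n s) t k \<in> L \<and> E (cat (tk n s) t k) (if k < n then \<zeta> k else \<eta> (k - n))
      (if Suc k < n then \<zeta> (Suc k) else \<eta> (Suc k - n))"
  proof cases
    case 1 then show ?thesis using assms(1)[of k] by (simp add: cat_def)
  next
    case 2
    then have "\<eta> (Suc k - n) = \<zeta> (Suc k)" using assms(3) by simp
    then show ?thesis using assms(1)[of k] 2 by (simp add: cat_def)
  next
    case 3 then show ?thesis using assms(2) by (simp add: cat_def orbit_def Suc_diff_le)
  qed
qed

text \<open>Where \<open>t\<close> first falls below the shifted sequence \<open>s\<close>, the orbit of \<open>t\<close> lies in an interval to the left
  of the one visited by the orbit of \<open>s\<close>. So the latter can be lowered until it lands on the former.\<close>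

lemma itineraries_lower:
  assumes s: "s \<in> itineraries" and t: "t \<in> itineraries" and le: "lexle t (drp 1 s)"
  shows "cat [s 0] t \<in> itineraries"
proof (cases "t = drp 1 s")
  case True
  then have "cat [s 0] t = s" by (auto simp: cat_def drp_def fun_eq_iff)
  then show ?thesis using s by simp
next
  case False
  then obtain j where j: "\<forall>i<j. t i = drp 1 s i" "t j < drp 1 s j"
    using le unfolding lexle_def lexless_def by blast
  obtain \<xi> where xi: "orbit s \<xi>" using s unfolding itineraries_def by blast
  obtain \<eta> where eta: "orbit t \<eta>" using t unfolding itineraries_def by blast
  have "\<eta> j \<le> b (t j)" using eta dom unfolding orbit_def by blast
  also have "\<dots> < a (s (Suc j))" using order j(2) eta xi by (simp add: orbit_def drp_def)
  also have "\<dots> \<le> \<xi> (Suc j)" using xi dom unfolding orbit_def by blast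
  finally have le: "\<eta> j \<le> \<xi> (Suc j)" by simp
  have "lo \<le> \<eta> j" using orbit_box[OF eta] by (simp add: box_def)
  then obtain \<zeta> where z: "\<zeta> (Suc j) = \<eta> j" "\<forall>k<Suc j. E (s k) (\<zeta> k) (\<zeta> (Suc k))"
    using lower_path[of "Suc j" s \<xi> "\<eta> j"] le xi unfolding orbit_def by auto
  have "orbit (cat (tk (Suc j) s) (drp j t)) (\<lambda>k. if k < Suc j then \<zeta> k else (\<lambda>n. \<eta> (j + n)) (k - Suc j))"
    using z xi by (intro glue orbit_drp[OF eta]) (auto simp: orbit_def)
  moreover have "cat (tk (Suc j) s) (drp j t) = cat [s 0] t"
  proof
    fix n show "cat (tk (Suc j) s) (drp j t) n = cat [s 0] t n"
      using j(1) by (cases n) (auto simp: cat_def drp_def)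
  qed
  ultimately show ?thesis unfolding itineraries_def by auto
qed

lemma itineraries_closed:
  assumes ap: "\<And>n. \<exists>t\<in>itineraries. \<forall>i<n. t i = s i"
  shows "s \<in> itineraries"
proof -
  have sL: "s n \<in> L" for n
  proof -
    obtain t where t: "t \<in> itineraries" "t n = s n" using ap[of "Suc n"] by auto
    then have "t n \<in> L" unfolding itineraries_def orbit_def by blast
    then show ?thesis using t(2) by simp
  qed
  have cl: "closed {\<xi> :: nat \<Rightarrow> real. \<forall>k<n. E (s k) (\<xi> k) (\<xi> (Suc k))}" for n
  proof -
    have "{\<xi> :: nat \<Rightarrow> real. \<forall>k<n. E (s k) (\<xi> k) (\<xi> (Suc k))}
      = (\<Inter>k\<in>{..<n}. {\<xi>. E (s k) (\<xi> k) (\<xi> (Suc k))})" by auto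
    then show ?thesis using closed_step[OF sL] by (simp add: closed_INT)
  qed
  have "\<exists>\<xi>\<in>box. \<forall>n. \<xi> \<in> {\<xi>. \<forall>k<n. E (s k) (\<xi> k) (\<xi> (Suc k))}"
  proof (rule compact_nested[OF _ cl])
    show "compact box" unfolding box_def by (rule compact_box)
    fix n
    show "{\<xi>. \<forall>k<Suc n. E (s k) (\<xi> k) (\<xi> (Suc k))} \<subseteq> {\<xi>. \<forall>k<n. E (s k) (\<xi> k) (\<xi> (Suc k))}" by auto
    obtain t \<xi> where "orbit t \<xi>" "\<forall>i<n. t i = s i" using ap[of n] unfolding itineraries_def by blast
    then have "\<xi> \<in> box \<and> (\<forall>k<n. E (s k) (\<xi> k) (\<xi> (Suc k)))" using orbit_box unfolding orbit_def by metis
    then show "box \<inter> {\<xi>. \<forall>k<n. E (s k) (\<xi> k) (\<xi> (Suc k))} \<noteq> {}" by blast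
  qed
  then obtain \<xi> where "\<And>n. \<forall>k<n. E (s k) (\<xi> k) (\<xi> (Suc k))" by blast
  then have "orbit s \<xi>" unfolding orbit_def using sL by blast
  then show ?thesis unfolding itineraries_def by blast
qed

lemma itineraries_lower_shift: "lower_shift itineraries L"
proof
  show "finite L" by (rule finite_L)
  show "s n \<in> L" if "s \<in> itineraries" for s n
    using that unfolding itineraries_def orbit_def by blast
  show "drp 1 s \<in> itineraries" if "s \<in> itineraries" for s
    using that orbit_drp unfolding itineraries_def by blast
qed (use itineraries_lower itineraries_closed in blast)+

text \<open>Among the orbits with itinerary \<open>per u\<close> one has the least starting point, by compactness. After
  \<open>length u\<close> steps it is at or above its start, so it can be lowered to return exactly to it; by
  minimality the lowered path has the same start.\<close>

lemma periodic_orbit: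
  assumes u: "u \<noteq> []" and per: "per u \<in> itineraries"
  shows "\<exists>\<xi>. orbit (per u) \<xi> \<and> \<xi> (length u) = \<xi> 0"
proof -
  obtain \<xi>1 where x1: "orbit (per u) \<xi>1" using per unfolding itineraries_def by blast
  have perL: "per u n \<in> L" for n using x1 unfolding orbit_def by blast
  define \<Theta> where "\<Theta> = {\<xi>. orbit (per u) \<xi>}"
  have eq: "\<Theta> = box \<inter> (\<Inter>n. {\<xi>. E (per u n) (\<xi> n) (\<xi> (Suc n))})"
  proof
    show "\<Theta> \<subseteq> box \<inter> (\<Inter>n. {\<xi>. E (per u n) (\<xi> n) (\<xi> (Suc n))})"
      unfolding \<Theta>_def using orbit_box by (auto simp: orbit_def)
    show "box \<inter> (\<Inter>n. {\<xi>. E (per u n) (\<xi> n) (\<xi> (Suc n))}) \<subseteq> \<Theta>"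
      unfolding \<Theta>_def using perL by (auto simp: orbit_def)
  qed
  have "compact \<Theta>" unfolding eq
  proof (rule compact_Int_closed)
    show "compact box" unfolding box_def by (rule compact_box)
  qed (use closed_step[OF perL] in \<open>auto intro!: closed_INT\<close>)
  moreover have "\<Theta> \<noteq> {}" using x1 unfolding \<Theta>_def by blast
  moreover have "continuous_on \<Theta> (\<lambda>\<xi>. \<xi> 0)"
    by (rule continuous_on_subset[OF continuous_on_product_coordinates]) simp
  ultimately obtain \<xi> where xi: "orbit (per u) \<xi>" "\<And>\<eta>. orbit (per u) \<eta> \<Longrightarrow> \<xi> 0 \<le> \<eta> 0"
    using continuous_attains_inf[of \<Theta> "\<lambda>\<xi>. \<xi> 0"] unfolding \<Theta>_def by blast
  let ?n = "length u"
  have "orbit (per u) (\<lambda>n. \<xi> (?n + n))" using orbit_drp[OF xi(1), of ?n] drp_per[OF u, of 1] by simp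
  then have "\<xi> 0 \<le> \<xi> ?n" using xi(2) by fastforce
  moreover have "lo \<le> \<xi> 0" using orbit_box[OF xi(1)] by (simp add: box_def)
  ultimately obtain \<zeta> where z: "\<zeta> ?n = \<xi> 0" "\<zeta> 0 \<le> \<xi> 0" "\<forall>k<?n. E (per u k) (\<zeta> k) (\<zeta> (Suc k))"
    using lower_path[of ?n "per u" \<xi> "\<xi> 0"] xi(1) unfolding orbit_def by auto
  define \<omega> where "\<omega> k = (if k < ?n then \<zeta> k else \<xi> (k - ?n))" for k
  have "orbit (cat (tk ?n (per u)) (per u)) \<omega>"
    unfolding \<omega>_def using z perL by (intro glue xi(1)) auto
  then have om: "orbit (per u) \<omega>" using tk_per[OF u, of 1] per_cat[OF u] by (simp add: pow_Suc)
  have "\<omega> 0 = \<zeta> 0" using u by (simp add: \<omega>_def)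
  then have "\<omega> 0 = \<xi> 0" using z(2) xi(2)[OF om] by simp
  then have "\<omega> ?n = \<omega> 0" by (simp add: \<omega>_def)
  then show ?thesis using om by blast
qed

end

section \<open>Geometry of a lifted graph\<close>

lemma compact_closed_subset: "compact K \<Longrightarrow> closed A \<Longrightarrow> A \<subseteq> K \<Longrightarrow> compact A"
  using compact_Int_closed[of K A] by (simp add: Int_absorb1)

locale lifted =
  fixes h :: "real \<Rightarrow> 'a::t2_space" and \<tau> :: "'a \<Rightarrow> 'a"
  assumes lg: "lifted_graph h \<tau>"
begin

abbreviation "r \<equiv> retr h"
abbreviation "H \<equiv> range h"

lemma h_homeo: "\<exists>g. homeomorphism UNIV H h g" using lg by (simp add: lifted_graph_def)
lemma tau_homeo: "\<exists>g. homeomorphism UNIV UNIV \<tau> g" using lg by (simp add: lifted_graph_def)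
lemma tau_h: "\<tau> (h x) = h (x + 1)" using lg by (simp add: lifted_graph_def)

lemma inj_h: "inj h"
proof -
  obtain g where "homeomorphism UNIV H h g" using h_homeo by blast
  then show ?thesis by (metis homeomorphism_def UNIV_I injI)
qed

lemma cont_h: "continuous_on A h"
  using h_homeo continuous_on_subset unfolding homeomorphism_def by blast

lemma r_h [simp]: "r (h t) = t" by (simp add: retr_def inj_h)

lemma cont_r: "continuous_on A r"
proof -
  obtain g where g: "homeomorphism UNIV H h g" using h_homeo by blast
  have ret: "retraction UNIV H (h \<circ> r)" using lg by (simp add: lifted_graph_def)
  have 1: "continuous_on UNIV (h \<circ> r)" using ret by (simp add: retraction_def)
  have 2: "continuous_on H g" using g by (simp add: homeomorphism_def)
  have "continuous_on UNIV (g \<circ> (h \<circ> r))"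
    by (rule continuous_on_compose[OF 1 continuous_on_subset[OF 2]]) auto
  moreover have "g \<circ> (h \<circ> r) = r" using g by (auto simp: homeomorphism_def)
  ultimately show ?thesis using continuous_on_subset by fastforce
qed

lemma closed_H: "closed H"
proof -
  have "H = {x. h (r x) = x}" by auto (metis rangeI)
  moreover have "closed {x. h (r x) = x}"
    by (rule closed_Collect_eq) (auto intro!: continuous_on_compose2[OF cont_h cont_r] continuous_intros)
  ultimately show ?thesis by simp
qed

lemma foot:
  assumes "C \<in> components (- H)" "x \<in> C"
  shows "closure C \<inter> H = {h (r x)}"
proof -
  obtain t where t: "closure C \<inter> H = {h t}" using lg assms(1) by (auto simp: lifted_graph_def)
  have C: "C = connected_component_set (- H) x"
    using assms by (metis components_iff connected_component_eq)
  have x: "x \<notin> H" using assms in_components_subset by blast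
  have "r x = (THE t. closure C \<inter> H = {h t})" using x C by (simp add: retr_def)
  also have "\<dots> = t" using t inj_h by (auto simp: inj_eq)
  finally show ?thesis using t by simp
qed

lemma foot_eq: "C \<in> components (- H) \<Longrightarrow> x \<in> C \<Longrightarrow> y \<in> C \<Longrightarrow> r x = r y"
  using foot[of C x] foot[of C y] inj_h by (simp add: inj_eq)

lemma component_of: "x \<notin> H \<Longrightarrow> \<exists>C\<in>components (- H). x \<in> C"
  by (metis ComplI Union_components UnionE)

lemma bij_tau: "bij \<tau>"
proof -
  obtain g where "homeomorphism UNIV UNIV \<tau> g" using tau_homeo by blast
  then show ?thesis unfolding homeomorphism_def by (metis UNIV_I bijI injI)
qed

lemma cont_tau: "continuous_on A \<tau>"
  using tau_homeo continuous_on_subset unfolding homeomorphism_def by blast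

lemma cont_inv_tau: "continuous_on A (inv \<tau>)"
proof -
  obtain g where g: "homeomorphism UNIV UNIV \<tau> g" using tau_homeo by blast
  have "inv \<tau> = g" using g bij_tau unfolding homeomorphism_def
    by (metis UNIV_I bij_is_surj ext inv_f_f bij_is_inj)
  then show ?thesis using g continuous_on_subset unfolding homeomorphism_def by blast
qed

lemma tau_H: "\<tau> x \<in> H \<longleftrightarrow> x \<in> H"
proof
  assume "\<tau> x \<in> H"
  then obtain t where "\<tau> x = h t" by blast
  then have "\<tau> x = \<tau> (h (t - 1))" by (simp add: tau_h)
  then show "x \<in> H" using bij_tau by (metis bij_is_inj inj_eq rangeI)
qed (auto simp: tau_h)

text \<open>A component is mapped by \<open>\<tau>\<close> into a component whose closure contains the translated foot.\<close>

lemma r_tau: "r (\<tau> x) = r x + 1"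
proof (cases "x \<in> H")
  case True then show ?thesis by (auto simp: tau_h)
next
  case False
  then obtain C where C: "C \<in> components (- H)" "x \<in> C" using component_of by blast
  have "connected (\<tau> ` C)"
    using C(1) in_components_connected by (intro connected_continuous_image cont_tau) auto
  moreover have "\<tau> ` C \<subseteq> - H" using in_components_subset[OF C(1)] tau_H by auto
  moreover have "\<tau> x \<notin> H" using False by (simp add: tau_H)
  then obtain C' where C': "C' \<in> components (- H)" "\<tau> x \<in> C'" using component_of[of "\<tau> x"] by metis
  ultimately have "\<tau> ` C \<subseteq> C'" using C(2) by (intro components_maximal[OF C'(1)]) auto
  have "h (r x) \<in> closure C" using foot[OF C] by blast
  then have "\<tau> (h (r x)) \<in> closure (\<tau> ` C)"
    using image_closure_subset[of C \<tau> "closure (\<tau> ` C)"] cont_tau closure_subset by blast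
  moreover have "closure (\<tau> ` C) \<subseteq> closure C'" using \<open>\<tau> ` C \<subseteq> C'\<close> by (rule closure_mono)
  ultimately have "h (r x + 1) \<in> closure C'" by (auto simp: tau_h)
  then have "h (r x + 1) \<in> closure C' \<inter> H" by blast
  then have "h (r x + 1) = h (r (\<tau> x))" unfolding foot[OF C'] by blast
  then show ?thesis using inj_h by (simp add: inj_eq)
qed

abbreviation "sh \<equiv> shift \<tau>"

lemma sh_0 [simp]: "sh 0 x = x" by (simp add: shift_def)

lemma sh_Suc: "sh (m + 1) x = \<tau> (sh m x)"
proof (cases "0 \<le> m")
  case True then show ?thesis by (simp add: shift_def nat_add_distrib)
next
  case False
  define k where "k = nat (- m) - 1"
  have k: "nat (- m) = Suc k" "m < 0" using False unfolding k_def by auto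
  have "sh (m + 1) x = (inv \<tau> ^^ k) x"
  proof (cases "m = -1")
    case True then show ?thesis using k by (simp add: shift_def)
  next
    case False
    then have "nat (- (m + 1)) = k" "m + 1 < 0" using k by auto
    then show ?thesis by (simp add: shift_def)
  qed
  moreover have "\<tau> (sh m x) = (inv \<tau> ^^ k) x"
    using k bij_tau by (simp add: shift_def bij_is_surj surj_f_inv_f)
  ultimately show ?thesis by simp
qed

lemma sh_pred: "sh (m - 1) x = inv \<tau> (sh m x)"
  using sh_Suc[of "m - 1" x] bij_tau by (simp add: bij_is_inj)

lemma sh_add: "sh (m + n) x = sh m (sh n x)"
proof (induction m rule: int_induct[where k = 0])
  case (step1 i)
  then show ?case using sh_Suc[of "i + n"] sh_Suc[of i] by (simp add: algebra_simps)
next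
  case (step2 i)
  have "sh (i - 1 + n) x = inv \<tau> (sh (i + n) x)" using sh_pred[of "i + n"] by (simp add: algebra_simps)
  then show ?case using step2 by (simp add: sh_pred)
qed simp

lemma sh_sh [simp]: "sh m (sh n x) = sh (m + n) x" by (simp add: sh_add)

lemma r_sh [simp]: "r (sh m x) = r x + of_int m"
proof (induction m rule: int_induct[where k = 0])
  case (step2 i)
  have "\<tau> (sh (i - 1) x) = sh i x" using sh_Suc[of "i - 1"] by simp
  then have "r (sh (i - 1) x) + 1 = r (sh i x)" by (metis r_tau)
  then show ?case using step2 by simp
qed (simp_all add: sh_Suc r_tau)

lemma sh_h: "sh m (h t) = h (t + of_int m)"
proof (induction m rule: int_induct[where k = 0])
  case (step1 i) then show ?case by (simp add: sh_Suc tau_h add.assoc)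
next
  case (step2 i)
  have "inv \<tau> (h (t + of_int i)) = h (t + of_int i - 1)"
    using bij_tau tau_h[of "t + of_int i - 1"] by (metis bij_is_inj diff_add_cancel inv_f_f)
  then show ?case using step2 by (simp add: sh_pred algebra_simps)
qed simp

lemma sh_H: "sh m x \<in> H \<longleftrightarrow> x \<in> H"
proof -
  have 1: "x \<in> H \<Longrightarrow> sh m x \<in> H" for m x by (auto simp: sh_h)
  show ?thesis using 1 1[of "sh m x" "- m"] by auto
qed

lemma cont_sh: "continuous_on A (sh m)"
proof -
  have 1: "continuous_on UNIV (\<tau> ^^ n)" for n
  proof (induction n)
    case (Suc n) then show ?case using continuous_on_compose[OF Suc cont_tau] by simp
  qed (simp add: id_def)
  have 2: "continuous_on UNIV (inv \<tau> ^^ n)" for n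
  proof (induction n)
    case (Suc n) then show ?case using continuous_on_compose[OF Suc cont_inv_tau] by simp
  qed (simp add: id_def)
  have "sh m = (if 0 \<le> m then \<tau> ^^ nat m else inv \<tau> ^^ nat (- m))" by (auto simp: shift_def)
  then have "continuous_on UNIV (sh m)" using 1 2 by presburger
  then show ?thesis using continuous_on_subset by blast
qed

lemma sh_inj [simp]: "sh m x = sh m y \<longleftrightarrow> x = y"
  by (metis add.left_inverse sh_0 sh_sh)

lemma sh_image: "sh m ` A = sh (- m) -` A"
proof
  show "sh (- m) -` A \<subseteq> sh m ` A"
  proof
    fix x assume "x \<in> sh (- m) -` A"
    then have "sh (- m) x \<in> A" "x = sh m (sh (- m) x)" by simp_all
    then show "x \<in> sh m ` A" by blast
  qed
qed auto

lemma closed_sh: "closed A \<Longrightarrow> closed (sh m ` A)"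
  unfolding sh_image by (intro closed_vimage cont_sh)

lemma finite_near: "finite {C \<in> components (- H). closure C \<inter> h ` {0..1} \<noteq> {}}"
  using lg by (simp add: lifted_graph_def)

lemma near:
  assumes "C \<in> components (- H)" "x \<in> C" "r x \<in> {0..1}"
  shows "C \<in> {C \<in> components (- H). closure C \<inter> h ` {0..1} \<noteq> {}}"
  using foot[OF assms(1,2)] assms(1,3) by blast

lemma compact_unit_band: "compact {x. r x \<in> {0..1}}"
proof -
  let ?K = "h ` {0..1} \<union> (\<Union>C\<in>{C \<in> components (- H). closure C \<inter> h ` {0..1} \<noteq> {}}. closure C)"
  have "compact (closure C)" if "C \<in> components (- H)" for C
    using lg that by (simp add: lifted_graph_def finite_graph_def)
  then have "compact ?K" using finite_near
    by (intro compact_Un compact_continuous_image cont_h compact_UN) auto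
  moreover have "closed {x. r x \<in> {0..1}}"
    using closed_vimage[OF closed_real_atLeastAtMost cont_r, of 0 1] by (simp add: vimage_def)
  moreover have "{x. r x \<in> {0..1}} \<subseteq> ?K"
  proof
    fix x assume x: "x \<in> {x. r x \<in> {0..1}}"
    show "x \<in> ?K"
    proof (cases "x \<in> H")
      case False
      then obtain C where C: "C \<in> components (- H)" "x \<in> C" using component_of by blast
      then show ?thesis using near[OF C] x closure_subset by blast
    qed (use x in auto)
  qed
  ultimately show ?thesis by (rule compact_closed_subset)
qed

lemma compact_band: "compact {x. r x \<in> {a..b}}"
proof -
  let ?K = "\<Union>k\<in>{\<lfloor>a\<rfloor>..\<lfloor>b\<rfloor>}. sh k ` {x. r x \<in> {0..1}}"
  have "compact ?K" by (intro compact_UN compact_continuous_image cont_sh compact_unit_band) auto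
  moreover have "closed {x. r x \<in> {a..b}}"
    using closed_vimage[OF closed_real_atLeastAtMost cont_r, of a b] by (simp add: vimage_def)
  moreover have "{x. r x \<in> {a..b}} \<subseteq> ?K"
  proof
    fix x assume x: "x \<in> {x. r x \<in> {a..b}}"
    have "x = sh \<lfloor>r x\<rfloor> (sh (- \<lfloor>r x\<rfloor>) x)" by simp
    moreover have "r (sh (- \<lfloor>r x\<rfloor>) x) \<in> {0..1}" by (simp; linarith)
    moreover have "\<lfloor>r x\<rfloor> \<in> {\<lfloor>a\<rfloor>..\<lfloor>b\<rfloor>}" using x by (simp add: floor_mono)
    ultimately show "x \<in> ?K" by blast
  qed
  ultimately show ?thesis by (rule compact_closed_subset)
qed

lemma finite_unit_feet: "finite (r ` (- H) \<inter> {0..1})"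
proof -
  let ?N = "{C \<in> components (- H). closure C \<inter> h ` {0..1} \<noteq> {}}"
  have "r ` (- H) \<inter> {0..1} \<subseteq> (\<lambda>C. r (SOME y. y \<in> C)) ` ?N"
  proof
    fix t assume "t \<in> r ` (- H) \<inter> {0..1}"
    then obtain x where x: "x \<notin> H" "t = r x" "t \<in> {0..1}" by blast
    then obtain C where C: "C \<in> components (- H)" "x \<in> C" using component_of by blast
    have s: "(SOME y. y \<in> C) \<in> C" using C(2) by (rule someI)
    have "r (SOME y. y \<in> C) = r x" using foot[OF C] foot[OF C(1) s] inj_h by (simp add: inj_eq)
    moreover have "C \<in> ?N" using near[OF C] x by simp
    ultimately show "t \<in> (\<lambda>C. r (SOME y. y \<in> C)) ` ?N" using x(2) by (intro image_eqI[of _ _ C]) simp_all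
  qed
  then show ?thesis using finite_near finite_surj by blast
qed

lemma finite_feet: "finite (r ` (- H) \<inter> {a..b})"
proof -
  have "r ` (- H) \<inter> {a..b} \<subseteq> (\<Union>k\<in>{\<lfloor>a\<rfloor>..\<lfloor>b\<rfloor>}. (\<lambda>t. t + of_int k) ` (r ` (- H) \<inter> {0..1}))"
  proof
    fix t assume "t \<in> r ` (- H) \<inter> {a..b}"
    then obtain x where x: "x \<notin> H" "t = r x" "t \<in> {a..b}" by blast
    let ?y = "sh (- \<lfloor>r x\<rfloor>) x"
    have "?y \<notin> H" using x(1) by (simp add: sh_H)
    moreover have "r ?y \<in> {0..1}" by (simp; linarith)
    ultimately have "r ?y \<in> r ` (- H) \<inter> {0..1}" by (intro IntI imageI) simp_all
    moreover have "t = r ?y + of_int \<lfloor>r x\<rfloor>" using x by simp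
    moreover have "\<lfloor>r x\<rfloor> \<in> {\<lfloor>a\<rfloor>..\<lfloor>b\<rfloor>}" using x by (auto intro: floor_mono)
    ultimately show "t \<in> (\<Union>k\<in>{\<lfloor>a\<rfloor>..\<lfloor>b\<rfloor>}. (\<lambda>t. t + of_int k) ` (r ` (- H) \<inter> {0..1}))" by blast
  qed
  moreover have "finite (\<Union>k\<in>{\<lfloor>a\<rfloor>..\<lfloor>b\<rfloor>}. (\<lambda>t. t + of_int k) ` (r ` (- H) \<inter> {0..1}))"
    using finite_unit_feet by simp
  ultimately show ?thesis by (rule finite_subset)
qed

text \<open>Near \<open>t\<close> only finitely many components are attached to the line.\<close>

lemma isolated_foot: "\<exists>\<delta>>0. \<forall>x. x \<notin> H \<longrightarrow> \<bar>r x - t\<bar> < \<delta> \<longrightarrow> r x = t"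
proof -
  let ?A = "r ` (- H) \<inter> {t - 1..t + 1} - {t}"
  obtain d where d: "d > 0" "\<forall>y\<in>?A. y \<noteq> t \<longrightarrow> d \<le> dist t y"
    using finite_set_avoid[of ?A t] finite_feet by blast
  have "r x = t" if "x \<notin> H" "\<bar>r x - t\<bar> < min d 1" for x
  proof (rule ccontr)
    assume n: "r x \<noteq> t"
    then have "r x \<in> ?A" using that by auto
    then have "d \<le> dist t (r x)" using d(2) n by blast
    then show False using that(2) by (simp add: dist_real_def abs_minus_commute)
  qed
  then show ?thesis using d(1) by (intro exI[of _ "min d 1"]) simp
qed

text \<open>What hangs at \<open>h t\<close> is open without \<open>h t\<close>, since no other feet are close.\<close>

lemma open_fibre: "open ({x. r x = t} - {h t})"
proof -
  obtain \<delta> where d: "\<delta> > 0" "\<forall>x. x \<notin> H \<longrightarrow> \<bar>r x - t\<bar> < \<delta> \<longrightarrow> r x = t" using isolated_foot by blast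
  have "{x. r x = t} - {h t} = - H \<inter> r -` {t - \<delta><..<t + \<delta>}"
  proof
    show "- H \<inter> r -` {t - \<delta><..<t + \<delta>} \<subseteq> {x. r x = t} - {h t}"
    proof
      fix x assume x: "x \<in> - H \<inter> r -` {t - \<delta><..<t + \<delta>}"
      then have "\<bar>r x - t\<bar> < \<delta>" by auto
      then show "x \<in> {x. r x = t} - {h t}" using d(2) x by blast
    qed
  qed (use d(1) in auto)
  moreover have "open (- H \<inter> r -` {t - \<delta><..<t + \<delta>})"
    using closed_H by (intro open_Int open_Compl open_vimage cont_r) auto
  ultimately show ?thesis by simp
qed

text \<open>Without \<open>h t\<close> the space is the disjoint union of three open sets, on which \<open>r\<close> is less than,
  equal to, and greater than \<open>t\<close>.\<close>

lemma separation:
  assumes S: "connected S" and a: "a \<in> S" "r a \<le> t" and b: "b \<in> S" "t \<le> r b" and ne: "r a \<noteq> r b"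
  shows "h t \<in> S"
proof (rule ccontr)
  assume n: "h t \<notin> S"
  have ol: "open {x. r x < t}" "open {x. r x > t}"
    using open_vimage[OF open_lessThan cont_r] open_vimage[OF open_greaterThan cont_r]
    by (simp_all add: vimage_def)
  have of: "open ({x. r x = t} - {h t})" by (rule open_fibre)
  define A B where "A = (if r a < t then {x. r x < t} else {x. r x < t} \<union> ({x. r x = t} - {h t}))"
    and "B = (if r a < t then {x. r x > t} \<union> ({x. r x = t} - {h t}) else {x. r x > t})"
  have "open A" "open B" using ol of unfolding A_def B_def by auto
  moreover have "A \<inter> B \<inter> S = {}" unfolding A_def B_def by auto
  moreover have "S \<subseteq> A \<union> B" using n unfolding A_def B_def by force
  moreover have "a \<in> A" "b \<in> B" using a b ne n unfolding A_def B_def by force+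
  ultimately show False using connectedD[OF S] a b by blast
qed

lemma component_open:
  assumes C: "C \<in> components (- H)" and x: "x \<in> C" "r x \<in> {0..1}"
  shows "open C"
proof -
  let ?W = "{y. r y = r x} - {h (r x)}"
  let ?N = "{C \<in> components (- H). closure C \<inter> h ` {0..1} \<noteq> {}}"
  have fibre: "r y = r x" if "y \<in> C" for y using foot_eq[OF C that x(1)] .
  have CH: "C \<inter> H = {}" using in_components_subset[OF C] by blast
  have "C = ?W \<inter> (\<Inter>D\<in>?N - {C}. - closure D)"
  proof
    show "C \<subseteq> ?W \<inter> (\<Inter>D\<in>?N - {C}. - closure D)"
    proof
      fix y assume y: "y \<in> C"
      have "y \<notin> closure D" if D: "D \<in> ?N - {C}" for D
      proof
        assume "y \<in> closure D"
        have Dc: "D \<in> components (- H)" using D by blast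
        have "closedin (top_of_set (- H)) D" using Dc by (rule closedin_component)
        then obtain K where K: "closed K" "D = - H \<inter> K" by (auto simp: closedin_closed)
        then have "closure D \<subseteq> K" by (simp add: closure_minimal)
        then have "y \<in> D" using \<open>y \<in> closure D\<close> K(2) y CH by blast
        moreover have "C \<inter> D = {}" using components_nonoverlap[OF C Dc] D by blast
        ultimately show False using y by blast
      qed
      then show "y \<in> ?W \<inter> (\<Inter>D\<in>?N - {C}. - closure D)" using y fibre CH by auto
    qed
    show "?W \<inter> (\<Inter>D\<in>?N - {C}. - closure D) \<subseteq> C"
    proof
      fix y assume y: "y \<in> ?W \<inter> (\<Inter>D\<in>?N - {C}. - closure D)"
      then have "y \<notin> H" by auto
      then obtain D where D: "D \<in> components (- H)" "y \<in> D" using component_of by blast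
      have "D \<in> ?N" using near[OF D] y x(2) by simp
      moreover have "y \<in> closure D" using D closure_subset by blast
      ultimately have "D = C" using y by blast
      then show "y \<in> C" using D by simp
    qed
  qed
  moreover have "open (?W \<inter> (\<Inter>D\<in>?N - {C}. - closure D))"
    using finite_near by (intro open_Int open_fibre open_INT) auto
  ultimately show ?thesis by metis
qed

end

section \<open>Displacements and the rotation set of the line\<close>

locale lifted_map = lifted +
  fixes F :: "'a \<Rightarrow> 'a"
  assumes cont_F: "continuous_on UNIV F" and deg: "degree_one \<tau> F"
begin

lemma F_tau: "F (\<tau> x) = \<tau> (F x)" using deg by (simp add: degree_one_def)

lemma F_sh: "F (sh m x) = sh m (F x)"
proof (induction m rule: int_induct[where k = 0])
  case (step1 i) then show ?case by (simp add: sh_Suc F_tau)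
next
  case (step2 i)
  have "\<tau> (F (sh (i - 1) x)) = F (sh i x)" using sh_Suc[of "i - 1" x] by (simp add: F_tau[symmetric])
  also have "\<dots> = \<tau> (sh (i - 1) (F x))" using step2 sh_Suc[of "i - 1" "F x"] by simp
  finally show ?case using bij_tau by (simp add: bij_is_inj inj_eq)
qed simp

lemma Fn_sh: "(F ^^ n) (sh m x) = sh m ((F ^^ n) x)"
  by (induction n) (simp_all add: F_sh)

lemma cont_Fn: "continuous_on A (F ^^ n)"
proof -
  have "continuous_on UNIV (F ^^ n)"
  proof (induction n)
    case (Suc n)
    then show ?case using continuous_on_compose[OF Suc continuous_on_subset[OF cont_F]] by simp
  qed (simp add: id_def)
  then show ?thesis using continuous_on_subset by blast
qed

definition disp :: "nat \<Rightarrow> 'a \<Rightarrow> real" where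
  "disp n x = r ((F ^^ n) x) - r x"

lemma disp_sh [simp]: "disp n (sh m x) = disp n x" by (simp add: disp_def Fn_sh)

lemma disp_0 [simp]: "disp 0 x = 0" by (simp add: disp_def)

lemma disp_add: "disp (n + k) x = disp k x + disp n ((F ^^ k) x)"
  by (simp add: disp_def funpow_add)

lemma cont_disp: "continuous_on A (disp n)"
  unfolding disp_def by (intro continuous_on_diff cont_r continuous_on_compose2[OF cont_r cont_Fn]) auto

lemma unit_translate: "\<exists>m. r (sh m x) \<in> {0..<1}"
  by (rule exI[of _ "- \<lfloor>r x\<rfloor>"]) (simp; linarith)

lemma speed_bound: "\<exists>C\<ge>0. \<forall>x. \<bar>disp 1 x\<bar> \<le> C"
proof -
  have "compact (disp 1 ` {x. r x \<in> {0..1}})"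
    by (intro compact_continuous_image cont_disp compact_unit_band)
  then obtain C where C: "\<forall>x\<in>{x. r x \<in> {0..1}}. \<bar>disp 1 x\<bar> \<le> C"
    using compact_imp_bounded bounded_real by (metis (mono_tags, lifting) imageI)
  have "\<bar>disp 1 x\<bar> \<le> C" for x
  proof -
    obtain m where "r (sh m x) \<in> {0..<1}" using unit_translate by blast
    then have "sh m x \<in> {x. r x \<in> {0..1}}" by simp
    then have "\<bar>disp 1 (sh m x)\<bar> \<le> C" using C by blast
    then show ?thesis by (simp only: disp_sh)
  qed
  moreover from this[of "h 0"] have "C \<ge> 0" by linarith
  ultimately show ?thesis by blast
qed

definition speed :: real where "speed = (SOME C. C \<ge> 0 \<and> (\<forall>x. \<bar>disp 1 x\<bar> \<le> C))"

lemma speed: "speed \<ge> 0" "\<bar>disp 1 x\<bar> \<le> speed"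
  using someI_ex[OF speed_bound[unfolded Bex_def]] unfolding speed_def[symmetric] by blast+

lemma disp_Suc: "\<bar>disp (Suc n) x - disp n x\<bar> \<le> speed"
  using disp_add[of 1 n x] speed(2)[of "(F ^^ n) x"] by simp

lemma disp_bound: "\<bar>disp n x\<bar> \<le> speed * real n"
proof (induction n)
  case (Suc n) then show ?case using disp_Suc[of n x] by (simp add: algebra_simps)
qed simp

lemma upper_rot_disp: "upper_rot h F x = limsup (\<lambda>n. ereal (disp n x / real n))"
  by (simp add: upper_rot_def disp_def)

lemma lower_rot_disp: "lower_rot h F x = liminf (\<lambda>n. ereal (disp n x / real n))"
  by (simp add: lower_rot_def disp_def)

lemma has_rot_of_tendsto: "(\<lambda>n. disp n x / real n) \<longlonglongrightarrow> \<alpha> \<Longrightarrow> has_rot h F x (ereal \<alpha>)"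
  unfolding has_rot_def upper_rot_disp lower_rot_disp
  by (simp add: lim_imp_Limsup lim_imp_Liminf)

lemma rot_cong:
  assumes "\<And>n. \<bar>disp n x - disp n y\<bar> \<le> C"
  shows "upper_rot h F x = upper_rot h F y" "lower_rot h F x = lower_rot h F y"
  unfolding upper_rot_disp lower_rot_disp using rates_cong(1,2)[of "\<lambda>n. disp n x" "\<lambda>n. disp n y" C, OF assms] by blast+

lemma rot_tail: "upper_rot h F ((F ^^ k) x) = upper_rot h F x" "lower_rot h F ((F ^^ k) x) = lower_rot h F x"
proof -
  have "\<bar>disp n ((F ^^ k) x) - disp n x\<bar> \<le> 2 * (speed * real k)" for n
  proof -
    have "disp n ((F ^^ k) x) - disp n x = disp k ((F ^^ n) x) - disp k x"
      using disp_add[of n k x] disp_add[of k n x] by (simp add: add.commute)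
    then show ?thesis using disp_bound[of k "(F ^^ n) x"] disp_bound[of k x] by linarith
  qed
  from rot_cong[OF this] show "upper_rot h F ((F ^^ k) x) = upper_rot h F x"
    "lower_rot h F ((F ^^ k) x) = lower_rot h F x" .
qed

lemma rot_sh: "upper_rot h F (sh m x) = upper_rot h F x" "lower_rot h F (sh m x) = lower_rot h F x"
  by (simp_all add: upper_rot_disp lower_rot_disp)

text \<open>The unit segment is placed so that \<open>y\<close> lies between the projections of the images of its ends,
  which differ by exactly 1 because \<open>F\<close> has degree one.\<close>

lemma line_cover: "\<exists>x. (F ^^ n) (h x) = h y \<and> \<bar>y - x - disp n (h x0)\<bar> \<le> 1"
proof -
  let ?d = "disp n (h x0)"
  define j where "j = \<lfloor>y - x0 - ?d\<rfloor>"
  define x1 where "x1 = x0 + of_int j"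
  have rx: "r ((F ^^ n) (h (x0 + of_int k))) = x0 + of_int k + ?d" for k
    by (simp add: sh_h[symmetric] Fn_sh disp_def)
  have r1: "r ((F ^^ n) (h x1)) = x1 + ?d" unfolding x1_def by (rule rx)
  have r2: "r ((F ^^ n) (h (x1 + 1))) = x1 + 1 + ?d" unfolding x1_def using rx[of "j + 1"] by (simp add: add.assoc)
  have j: "x1 + ?d \<le> y" "y \<le> x1 + 1 + ?d" unfolding x1_def j_def by linarith+
  have "connected ((F ^^ n) ` h ` {x1..x1 + 1})"
    by (intro connected_continuous_image cont_Fn cont_h) simp
  then have "h y \<in> (F ^^ n) ` h ` {x1..x1 + 1}"
    by (rule separation[where a = "(F ^^ n) (h x1)" and b = "(F ^^ n) (h (x1 + 1))"]) (use r1 r2 j in auto)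
  then obtain x where x: "x \<in> {x1..x1 + 1}" "(F ^^ n) (h x) = h y" by force
  then show ?thesis using j by (intro exI[of _ x]) auto
qed

text \<open>The points may vary with \<open>n\<close> here; \<open>line_realise\<close> shows that one point suffices.\<close>

definition line_rates :: "real set" where
  "line_rates = {\<alpha>. \<forall>\<epsilon>>0. \<forall>n0. \<exists>n\<ge>n0. \<exists>x. \<bar>disp n (h x) - \<alpha> * real n\<bar> \<le> \<epsilon> * real n}"

text \<open>By \<open>line_cover\<close>, finitely many pieces of orbits with mean displacements close to \<open>\<alpha>\<close> can be
  concatenated, and compactness handles infinitely many.\<close>

lemma line_realise:
  assumes "\<alpha> \<in> line_rates"
  shows "\<exists>x. (\<lambda>n. disp n (h x) / real n) \<longlonglongrightarrow> \<alpha>"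
proof -
  have "\<exists>n x. n \<ge> Suc j \<and> \<bar>disp n (h x) - \<alpha> * real n\<bar> \<le> 1 / real (Suc j) * real n" for j
  proof -
    have "(0::real) < 1 / real (Suc j)" by simp
    then show ?thesis using assms unfolding line_rates_def by blast
  qed
  then obtain len X where len: "\<And>j. len j \<ge> Suc j"
    and X: "\<And>j. \<bar>disp (len j) (h (X j)) - \<alpha> * real (len j)\<bar> \<le> 1 / real (Suc j) * real (len j)"
    by metis
  define \<epsilon> where "\<epsilon> j = 2 / real (Suc j)" for j
  have eps: "\<epsilon> \<longlonglongrightarrow> 0" unfolding \<epsilon>_def
    using LIMSEQ_Suc[OF lim_const_over_n[of "2::real"]] by simp
  have len1: "len j \<ge> 1" for j using len[of j] by simp
  obtain \<rho> where rho: "\<forall>a C \<alpha>.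
    (\<forall>n. \<bar>a (Suc n) - a n\<bar> \<le> C) \<longrightarrow>
    (\<forall>i. \<bar>a (\<Sum>l<Suc i. len (\<rho> l)) - a (\<Sum>l<i. len (\<rho> l)) - \<alpha> * real (len (\<rho> i))\<bar>
           \<le> \<epsilon> (\<rho> i) * real (len (\<rho> i))) \<longrightarrow>
    (\<lambda>n. a n / real n) \<longlonglongrightarrow> \<alpha>"
    by (rule exE[OF block_average[OF len1 eps]])
  define T where "T i = (\<Sum>l<i. len (\<rho> l))" for i
  have TS: "T (Suc i) = len (\<rho> i) + T i" for i by (simp add: T_def)
  define good where "good l x \<longleftrightarrow>
    \<bar>disp (T (Suc l)) (h x) - disp (T l) (h x) - \<alpha> * real (len (\<rho> l))\<bar> \<le> \<epsilon> (\<rho> l) * real (len (\<rho> l))" for l x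
  have fin: "\<exists>x. (F ^^ T i) (h x) = h y \<and> (\<forall>l<i. good l x)" for i y
  proof (induction i arbitrary: y)
    case 0 then show ?case by (intro exI[of _ y]) (simp add: T_def)
  next
    case (Suc i)
    let ?n = "len (\<rho> i)"
    obtain y' where y': "(F ^^ ?n) (h y') = h y" "\<bar>y - y' - disp ?n (h (X (\<rho> i)))\<bar> \<le> 1" using line_cover by blast
    obtain x where x: "(F ^^ T i) (h x) = h y'" "\<forall>l<i. good l x" using Suc by blast
    have 1: "(F ^^ T (Suc i)) (h x) = h y" by (simp add: TS funpow_add x(1) y'(1))
    have "disp (T (Suc i)) (h x) - disp (T i) (h x) = y - y'" using 1 x(1) by (simp add: disp_def)
    moreover have "1 \<le> 1 / real (Suc (\<rho> i)) * real ?n" using len[of "\<rho> i"] by (simp add: field_simps)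
    moreover have "\<epsilon> (\<rho> i) * real ?n = 1 / real (Suc (\<rho> i)) * real ?n + 1 / real (Suc (\<rho> i)) * real ?n"
      by (simp add: \<epsilon>_def)
    ultimately have "good i x" unfolding good_def using y'(2) X[of "\<rho> i"] by linarith
    then show ?case using 1 x(2) by (auto simp: less_Suc_eq)
  qed
  have cdh: "continuous_on UNIV (\<lambda>x. disp n (h x))" for n
    by (rule continuous_on_compose2[OF cont_disp cont_h]) auto
  have good_shift: "good l (x + of_int m) \<longleftrightarrow> good l x" for l x m
    by (simp add: good_def sh_h[symmetric])
  have "\<exists>x\<in>{0..1}. \<forall>i. x \<in> {x. \<forall>l<i. good l x}"
  proof (rule compact_nested)
    fix i :: nat
    have "{x. \<forall>l<i. good l x} = (\<Inter>l\<in>{..<i}. {x. good l x})" by auto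
    moreover have "closed {x. good l x}" for l
      unfolding good_def by (intro closed_Collect_le continuous_intros cdh)
    ultimately show "closed {x. \<forall>l<i. good l x}" by (metis closed_INT)
    obtain x where "\<forall>l<i. good l x" using fin by blast
    then have "\<forall>l<i. good l (x + of_int (- \<lfloor>x\<rfloor>))" by (simp only: good_shift)
    moreover have "x + of_int (- \<lfloor>x\<rfloor>) \<in> {0..1}" by (simp; linarith)
    ultimately show "{0..1} \<inter> {x. \<forall>l<i. good l x} \<noteq> {}" by blast
  qed auto
  then obtain x where x: "\<And>l. good l x" by blast
  have "(\<lambda>n. disp n (h x) / real n) \<longlonglongrightarrow> \<alpha>"
  proof (rule rho[THEN spec, THEN spec, THEN spec, THEN mp, THEN mp])
    show "\<forall>n. \<bar>disp (Suc n) (h x) - disp n (h x)\<bar> \<le> speed" using disp_Suc by blast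
    show "\<forall>i. \<bar>disp (\<Sum>l<Suc i. len (\<rho> l)) (h x) - disp (\<Sum>l<i. len (\<rho> l)) (h x) - \<alpha> * real (len (\<rho> i))\<bar>
           \<le> \<epsilon> (\<rho> i) * real (len (\<rho> i))"
      using x unfolding good_def T_def by blast
  qed
  then show ?thesis by blast
qed

lemma cluster_in_line_rates: "cluster_rate (\<lambda>n. disp n (h x)) \<alpha> \<Longrightarrow> \<alpha> \<in> line_rates"
  unfolding line_rates_def cluster_rate_def by blast

lemma line_extremes:
  "\<exists>\<alpha>\<in>line_rates. upper_rot h F (h x) = ereal \<alpha>" "\<exists>\<alpha>\<in>line_rates. lower_rot h F (h x) = ereal \<alpha>"
  using extreme_rates[of "\<lambda>n. disp n (h x)" speed, OF disp_bound] cluster_in_line_rates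
  unfolding upper_rot_disp lower_rot_disp by blast+

lemma line_rates_nonempty: "line_rates \<noteq> {}" using line_extremes(1) by blast

lemma line_rates_compact: "compact line_rates"
proof -
  have "\<bar>\<alpha>\<bar> \<le> speed + 1" if a: "\<alpha> \<in> line_rates" for \<alpha>
  proof -
    have "(0::real) < 1" by simp
    then obtain n x where n: "n \<ge> 1" "\<bar>disp n (h x) - \<alpha> * real n\<bar> \<le> 1 * real n"
      using a unfolding line_rates_def by blast
    have "\<bar>\<alpha> * real n\<bar> \<le> \<bar>disp n (h x)\<bar> + real n" using n(2) by linarith
    also have "\<dots> \<le> (speed + 1) * real n" using disp_bound[of n "h x"] by (simp add: algebra_simps)
    finally show ?thesis using n(1) by (simp add: abs_mult)
  qed
  then have "bounded line_rates" unfolding bounded_real by blast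
  moreover have "closed line_rates"
  proof -
    have cl: "\<alpha> \<in> line_rates" if a: "\<alpha> \<in> closure line_rates" for \<alpha>
      unfolding line_rates_def
    proof (intro CollectI allI impI)
      fix \<epsilon> :: real and n0 :: nat assume e: "\<epsilon> > 0"
      obtain \<beta> where b: "\<beta> \<in> line_rates" "dist \<beta> \<alpha> < \<epsilon> / 2"
        using a e unfolding closure_approachable by (meson half_gt_zero)
      have "\<epsilon> / 2 > 0" using e by simp
      then obtain n x where n: "n \<ge> n0" "\<bar>disp n (h x) - \<beta> * real n\<bar> \<le> \<epsilon> / 2 * real n"
        using b(1) unfolding line_rates_def by blast
      have "\<bar>(\<beta> - \<alpha>) * real n\<bar> \<le> \<epsilon> / 2 * real n"
        unfolding abs_mult using b(2) e by (intro mult_mono) (auto simp: dist_real_def)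
      moreover have "disp n (h x) - \<alpha> * real n = (disp n (h x) - \<beta> * real n) + (\<beta> - \<alpha>) * real n"
        by (simp add: algebra_simps)
      moreover have "\<epsilon> / 2 * real n + \<epsilon> / 2 * real n = \<epsilon> * real n" by simp
      ultimately have "\<bar>disp n (h x) - \<alpha> * real n\<bar> \<le> \<epsilon> * real n" using n(2) by linarith
      then show "\<exists>n\<ge>n0. \<exists>x. \<bar>disp n (h x) - \<alpha> * real n\<bar> \<le> \<epsilon> * real n" using n(1) by blast
    qed
    then show ?thesis using closure_subset_eq[of line_rates] by blast
  qed
  ultimately show ?thesis by (simp add: compact_eq_bounded_closed)
qed

text \<open>Two realised values are separated by \<open>\<gamma>\<close> at all large times \<open>n\<close>; the intermediate value theorem
  along the line gives a point whose mean displacement at time \<open>n\<close> is \<open>\<gamma>\<close>.\<close>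

lemma line_rates_interval: "is_interval line_rates"
  unfolding is_interval_1
proof (intro ballI allI impI)
  fix \<alpha> \<beta> \<gamma> assume ab: "\<alpha> \<in> line_rates" "\<beta> \<in> line_rates" and g: "\<alpha> \<le> \<gamma> \<and> \<gamma> \<le> \<beta>"
  show "\<gamma> \<in> line_rates"
  proof (cases "\<gamma> = \<alpha> \<or> \<gamma> = \<beta>")
    case False
    then have lt: "\<alpha> < \<gamma>" "\<gamma> < \<beta>" using g by auto
    obtain x y where x: "(\<lambda>n. disp n (h x) / real n) \<longlonglongrightarrow> \<alpha>" and y: "(\<lambda>n. disp n (h y) / real n) \<longlonglongrightarrow> \<beta>"
      using line_realise ab by metis
    from eventually_conj[OF order_tendstoD(2)[OF x lt(1)] order_tendstoD(1)[OF y lt(2)]]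
    obtain M where M: "\<And>n. n \<ge> M \<Longrightarrow> disp n (h x) / real n < \<gamma> \<and> \<gamma> < disp n (h y) / real n"
      unfolding eventually_sequentially by blast
    show ?thesis unfolding line_rates_def
    proof (intro CollectI allI impI)
      fix \<epsilon> :: real and n0 :: nat assume e: "\<epsilon> > 0"
      define n where "n = Suc (max M n0)"
      have n: "n > 0" "n \<ge> M" "n \<ge> n0" unfolding n_def by auto
      have "disp n (h x) \<le> \<gamma> * real n" "\<gamma> * real n \<le> disp n (h y)"
        using M[OF n(2)] n(1) by (simp_all add: field_simps)
      moreover have "connected (range (\<lambda>x. disp n (h x)))"
        by (intro connected_continuous_image continuous_on_compose2[OF cont_disp cont_h]) auto
      ultimately have "\<gamma> * real n \<in> range (\<lambda>x. disp n (h x))"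
        using connectedD_interval by blast
      then obtain z where "disp n (h z) = \<gamma> * real n" by force
      then show "\<exists>n\<ge>n0. \<exists>x. \<bar>disp n (h x) - \<gamma> * real n\<bar> \<le> \<epsilon> * real n"
        using n(3) e by (intro exI[of _ n] conjI exI[of _ z]) auto
    qed
  qed (use ab in auto)
qed

end

section \<open>Points added by the closure of the images of the line\<close>

lemma five_points:
  fixes B :: "real set"
  assumes "infinite B"
  shows "\<exists>t1\<in>B. \<exists>t2\<in>B. \<exists>t3\<in>B. \<exists>t4\<in>B. \<exists>t5\<in>B. t1 < t2 \<and> t2 < t3 \<and> t3 < t4 \<and> t4 < t5"
proof -
  obtain T where T: "finite T" "card T = 5" "T \<subseteq> B" using infinite_arbitrarily_large[OF assms] by blast
  define xs where "xs = sorted_list_of_set T"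
  have xs: "length xs = 5" "sorted_wrt (<) xs" "set xs = T" using T by (simp_all add: xs_def)
  have m: "xs ! i \<in> B" if "i < 5" for i using xs T that nth_mem by fastforce
  have l: "xs ! i < xs ! Suc i" if "Suc i < 5" for i using sorted_wrt_nth_less[OF xs(2)] xs(1) that by simp
  have "xs ! 0 \<in> B" "xs ! 1 \<in> B" "xs ! 2 \<in> B" "xs ! 3 \<in> B" "xs ! 4 \<in> B"
    by (intro m; simp)+
  moreover have "xs ! 0 < xs ! 1" "xs ! 1 < xs ! 2" "xs ! 2 < xs ! 3" "xs ! 3 < xs ! 4"
    using l[of 0] l[of 1] l[of 2] l[of 3] by (simp_all add: numeral_eq_Suc)
  ultimately show ?thesis by blast
qed

context lifted
begin

lemma component_closure: "C \<in> components (- H) \<Longrightarrow> closure C - H \<subseteq> C"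
proof -
  assume C: "C \<in> components (- H)"
  then have "closedin (top_of_set (- H)) C" by (rule closedin_component)
  then obtain K where K: "closed K" "C = - H \<inter> K" by (auto simp: closedin_closed)
  then have "closure C \<subseteq> K" by (simp add: closure_minimal)
  then show ?thesis using K(2) by blast
qed

text \<open>Open pieces of an edge of a branch are open in the whole space, provided they avoid the line.\<close>

lemma arc_piece_open:
  assumes C: "C \<in> components (- H)" "x \<in> C" "r x \<in> {0..1}"
    and V: "finite V" "finite (components (closure C - V))" and A: "A \<in> components (closure C - V)"
    and f: "homeomorphism {0<..<1::real} A f g"
    and t: "0 < t1" "t3 < 1" and n: "f ` {t1..t3} \<inter> H = {}"
  shows "open (f ` {t1<..<t3})"
proof -
  let ?G = "closure C"
  have "openin (top_of_set (?G - V)) A"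
  proof -
    have "closedin (top_of_set (?G - V)) (\<Union>(components (?G - V) - {A}))"
      using V(2) by (intro closedin_Union) (auto intro: closedin_component)
    moreover have "A = (?G - V) - \<Union>(components (?G - V) - {A})"
    proof
      show "A \<subseteq> (?G - V) - \<Union>(components (?G - V) - {A})"
        using components_nonoverlap[OF A] in_components_subset[OF A] by blast
      show "(?G - V) - \<Union>(components (?G - V) - {A}) \<subseteq> A"
        using Union_components[of "?G - V"] by blast
    qed
    ultimately show ?thesis by (metis openin_diff openin_subtopology_self)
  qed
  then obtain O1 where O1: "open O1" "A = (?G - V) \<inter> O1" by (auto simp: openin_open)
  have "openin (top_of_set {0<..<1}) {t1<..<t3}" 
    unfolding openin_open by (rule exI[of _ "{t1<..<t3}"]) (use t in auto)
  then have "openin (top_of_set A) (f ` {t1<..<t3})" using homeomorphism_imp_open_map[OF f] by blast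
  then obtain O2 where O2: "open O2" "f ` {t1<..<t3} = A \<inter> O2" by (auto simp: openin_open)
  have "f ` {t1<..<t3} \<subseteq> f ` {t1..t3}" by (intro image_mono) auto
  then have "f ` {t1<..<t3} \<inter> H = {}" using n by blast
  then have nH: "z \<notin> H" if "z \<in> f ` {t1<..<t3}" for z using that by blast
  have "f ` {t1<..<t3} = C \<inter> (O1 - V) \<inter> O2"
  proof (rule set_eqI, rule iffI)
    fix z assume z: "z \<in> f ` {t1<..<t3}"
    then have "z \<in> (?G - V) \<inter> O1 \<inter> O2" using O1(2) O2(2) by metis
    moreover have "z \<in> C" using component_closure[OF C(1)] nH[OF z] calculation by blast
    ultimately show "z \<in> C \<inter> (O1 - V) \<inter> O2" by simp
  next
    fix z assume z: "z \<in> C \<inter> (O1 - V) \<inter> O2"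
    then have "z \<in> ?G" using closure_subset by auto
    then show "z \<in> f ` {t1<..<t3}" using z unfolding O2(2) O1(2) by simp
  qed
  moreover have "open (C \<inter> (O1 - V) \<inter> O2)"
    using component_open[OF C] O1(1) O2(1) V(1) by (intro open_Int open_Diff finite_imp_closed)
  ultimately show ?thesis by simp
qed

end

context lifted_map
begin

definition line_images :: "'a set" where "line_images = (\<Union>n. (F ^^ n) ` H)"

lemma TR_line_images: "TR h F = closure line_images" by (simp add: TR_def line_images_def)

text \<open>The image is connected and unbounded in both directions, so it contains all cut points.\<close>

lemma H_iter: "H \<subseteq> (F ^^ n) ` H"
proof
  fix y assume "y \<in> H"
  then obtain t where t: "y = h t" by blast
  let ?c = "speed * real n + 1"
  have c: "connected ((F ^^ n) ` H)" by (intro connected_continuous_image cont_Fn cont_h) simp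
  have "r ((F ^^ n) (h (t - ?c))) \<le> t - 1"
    using disp_bound[of n "h (t - ?c)"] by (simp add: disp_def)
  moreover have "r ((F ^^ n) (h (t + ?c))) \<ge> t + 1"
    using disp_bound[of n "h (t + ?c)"] by (simp add: disp_def)
  ultimately have "h t \<in> (F ^^ n) ` H"
    by (intro separation[OF c, where a = "(F ^^ n) (h (t - ?c))" and b = "(F ^^ n) (h (t + ?c))"]) auto
  then show "y \<in> (F ^^ n) ` H" using t by simp
qed

lemma line_images_mono: "m \<le> n \<Longrightarrow> (F ^^ m) ` H \<subseteq> (F ^^ n) ` H"
proof -
  assume "m \<le> n"
  then obtain k where k: "n = m + k" using le_Suc_ex by blast
  have "(F ^^ m) ` H \<subseteq> (F ^^ m) ` (F ^^ k) ` H" using H_iter by (rule image_mono)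
  then show ?thesis by (simp add: k funpow_add image_comp)
qed

lemma H_line_images: "H \<subseteq> line_images"
  unfolding line_images_def by (rule order_trans[OF H_iter[of 0]]) (rule UN_upper, simp)

lemma line_images_TR: "line_images \<subseteq> TR h F" unfolding TR_line_images by (rule closure_subset)

lemma closed_TR: "closed (TR h F)" by (simp add: TR_line_images)

lemma Fn_line_images: "x \<in> line_images \<Longrightarrow> (F ^^ n) x \<in> line_images"
proof -
  assume "x \<in> line_images"
  then obtain k t where "x = (F ^^ k) (h t)" unfolding line_images_def by blast
  then have "(F ^^ n) x = (F ^^ (n + k)) (h t)" by (simp add: funpow_add)
  then show ?thesis unfolding line_images_def by blast
qed

lemma line_images_F: "line_images \<subseteq> F ` line_images"
proof
  fix x assume "x \<in> line_images"
  then obtain n where "x \<in> (F ^^ n) ` H" unfolding line_images_def by blast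
  then have "x \<in> (F ^^ Suc n) ` H" using line_images_mono[of n "Suc n"] by auto
  then obtain t where "x = F ((F ^^ n) (h t))" by auto
  then show "x \<in> F ` line_images" unfolding line_images_def by blast
qed

lemma line_images_sh: "sh m x \<in> line_images \<longleftrightarrow> x \<in> line_images"
proof -
  have 1: "sh m x \<in> line_images" if x: "x \<in> line_images" for m x
  proof -
    obtain n t where "x = (F ^^ n) (h t)" using x unfolding line_images_def by blast
    then have "sh m x = (F ^^ n) (h (t + of_int m))" by (simp add: Fn_sh[symmetric] sh_h)
    then show ?thesis unfolding line_images_def by blast
  qed
  from 1[of x m] 1[of "sh m x" "- m"] show ?thesis by auto
qed

lemma connected_line_images: "connected line_images"
  unfolding line_images_def
proof (rule connected_Union)
  show "connected S" if "S \<in> range (\<lambda>n. (F ^^ n) ` H)" for S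
    using that by (auto intro!: connected_continuous_image cont_Fn cont_h)
  have "h 0 \<in> (F ^^ n) ` H" for n using H_iter[of n] by blast
  then show "\<Inter> (range (\<lambda>n. (F ^^ n) ` H)) \<noteq> {}" by blast
qed

lemma TR_sh: "sh m x \<in> TR h F \<longleftrightarrow> x \<in> TR h F"
proof -
  have 1: "sh m x \<in> TR h F" if x: "x \<in> TR h F" for m x
  proof -
    have "sh m ` closure line_images \<subseteq> closure line_images"
      by (rule image_closure_subset[OF cont_sh]) (use line_images_sh closure_subset in auto)
    then show ?thesis using x unfolding TR_line_images by blast
  qed
  from 1[of x m] 1[of "sh m x" "- m"] show ?thesis by auto
qed

lemma Fn_TR: "x \<in> TR h F \<Longrightarrow> (F ^^ n) x \<in> TR h F"
proof -
  have "(F ^^ n) ` closure line_images \<subseteq> closure line_images"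
    by (rule image_closure_subset[OF cont_Fn]) (use Fn_line_images closure_subset in auto)
  then show "x \<in> TR h F \<Longrightarrow> (F ^^ n) x \<in> TR h F" unfolding TR_line_images by blast
qed

text \<open>Bounded speed makes the image of a closed set locally the image of a compact set.\<close>

lemma closed_image_Fn:
  assumes A: "closed A"
  shows "closed ((F ^^ n) ` A)"
proof -
  have "open (- (F ^^ n) ` A)"
  proof (rule open_subopen[THEN iffD2], rule ballI)
    fix z assume z: "z \<in> - (F ^^ n) ` A"
    let ?c = "speed * real n + 1"
    let ?K = "{x. r x \<in> {r z - ?c..r z + ?c}} \<inter> A"
    have "compact ((F ^^ n) ` ?K)"
      using A by (intro compact_continuous_image cont_Fn compact_Int_closed compact_band)
    then have "open (- (F ^^ n) ` ?K \<inter> r -` {r z - 1<..<r z + 1})"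
      by (intro open_Int open_Compl compact_imp_closed open_vimage cont_r) auto
    moreover have "z \<in> - (F ^^ n) ` ?K \<inter> r -` {r z - 1<..<r z + 1}" using z by auto
    moreover have "- (F ^^ n) ` ?K \<inter> r -` {r z - 1<..<r z + 1} \<subseteq> - (F ^^ n) ` A"
    proof
      fix w assume w: "w \<in> - (F ^^ n) ` ?K \<inter> r -` {r z - 1<..<r z + 1}"
      have "x \<in> ?K" if "x \<in> A" "w = (F ^^ n) x" for x
        using w that disp_bound[of n x] by (simp add: disp_def abs_le_iff)
      then show "w \<in> - (F ^^ n) ` A" using w by blast
    qed
    ultimately show "\<exists>T. open T \<and> z \<in> T \<and> T \<subseteq> - (F ^^ n) ` A" by blast
  qed
  then show ?thesis by (simp add: closed_def)
qed

lemma TR_F: "TR h F \<subseteq> F ` TR h F"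
proof -
  have "closed (F ` TR h F)" using closed_image_Fn[OF closed_TR, of 1] by simp
  moreover have "line_images \<subseteq> F ` TR h F" by (rule order_trans[OF line_images_F image_mono[OF line_images_TR]])
  ultimately show ?thesis unfolding TR_line_images by (simp add: closure_minimal)
qed

text \<open>The points of \<open>T_R\<close> whose orbits are not tails of orbits of the line.\<close>

definition ends :: "'a set" where "ends = TR h F - line_images"

text \<open>The closed set \<open>F ` TR h F\<close> contains \<open>line_images\<close>, hence \<open>TR h F\<close>; and a preimage of a
  point outside \<open>line_images\<close> is outside as well.\<close>

lemma ends_pre: "z \<in> ends \<Longrightarrow> \<exists>p\<in>ends. F p = z"
proof -
  assume z: "z \<in> ends"
  then obtain p where p: "p \<in> TR h F" "z = F p" using TR_F unfolding ends_def by blast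
  have "p \<notin> line_images" using Fn_line_images[of p 1] p(2) z by (auto simp: ends_def)
  then show ?thesis using p by (auto simp: ends_def)
qed

lemma ends_sh: "sh m x \<in> ends \<longleftrightarrow> x \<in> ends"
  by (simp add: ends_def TR_sh line_images_sh)

text \<open>If three points of an edge are ends and the piece of edge between the outer ones avoids the line,
  then this piece meets the connected set \<open>line_images\<close> in a relatively open and closed subset, and the
  line lies outside. So it misses \<open>line_images\<close>, although its middle point is adherent to it.\<close>

lemma finite_ends_arc:
  assumes C: "C \<in> components (- H)" "x \<in> C" "r x \<in> {0..1}"
    and V: "finite V" "finite (components (closure C - V))" and A: "A \<in> components (closure C - V)"
    and f: "homeomorphism {0<..<1::real} A f g"
  shows "finite (ends \<inter> A)"
proof -
  define B where "B = {t \<in> {0<..<1}. f t \<in> ends}"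
  have fA: "f ` {0<..<1} = A" and inj: "\<And>s t. s \<in> {0<..<1} \<Longrightarrow> t \<in> {0<..<1} \<Longrightarrow> f s = f t \<Longrightarrow> s = t"
    and cf: "continuous_on {0<..<1} f"
    using f unfolding homeomorphism_def by (metis, metis, metis)
  have AC: "A \<subseteq> closure C" using in_components_subset[OF A] by blast
  have no3: "f ` {t1..t3} \<inter> H \<noteq> {}" if t: "t1 \<in> B" "t2 \<in> B" "t3 \<in> B" "t1 < t2" "t2 < t3" for t1 t2 t3
  proof
    assume n: "f ` {t1..t3} \<inter> H = {}"
    have sub: "{t1..t3} \<subseteq> {0<..<1}" using t unfolding B_def by auto
    have P: "open (f ` {t1<..<t3})"
      by (rule arc_piece_open[OF C V A f _ _ n]) (use t in \<open>auto simp: B_def\<close>)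
    have "compact (f ` {t1..t3})" by (intro compact_continuous_image continuous_on_subset[OF cf sub]) simp
    then have W: "open (- f ` {t1..t3})" by (simp add: compact_imp_closed open_Compl)
    have "line_images \<subseteq> f ` {t1<..<t3} \<union> - f ` {t1..t3}"
    proof
      fix q assume q: "q \<in> line_images"
      show "q \<in> f ` {t1<..<t3} \<union> - f ` {t1..t3}"
      proof (cases "q \<in> f ` {t1..t3}")
        case True
        then obtain s where s: "s \<in> {t1..t3}" "q = f s" by blast
        have "s \<noteq> t1" "s \<noteq> t3" using t(1,3) q s(2) unfolding B_def ends_def by auto
        then show ?thesis using s by auto
      qed simp
    qed
    moreover have "f ` {t1<..<t3} \<inter> - f ` {t1..t3} \<inter> line_images = {}"
    proof -
      have "f ` {t1<..<t3} \<subseteq> f ` {t1..t3}" by (intro image_mono) auto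
      then show ?thesis by blast
    qed
    moreover have "- f ` {t1..t3} \<inter> line_images \<noteq> {}"
    proof -
      have "h 0 \<in> - f ` {t1..t3}" using n by blast
      then show ?thesis using H_line_images by blast
    qed
    ultimately have "f ` {t1<..<t3} \<inter> line_images = {}" using connectedD[OF connected_line_images P W] by blast
    moreover have "f t2 \<in> f ` {t1<..<t3}" using t by auto
    moreover have "f t2 \<in> closure line_images" using t(2) unfolding B_def ends_def TR_line_images by blast
    ultimately show False using P by (metis disjoint_iff open_Int_closure_eq_empty)
  qed
  have "finite B"
  proof (rule ccontr)
    assume "infinite B"
    \<comment> \<open>Two consecutive triples: the edge meets the line at most once, and \<open>f t3\<close> is not on the line.\<close>
    then obtain t1 t2 t3 t4 t5 where t: "t1 \<in> B" "t2 \<in> B" "t3 \<in> B" "t4 \<in> B" "t5 \<in> B"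
      "t1 < t2" "t2 < t3" "t3 < t4" "t4 < t5" using five_points by meson
    have sub: "{t1..t5} \<subseteq> {0<..<1}" using t unfolding B_def by auto
    obtain s where s: "s \<in> {t1..t3}" "f s \<in> H" using no3[of t1 t2 t3] t by blast
    obtain s' where s': "s' \<in> {t3..t5}" "f s' \<in> H" using no3[of t3 t4 t5] t by blast
    have "s \<in> {t1..t5}" "s' \<in> {t1..t5}" using s(1) s'(1) t by auto
    then have s01: "s \<in> {0<..<1}" "s' \<in> {0<..<1}" using sub by blast+
    then have "f s \<in> closure C" "f s' \<in> closure C" using fA AC by blast+
    then have "f s \<in> {h (r x)}" "f s' \<in> {h (r x)}"
      unfolding foot[OF C(1,2), symmetric] using s(2) s'(2) by blast+
    then have "f s = f s'" by simp
    then have "s = s'" using inj s01 by blast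
    then have "s = t3" using s s' by auto
    then have "f t3 \<in> line_images" using s(2) H_line_images by blast
    then show False using t(3) unfolding B_def ends_def by blast
  qed
  moreover have "ends \<inter> A \<subseteq> f ` B" using fA unfolding B_def by blast
  ultimately show ?thesis using finite_surj by blast
qed

lemma finite_ends: "finite (ends \<inter> {x. r x \<in> {0..1}})"
proof -
  let ?N = "{C \<in> components (- H). closure C \<inter> h ` {0..1} \<noteq> {}}"
  have "finite (ends \<inter> C)" if "C \<in> ?N" for C
  proof -
    have C: "C \<in> components (- H)" "closure C \<inter> h ` {0..1} \<noteq> {}" using that by auto
    obtain x where x: "x \<in> C" using in_components_nonempty[OF C(1)] by blast
    obtain y where y: "y \<in> closure C" "y \<in> h ` {0..1}" using C(2) by blast
    then have "y \<in> closure C \<inter> H" by blast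
    then have "y = h (r x)" unfolding foot[OF C(1) x] by simp
    moreover obtain u where "y = h u" "u \<in> {0..1}" using y(2) by blast
    ultimately have rx: "r x \<in> {0..1}" by (metis r_h)
    have "finite_graph (closure C)" using lg C(1) by (simp add: lifted_graph_def)
    then obtain V where V: "finite V" "finite (components (closure C - V))"
      "\<forall>A\<in>components (closure C - V). A homeomorphic {0<..<1::real}" unfolding finite_graph_def by blast
    have "finite (ends \<inter> A)" if A: "A \<in> components (closure C - V)" for A
    proof -
      have "{0<..<1::real} homeomorphic A" using V(3) A homeomorphic_sym by blast
      then obtain f g where "homeomorphism {0<..<1::real} A f g" unfolding homeomorphic_def by blast
      from finite_ends_arc[OF C(1) x rx V(1,2) A this] show ?thesis .
    qed
    then have "finite (V \<union> (\<Union>A\<in>components (closure C - V). ends \<inter> A))" using V by blast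
    moreover have "ends \<inter> C \<subseteq> V \<union> (\<Union>A\<in>components (closure C - V). ends \<inter> A)"
      using Union_components[of "closure C - V"] closure_subset[of C] by blast
    ultimately show ?thesis by (rule rev_finite_subset)
  qed
  then have "finite (\<Union>C\<in>?N. ends \<inter> C)" using finite_near by blast
  moreover have "ends \<inter> {x. r x \<in> {0..1}} \<subseteq> (\<Union>C\<in>?N. ends \<inter> C)"
  proof
    fix x assume x: "x \<in> ends \<inter> {x. r x \<in> {0..1}}"
    then have "x \<notin> H" using H_line_images unfolding ends_def by blast
    then obtain C where C: "C \<in> components (- H)" "x \<in> C" using component_of by blast
    then show "x \<in> (\<Union>C\<in>?N. ends \<inter> C)" using near[OF C] x by blast
  qed
  ultimately show ?thesis by (rule rev_finite_subset)
qed

lemma finite_ends_band: "finite (ends \<inter> {x. r x \<in> {c..d}})"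
proof -
  have "ends \<inter> {x. r x \<in> {c..d}} \<subseteq> (\<Union>k\<in>{\<lfloor>c\<rfloor>..\<lfloor>d\<rfloor>}. sh k ` (ends \<inter> {x. r x \<in> {0..1}}))"
  proof
    fix x assume x: "x \<in> ends \<inter> {x. r x \<in> {c..d}}"
    let ?y = "sh (- \<lfloor>r x\<rfloor>) x"
    have "?y \<in> ends" using x by (simp add: ends_sh)
    moreover have "r ?y \<in> {0..1}" by (simp; linarith)
    moreover have "x = sh \<lfloor>r x\<rfloor> ?y" by simp
    moreover have "\<lfloor>r x\<rfloor> \<in> {\<lfloor>c\<rfloor>..\<lfloor>d\<rfloor>}" using x by (simp add: floor_mono)
    ultimately show "x \<in> (\<Union>k\<in>{\<lfloor>c\<rfloor>..\<lfloor>d\<rfloor>}. sh k ` (ends \<inter> {x. r x \<in> {0..1}}))" by blast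
  qed
  then show ?thesis by (rule finite_subset) (intro finite_UN_I finite_imageI finite_ends, simp)
qed

definition unit_rep :: "'a \<Rightarrow> 'a" where "unit_rep x = sh (- \<lfloor>r x\<rfloor>) x"

lemma unit_rep_sh [simp]: "unit_rep (sh m x) = unit_rep x" by (simp add: unit_rep_def)

lemma unit_rep_eqE: "unit_rep x = y \<Longrightarrow> \<exists>m. x = sh m y"
  unfolding unit_rep_def by (intro exI[of _ "\<lfloor>r x\<rfloor>"]) auto

lemma r_unit_rep: "r (unit_rep x) \<in> {0..<1}" unfolding unit_rep_def by (simp; linarith)

lemma unit_rep_id: "r x \<in> {0..<1} \<Longrightarrow> unit_rep x = x"
proof -
  assume "r x \<in> {0..<1}"
  then have "\<lfloor>r x\<rfloor> = 0" by (simp add: floor_eq_iff)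
  then show ?thesis by (simp add: unit_rep_def)
qed

lemma unit_rep_Fn: "unit_rep ((F ^^ n) (unit_rep x)) = unit_rep ((F ^^ n) x)"
  unfolding unit_rep_def[of x] by (simp add: Fn_sh)

text \<open>Every end has an end among its preimages, so \<open>F\<close> maps the finite set of ends modulo translations
  onto itself. It is therefore a permutation of this set.\<close>

lemma ends_periodic:
  assumes y: "y \<in> ends" "r y \<in> {0..<1}"
  shows "\<exists>q\<ge>1. \<exists>m. (F ^^ q) y = sh m y \<and> (\<forall>p\<in>TR h F. (F ^^ q) p = sh m y \<longrightarrow> p = y)"
proof -
  define Z where "Z = ends \<inter> {x. r x \<in> {0..<1}}"
  define \<pi> where "\<pi> z = unit_rep (F z)" for z
  have finZ: "finite Z" by (rule finite_subset[OF _ finite_ends]) (auto simp: Z_def)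
  have unit_rep_ends: "unit_rep x \<in> Z" if "x \<in> ends" for x
    unfolding Z_def using r_unit_rep[of x] that by (simp add: unit_rep_def ends_sh)
  have sub: "Z \<subseteq> \<pi> ` Z"
  proof
    fix z assume z: "z \<in> Z"
    then obtain p where p: "p \<in> ends" "F p = z" using ends_pre unfolding Z_def by blast
    have "\<pi> (unit_rep p) = unit_rep z" unfolding \<pi>_def using unit_rep_Fn[of 1 p] p(2) by simp
    also have "\<dots> = z" using z unit_rep_id unfolding Z_def by blast
    finally show "z \<in> \<pi> ` Z" using unit_rep_ends[OF p(1)] by (metis imageI)
  qed
  have ZZ: "\<pi> ` Z = Z" using card_seteq[OF finite_imageI[OF finZ] sub card_image_le[OF finZ]] by simp
  then have inj: "inj_on \<pi> Z" using finZ by (simp add: eq_card_imp_inj_on)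
  have pin: "(\<pi> ^^ n) z = unit_rep ((F ^^ n) z)" if "z \<in> Z" for n z
  proof (induction n)
    case 0 then show ?case using that unit_rep_id unfolding Z_def by simp
  next
    case (Suc n)
    then show ?case unfolding \<pi>_def using unit_rep_Fn[of 1 "(F ^^ n) z"] by simp
  qed
  have pinZ: "(\<pi> ^^ n) z \<in> Z" if "z \<in> Z" for n z
  proof (induction n)
    case (Suc n)
    have "\<pi> ((\<pi> ^^ n) z) \<in> \<pi> ` Z" using Suc by (rule imageI)
    then show ?case unfolding ZZ by simp
  qed (use that in simp)
  have injn: "z = z'" if "z \<in> Z" "z' \<in> Z" "(\<pi> ^^ n) z = (\<pi> ^^ n) z'" for n z z'
    using that(3)
  proof (induction n)
    case (Suc n)
    have "\<pi> ((\<pi> ^^ n) z) = \<pi> ((\<pi> ^^ n) z')" using Suc.prems by simp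
    from inj_onD[OF inj this pinZ[OF that(1)] pinZ[OF that(2)]] show ?case by (rule Suc.IH)
  qed simp
  have yZ: "y \<in> Z" using y unfolding Z_def by simp
  have "\<not> inj_on (\<lambda>n. (\<pi> ^^ n) y) UNIV"
  proof
    assume i: "inj_on (\<lambda>n. (\<pi> ^^ n) y) UNIV"
    have "finite (range (\<lambda>n. (\<pi> ^^ n) y))"
      by (rule finite_subset[OF _ finZ]) (use pinZ[OF yZ] in auto)
    from finite_imageD[OF this i] show False by simp
  qed
  then obtain i j where "i \<noteq> j" "(\<pi> ^^ i) y = (\<pi> ^^ j) y" by (auto simp: inj_on_def)
  then obtain i j where ij: "i < j" "(\<pi> ^^ i) y = (\<pi> ^^ j) y" by (metis linorder_neqE_nat)
  define q where "q = j - i"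
  have q1: "q \<ge> 1" using ij(1) unfolding q_def by simp
  have "(\<pi> ^^ i) y = (\<pi> ^^ i) ((\<pi> ^^ q) y)"
  proof -
    have "j = i + q" using ij(1) unfolding q_def by simp
    then show ?thesis using ij(2) by (simp add: funpow_add)
  qed
  then have qy: "(\<pi> ^^ q) y = y" using injn[OF yZ pinZ[OF yZ]] by metis
  then have "unit_rep ((F ^^ q) y) = y" using pin[OF yZ] by simp
  then obtain m where m: "(F ^^ q) y = sh m y" using unit_rep_eqE by blast
  have "p = y" if p: "p \<in> TR h F" "(F ^^ q) p = sh m y" for p
  proof -
    have "p \<notin> line_images"
    proof
      assume "p \<in> line_images"
      then have "sh m y \<in> line_images" using Fn_line_images[of p q] p(2) by simp
      then show False using y(1) by (simp add: line_images_sh ends_def)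
    qed
    then have bp: "unit_rep p \<in> Z" using unit_rep_ends p(1) by (simp add: ends_def)
    have "(\<pi> ^^ q) (unit_rep p) = unit_rep ((F ^^ q) p)" using pin[OF bp] unit_rep_Fn by simp
    also have "\<dots> = y" using p(2) unit_rep_id[OF y(2)] by simp
    finally have "unit_rep p = y" using injn[OF bp yZ] qy by metis
    then obtain k where k: "p = sh k y" using unit_rep_eqE by blast
    have "sh (k + m) y = sh m y" using p(2) unfolding k Fn_sh m by simp
    then have "r y + of_int (k + m) = r y + of_int m" by (metis r_sh)
    then show ?thesis using k by simp
  qed
  then show ?thesis using q1 m by blast
qed

text \<open>For each \<open>l\<close> there is an orbit from the line to a point so close to \<open>y\<close> that its last \<open>l\<close> predecessors
  are all near \<open>y\<close>, because \<open>y\<close> is its own only preimage. The last point of this orbit outside the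
  neighbourhood \<open>V 1\<close> is then followed by more than \<open>l\<close> points inside. A limit of such points for
  growing \<open>l\<close> is not \<open>y\<close>, hence not an end, and its whole orbit stays near \<open>y\<close>.\<close>

lemma shadow:
  fixes G :: "'a \<Rightarrow> 'a"
  assumes cG: "\<And>A n. continuous_on A (G ^^ n)" and clG: "\<And>A. closed A \<Longrightarrow> closed (G ` A)"
    and GTR: "\<And>x. x \<in> TR h F \<Longrightarrow> G x \<in> TR h F"
    and y: "y \<in> ends" and uniq: "\<And>p. p \<in> TR h F \<Longrightarrow> G p = y \<Longrightarrow> p = y"
    and reach: "\<And>z. z \<in> line_images \<Longrightarrow> \<exists>n. \<exists>x\<in>H. z = (G ^^ n) x"
  shows "\<exists>p\<in>line_images. \<forall>i. \<bar>r ((G ^^ i) p) - r y\<bar> \<le> 1"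
proof -
  have yTR: "y \<in> TR h F" "y \<notin> line_images" "y \<notin> H" using y H_line_images unfolding ends_def by auto
  \<comment> \<open>The other ends close to \<open>y\<close>, which the neighbourhood has to avoid.\<close>
  define Bd where "Bd = ends \<inter> {x. r x \<in> {r y - 1..r y + 1}} - {y}"
  have finB: "finite Bd" unfolding Bd_def using finite_ends_band by simp
  have "\<exists>U. open U \<and> y \<in> U \<and> b \<notin> closure U" if "b \<in> Bd" for b
  proof -
    have "y \<noteq> b" using that unfolding Bd_def by blast
    then obtain U W where UW: "open U" "open W" "y \<in> U" "b \<in> W" "U \<inter> W = {}" using hausdorff by metis
    then have "b \<notin> closure U" using open_Int_closure_eq_empty[of W U] by blast
    then show ?thesis using UW by blast
  qed
  then obtain Ub where Ub: "\<And>b. b \<in> Bd \<Longrightarrow> open (Ub b) \<and> y \<in> Ub b \<and> b \<notin> closure (Ub b)" by metis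
  define U where "U = (\<Inter>b\<in>Bd. Ub b) \<inter> (- H \<inter> r -` {r y - 1<..<r y + 1})"
  have oU: "open U" unfolding U_def using finB Ub closed_H
    by (intro open_Int open_INT open_Compl open_vimage cont_r) auto
  have yU: "y \<in> U" unfolding U_def using Ub yTR(3) by auto
  have UH: "U \<inter> H = {}" unfolding U_def by blast
  have Ur: "closure U \<subseteq> {x. r x \<in> {r y - 1..r y + 1}}"
  proof (rule closure_minimal)
    show "closed {x. r x \<in> {r y - 1..r y + 1}}" by (rule compact_imp_closed[OF compact_band])
  qed (auto simp: U_def)
  then have compU: "compact (closure U)" by (rule compact_closed_subset[OF compact_band closed_closure])
  have Uends: "x = y" if x: "x \<in> closure U" "x \<in> ends" for x
  proof (rule ccontr)
    assume "x \<noteq> y"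
    then have b: "x \<in> Bd" using x Ur unfolding Bd_def by blast
    have "U \<subseteq> Ub x" using b unfolding U_def by blast
    then have "closure U \<subseteq> closure (Ub x)" by (rule closure_mono)
    then show False using Ub[OF b] x(1) by blast
  qed
  \<comment> \<open>A neighbourhood of \<open>y\<close> whose points have their preimages in \<open>V\<close>.\<close>
  define nb where "nb V = V - G ` (TR h F - V)" for V
  have nb: "open (nb V)" "y \<in> nb V" "nb V \<subseteq> V" "\<And>x. x \<in> TR h F \<Longrightarrow> G x \<in> nb V \<Longrightarrow> x \<in> V"
    if V: "open V" "y \<in> V" for V
  proof -
    have "closed (G ` (TR h F - V))" using V(1) closed_TR by (intro clG closed_Diff)
    then show "open (nb V)" unfolding nb_def using V(1) by (rule open_Diff[rotated])
    have "y \<noteq> G p" if "p \<in> TR h F - V" for p using uniq[of p] that V(2) by auto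
    then show "y \<in> nb V" unfolding nb_def using V(2) by blast
    show "nb V \<subseteq> V" unfolding nb_def by blast
    show "x \<in> V" if "x \<in> TR h F" "G x \<in> nb V" for x using that unfolding nb_def by blast
  qed
  define V where "V i = (nb ^^ i) U" for i
  have V: "open (V i) \<and> y \<in> V i" for i
  proof (induction i)
    case 0 then show ?case using oU yU by (simp add: V_def)
  next
    case (Suc i) then show ?case using nb(1,2)[of "V i"] by (simp add: V_def)
  qed
  have VS: "V (Suc i) = nb (V i)" for i by (simp add: V_def)
  have Vdec: "V (Suc i) \<subseteq> V i" for i using nb(3)[of "V i"] V[of i] by (simp add: VS)
  have VU: "V i \<subseteq> U" for i
  proof (induction i)
    case 0 then show ?case by (simp add: V_def)
  next
    case (Suc i) from order_trans[OF Vdec this] show ?case .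
  qed
  have Vstep: "x \<in> V i" if "x \<in> TR h F" "G x \<in> V (Suc i)" for x i
    using nb(4)[of "V i" x] V[of i] that by (simp add: VS)
  have "\<exists>p\<in>closure U. \<forall>l. p \<in> (TR h F - V 1) \<inter> (\<Inter>i\<in>{1..l}. (G ^^ i) -` closure U)"
  proof (rule compact_nested[OF compU])
    fix l
    show "closed ((TR h F - V 1) \<inter> (\<Inter>i\<in>{1..l}. (G ^^ i) -` closure U))"
      using closed_TR V by (intro closed_Int closed_Diff closed_INT ballI closed_vimage cG) auto
    show "(TR h F - V 1) \<inter> (\<Inter>i\<in>{1..Suc l}. (G ^^ i) -` closure U) \<subseteq> (TR h F - V 1) \<inter> (\<Inter>i\<in>{1..l}. (G ^^ i) -` closure U)"
      by auto
    have "y \<in> closure line_images" using yTR(1) by (simp add: TR_line_images)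
    then have "V (Suc l) \<inter> line_images \<noteq> {}" using V[of "Suc l"] open_Int_closure_eq_empty[of "V (Suc l)" line_images] by blast
    then obtain z where z: "z \<in> V (Suc l)" "z \<in> line_images" by blast
    obtain n x where x: "x \<in> H" "z = (G ^^ n) x" using reach[OF z(2)] by blast
    define X where "X i = (G ^^ i) x" for i
    have XTR: "X i \<in> TR h F" for i
    proof (induction i)
      case 0 then show ?case using x(1) H_line_images line_images_TR by (auto simp: X_def)
    next
      case (Suc i) then show ?case using GTR by (simp add: X_def)
    qed
    have XS: "X (Suc i) = G (X i)" for i by (simp add: X_def)
    have hist: "X (n - k) \<in> V (Suc l - k)" if "k \<le> l" "k \<le> n" for k using that
    proof (induction k)
      case 0 then show ?case using z x by (simp add: X_def)
    next
      case (Suc k)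
      then have e: "Suc (n - Suc k) = n - k" "Suc (Suc l - Suc k) = Suc l - k" by auto
      have "X (n - k) \<in> V (Suc l - k)" using Suc by simp
      then have "G (X (n - Suc k)) \<in> V (Suc (Suc l - Suc k))" using XS[of "n - Suc k"] unfolding e by simp
      from Vstep[OF XTR this] show ?case .
    qed
    have X0: "X 0 \<notin> V i" for i using x(1) VU[of i] UH by (auto simp: X_def)
    have V1: "V (Suc k) \<subseteq> V 1" for k
    proof (induction k)
      case (Suc k) from order_trans[OF Vdec this] show ?case .
    qed simp
    have ln: "l < n"
    proof (rule ccontr)
      assume "\<not> l < n"
      then have "X (n - n) \<in> V (Suc l - n)" using hist[of n] by simp
      then show False using X0 by simp
    qed
    have late: "X (n - k) \<in> V 1" if "k \<le> l" for k
    proof -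
      have "X (n - k) \<in> V (Suc (l - k))" using hist[of k] that ln by (simp add: Suc_diff_le)
      then show ?thesis using V1 by blast
    qed
    define i where "i = Max {i. i < n \<and> X i \<notin> V 1}"
    have fin: "finite {i. i < n \<and> X i \<notin> V 1}" by simp
    have "0 \<in> {i. i < n \<and> X i \<notin> V 1}" using X0 ln by simp
    then have "i \<in> {i. i < n \<and> X i \<notin> V 1}" unfolding i_def using Max_in[OF fin] by blast
    then have i: "i < n" "X i \<notin> V 1" by auto
    have after: "X j \<in> V 1" if "i < j" "j \<le> n" for j
    proof (cases "j = n")
      case True then show ?thesis using late[of 0] by simp
    next
      case False
      show ?thesis
      proof (rule ccontr)
        assume "X j \<notin> V 1"
        then have "j \<le> i" unfolding i_def using that False by (intro Max_ge[OF fin]) simp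
        then show False using that(1) by simp
      qed
    qed
    have il: "i + l < n"
    proof (rule ccontr)
      assume "\<not> i + l < n"
      then have "n - i \<le> l" by simp
      then have "X (n - (n - i)) \<in> V 1" by (rule late)
      then show False using i by simp
    qed
    have "X i \<in> closure U"
    proof -
      have "G (X i) \<in> V (Suc 0)" using after[of "Suc i"] i(1) XS by simp
      from Vstep[OF XTR this] have "X i \<in> V 0" .
      then show ?thesis using closure_subset by (auto simp: V_def)
    qed
    moreover have "(G ^^ j) (X i) \<in> closure U" if "j \<in> {1..l}" for j
    proof -
      have "(G ^^ j) (X i) = X (j + i)" by (simp add: X_def funpow_add)
      moreover have "X (j + i) \<in> V 1" using after[of "j + i"] that il by simp
      ultimately show ?thesis using VU[of 1] closure_subset by auto
    qed
    ultimately show "closure U \<inter> ((TR h F - V 1) \<inter> (\<Inter>i\<in>{1..l}. (G ^^ i) -` closure U)) \<noteq> {}"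
      using XTR i(2) by blast
  qed
  then obtain p where p: "p \<in> closure U" "p \<in> TR h F" "p \<notin> V 1"
    "\<And>l. p \<in> (\<Inter>i\<in>{1..l}. (G ^^ i) -` closure U)" by blast
  have Gp: "(G ^^ i) p \<in> closure U" for i
  proof (cases "i = 0")
    case False then show ?thesis using p(4)[of i] by auto
  qed (use p(1) in simp)
  have "p \<noteq> y" using p(3) V by blast
  then have "p \<in> line_images" using Uends[OF p(1)] p(2) by (auto simp: ends_def)
  moreover have "\<bar>r ((G ^^ i) p) - r y\<bar> \<le> 1" for i
    using Gp[of i] Ur by (auto simp: abs_le_iff)
  ultimately show ?thesis by blast
qed

lemma TR_rates:
  assumes y: "y \<in> TR h F"
  shows "\<exists>t. upper_rot h F y = upper_rot h F (h t) \<and> lower_rot h F y = lower_rot h F (h t)"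
proof -
  have swept: "\<exists>t. upper_rot h F x = upper_rot h F (h t) \<and> lower_rot h F x = lower_rot h F (h t)" if x: "x \<in> line_images" for x
  proof -
    obtain n t where "x = (F ^^ n) (h t)" using x unfolding line_images_def by blast
    then show ?thesis using rot_tail by blast
  qed
  show ?thesis
  proof (cases "y \<in> line_images")
    case False
    define z where "z = unit_rep y"
    have z: "z \<in> ends" "r z \<in> {0..<1}"
      using y False r_unit_rep unfolding z_def unit_rep_def by (auto simp: ends_def TR_sh line_images_sh)
    obtain q m where q: "q \<ge> 1" "(F ^^ q) z = sh m z" "\<And>p. p \<in> TR h F \<Longrightarrow> (F ^^ q) p = sh m z \<Longrightarrow> p = z"
      using ends_periodic[OF z] by blast
    define G where "G x = sh (- m) ((F ^^ q) x)" for x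
    have Gn: "(G ^^ n) x = sh (- (int n * m)) ((F ^^ (q * n)) x)" for n x
    proof (induction n)
      case (Suc n)
      have "(G ^^ Suc n) x = sh (- m) ((F ^^ q) (sh (- (int n * m)) ((F ^^ (q * n)) x)))"
        unfolding Suc[symmetric] G_def[symmetric] by simp
      also have "\<dots> = sh (- (int (Suc n) * m)) ((F ^^ (q + q * n)) x)"
        by (simp add: Fn_sh funpow_add algebra_simps)
      finally show ?case by simp
    qed simp
    have Gz: "G z = z" by (simp add: G_def q(2))
    have "\<exists>p\<in>line_images. \<forall>i. \<bar>r ((G ^^ i) p) - r z\<bar> \<le> 1"
    proof (rule shadow[OF _ _ _ z(1)])
      show "continuous_on A (G ^^ n)" for A n
      proof -
        have "continuous_on A (\<lambda>x. sh (- (int n * m)) ((F ^^ (q * n)) x))"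
          by (rule continuous_on_compose2[OF cont_sh cont_Fn]) auto
        then show ?thesis using Gn by (simp add: fun_eq_iff cong: continuous_on_cong)
      qed
      show "closed (G ` A)" if "closed A" for A
      proof -
        have "G ` A = sh (- m) ` (F ^^ q) ` A" by (auto simp: G_def)
        then show ?thesis using closed_sh closed_image_Fn that by metis
      qed
      show "G x \<in> TR h F" if "x \<in> TR h F" for x using Fn_TR[OF that] by (simp add: G_def TR_sh)
      show "p = z" if p: "p \<in> TR h F" "G p = z" for p
      proof -
        have "(F ^^ q) p = sh m (G p)" by (simp add: G_def)
        then show ?thesis using q(3) p by simp
      qed
      show "\<exists>n. \<exists>x\<in>H. w = (G ^^ n) x" if w: "w \<in> line_images" for w
      proof -
        obtain n where n: "w \<in> (F ^^ n) ` H" using w unfolding line_images_def by blast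
        have "n \<le> q * n" using q(1) by simp
        then obtain x where x: "x \<in> H" "w = (F ^^ (q * n)) x" using n line_images_mono by blast
        have "w = (G ^^ n) (sh (int n * m) x)" unfolding Gn Fn_sh by (simp add: x(2))
        then show ?thesis using x(1) sh_H by blast
      qed
    qed
    then obtain p where p: "p \<in> line_images" "\<And>i. \<bar>r ((G ^^ i) p) - r z\<bar> \<le> 1" by blast
    have "\<bar>disp n z - disp n p\<bar> \<le> 2 * (speed * real q) + 2" for n
    proof -
      define j i where "j = n mod q" and "i = n div q"
      have nij: "n = j + q * i" unfolding j_def i_def by simp
      have jq: "j \<le> q" unfolding j_def using q(1) by (simp add: less_imp_le)
      have Fx: "r ((F ^^ n) x) = disp j ((G ^^ i) x) + r ((G ^^ i) x) + of_int (int i * m)" for x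
      proof -
        have "(F ^^ (q * i)) x = sh (int i * m) ((G ^^ i) x)" unfolding Gn by simp
        then have "(F ^^ n) x = sh (int i * m) ((F ^^ j) ((G ^^ i) x))"
          unfolding nij by (simp add: funpow_add Fn_sh)
        then show ?thesis by (simp add: disp_def)
      qed
      have Giz: "(G ^^ i) z = z" for i by (induction i) (simp_all add: Gz)
      have b: "\<bar>disp j x\<bar> \<le> speed * real q" for x
      proof -
        have "speed * real j \<le> speed * real q" using jq speed(1) by (intro mult_left_mono) auto
        then show ?thesis using disp_bound[of j x] by linarith
      qed
      have "disp n z - disp n p = (disp j z - disp j ((G ^^ i) p)) + (r z - r ((G ^^ i) p)) + (r p - r z)"
        unfolding disp_def[of n] Fx Giz by simp
      moreover have "\<bar>r p - r z\<bar> \<le> 1" using p(2)[of 0] by simp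
      ultimately show ?thesis using b[of z] b[of "(G ^^ i) p"] p(2)[of i] by linarith
    qed
    from rot_cong[OF this] swept[OF p(1)] rot_sh[of "- \<lfloor>r y\<rfloor>" y] show ?thesis
      unfolding z_def unit_rep_def by metis
  qed (use swept in blast)
qed

section \<open>Rotation sets of the whole space\<close>

lemma plus_ints_iff: "z \<in> plus_ints \<tau> A \<longleftrightarrow> (\<exists>m. sh m z \<in> A)"
proof
  assume "z \<in> plus_ints \<tau> A"
  then obtain m x where mx: "x \<in> A" "z = sh m x" unfolding plus_ints_def by blast
  then have "sh (- m) z \<in> A" by simp
  then show "\<exists>m. sh m z \<in> A" by blast
next
  assume "\<exists>m. sh m z \<in> A"
  then obtain m where m: "sh m z \<in> A" by blast
  have "z = sh (- m) (sh m z)" by simp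
  then show "z \<in> plus_ints \<tau> A" unfolding plus_ints_def using m by blast
qed

lemma outside_TR: "z \<notin> TR h F \<Longrightarrow> \<exists>m. sh m z \<in> XF h F"
proof -
  assume z: "z \<notin> TR h F"
  obtain m where m: "r (sh m z) \<in> {0..<1}" using unit_translate by blast
  have "sh m z \<in> - TR h F" using z by (simp add: TR_sh)
  then have "sh m z \<in> closure (- TR h F)" by (rule subsetD[OF closure_subset])
  then have "sh m z \<in> XF h F" using m by (simp add: XF_def)
  then show ?thesis by (rule exI)
qed

lemma XF_r: "x \<in> XF h F \<Longrightarrow> r x \<in> {0..<1}" unfolding XF_def by blast

lemma XF_unique:
  assumes "x \<in> XF h F" "y \<in> XF h F" "sh m x = sh n y"
  shows "m = n" "x = y"
proof -
  have "r x + of_int m = r y + of_int n" using assms(3) by (metis r_sh)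
  moreover have "r x \<in> {0..<1}" "r y \<in> {0..<1}" using XF_r assms by blast+
  ultimately have "real_of_int m < of_int n + 1" "real_of_int n < of_int m + 1" by auto
  then show "m = n" by linarith
  then show "x = y" using assms(3) by simp
qed

text \<open>The half-open condition on \<open>r\<close> defines a closed set here since \<open>r\<close> takes only finitely many values in \<open>[0, 1]\<close> off the
  line.\<close>

lemma compact_XF: "compact (XF h F)"
proof -
  define R where "R = {t \<in> r ` (- H) \<inter> {0..1}. t < 1}"
  have finR: "finite R" by (rule finite_subset[OF _ finite_feet[of 0 1]]) (auto simp: R_def)
  \<comment> \<open>The greatest foot in \<open>[0, 1)\<close>; the number 0 only makes the set nonempty.\<close>
  define c where "c = Max (insert 0 R)"
  have c: "t \<le> c" if "t \<in> insert 0 R" for t unfolding c_def using finR that by (intro Max_ge) auto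
  have "c \<in> insert 0 R" unfolding c_def using finR by (intro Max_in) auto
  then have c1: "c < 1" unfolding R_def by auto
  have foot: "r x \<in> R" if x: "x \<in> XF h F" for x
  proof -
    obtain \<delta> where d: "\<delta> > 0" "\<forall>y. y \<notin> H \<longrightarrow> \<bar>r y - r x\<bar> < \<delta> \<longrightarrow> r y = r x" using isolated_foot by blast
    have o: "open (r -` {r x - \<delta><..<r x + \<delta>})" by (intro open_vimage cont_r) auto
    have "x \<in> r -` {r x - \<delta><..<r x + \<delta>} \<inter> closure (- TR h F)" using x d(1) unfolding XF_def by auto
    then have "r -` {r x - \<delta><..<r x + \<delta>} \<inter> - TR h F \<noteq> {}"
      using open_Int_closure_eq_empty[OF o, of "- TR h F"] by blast
    then obtain y where y: "y \<in> r -` {r x - \<delta><..<r x + \<delta>}" "y \<notin> TR h F" by blast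
    have yH: "y \<notin> H" using y(2) H_line_images line_images_TR by blast
    moreover have "\<bar>r y - r x\<bar> < \<delta>" using y(1) by auto
    ultimately have "r y = r x" using d(2) by blast
    then have "r x \<in> r ` (- H)" using yH by (metis ComplI imageI)
    then show ?thesis using XF_r[OF x] unfolding R_def by auto
  qed
  have "XF h F = closure (- TR h F) \<inter> {x. r x \<in> {0..c}}"
  proof
    show "XF h F \<subseteq> closure (- TR h F) \<inter> {x. r x \<in> {0..c}}"
    proof
      fix x assume x: "x \<in> XF h F"
      have "0 \<le> r x" "r x \<le> c" using XF_r[OF x] c[of "r x"] foot[OF x] by auto
      then show "x \<in> closure (- TR h F) \<inter> {x. r x \<in> {0..c}}" using x unfolding XF_def by auto
    qed
    show "closure (- TR h F) \<inter> {x. r x \<in> {0..c}} \<subseteq> XF h F" unfolding XF_def using c1 by auto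
  qed
  then show ?thesis using compact_Int_closed[OF compact_band closed_closure, of 0 c "- TR h F"]
    by (simp add: Int_commute)
qed

lemma has_rot_iff: "has_rot h F x \<rho> \<longleftrightarrow> upper_rot h F x = \<rho> \<and> lower_rot h F x = \<rho>"
  by (simp add: has_rot_def)

lemma Rot_line: "Rot h F H = ereal ` line_rates"
proof
  show "Rot h F H \<subseteq> ereal ` line_rates"
  proof
    fix \<rho> assume "\<rho> \<in> Rot h F H"
    then obtain t where "has_rot h F (h t) \<rho>" unfolding Rot_def by blast
    then show "\<rho> \<in> ereal ` line_rates" using line_extremes(1)[of t] unfolding has_rot_iff by blast
  qed
  show "ereal ` line_rates \<subseteq> Rot h F H"
  proof
    fix \<rho> assume "\<rho> \<in> ereal ` line_rates"
    then obtain \<alpha> where a: "\<alpha> \<in> line_rates" "\<rho> = ereal \<alpha>" by blast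
    obtain t where "(\<lambda>n. disp n (h t) / real n) \<longlonglongrightarrow> \<alpha>" using line_realise[OF a(1)] by blast
    then show "\<rho> \<in> Rot h F H" unfolding Rot_def a(2) using has_rot_of_tendsto by blast
  qed
qed

lemma Rot_TR: "Rot h F (TR h F) = Rot h F H"
proof
  show "Rot h F (TR h F) \<subseteq> Rot h F H"
  proof
    fix \<rho> assume "\<rho> \<in> Rot h F (TR h F)"
    then obtain y where y: "y \<in> TR h F" "has_rot h F y \<rho>" unfolding Rot_def by blast
    obtain t where "upper_rot h F y = upper_rot h F (h t)" "lower_rot h F y = lower_rot h F (h t)"
      using TR_rates[OF y(1)] by blast
    then have "has_rot h F (h t) \<rho>" using y(2) unfolding has_rot_iff by simp
    then show "\<rho> \<in> Rot h F H" unfolding Rot_def by blast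
  qed
  show "Rot h F H \<subseteq> Rot h F (TR h F)" unfolding Rot_def using H_line_images line_images_TR by blast
qed

lemma into_TR_rates:
  assumes "(F ^^ n) x \<in> TR h F"
  shows "upper_rot h F x \<in> ereal ` line_rates" "lower_rot h F x \<in> ereal ` line_rates"
proof -
  obtain t where t: "upper_rot h F ((F ^^ n) x) = upper_rot h F (h t)"
    "lower_rot h F ((F ^^ n) x) = lower_rot h F (h t)" using TR_rates[OF assms] by blast
  show "upper_rot h F x \<in> ereal ` line_rates"
    using line_extremes(1)[of t] t(1) unfolding rot_tail by auto
  show "lower_rot h F x \<in> ereal ` line_rates"
    using line_extremes(2)[of t] t(2) unfolding rot_tail by auto
qed

text \<open>The sets \<open>R m\<close> stand for the rotation intervals of the orbits that never enter \<open>T_R\<close>.\<close>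

lemma assembly:
  fixes R :: "nat \<Rightarrow> real set" and J :: "nat set"
  assumes J: "J \<subseteq> {1..N}"
    and R: "\<And>m. m \<in> J \<Longrightarrow> compact (R m) \<and> is_interval (R m) \<and> R m \<inter> \<int> \<noteq> {}"
    and up: "\<And>x. (\<And>n. (F ^^ n) x \<notin> TR h F) \<Longrightarrow> \<exists>m\<in>J. upper_rot h F x \<in> ereal ` R m"
    and low: "\<And>x. (\<And>n. (F ^^ n) x \<notin> TR h F) \<Longrightarrow> \<exists>m\<in>J. lower_rot h F x \<in> ereal ` R m"
    and real: "\<And>m \<alpha>. m \<in> J \<Longrightarrow> \<alpha> \<in> R m \<Longrightarrow> \<exists>x. has_rot h F x (ereal \<alpha>)"
    and rat: "\<And>m q. m \<in> J \<Longrightarrow> q \<in> R m \<inter> \<rat> \<Longrightarrow>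
      \<exists>x\<in>Xinf h \<tau> F. periodic_mod1 \<tau> F x \<and> has_rot h F x (ereal q)"
  shows "\<exists>(k::nat) (I :: nat \<Rightarrow> real set).
    (\<forall>i\<le>k. compact (I i) \<and> is_interval (I i) \<and> I i \<noteq> {}) \<and>
    ereal ` I 0 = Rot h F (range h) \<and>
    Rot h F (range h) = Rot h F (TR h F) \<and>
    Rot h F UNIV = Rot_upper h F UNIV \<and>
    Rot_upper h F UNIV = Rot_lower h F UNIV \<and>
    Rot_lower h F UNIV = ereal ` (\<Union>i\<le>k. I i) \<and>
    (\<forall>i\<in>{1..k}. \<forall>q\<in>I i \<inter> \<rat>.
       \<exists>x\<in>Xinf h \<tau> F. periodic_mod1 \<tau> F x \<and> has_rot h F x (ereal q)) \<and>
    (\<forall>i\<in>{1..k}. I i \<inter> \<int> \<noteq> {}) \<and>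
    k \<le> N"
proof -
  have finJ: "finite J" using J finite_subset by blast
  define k where "k = card J"
  have kN: "k \<le> N" using card_mono[OF _ J] unfolding k_def by simp
  obtain f where f: "bij_betw f {1..k} J" using ex_bij_betw_nat_finite_1[OF finJ] unfolding k_def by blast
  have fJ: "f i \<in> J" if "i \<in> {1..k}" for i using f that by (rule bij_betwE[rule_format])
  define I where "I i = (if i = 0 then line_rates else R (f i))" for i
  define W where "W = (\<Union>i\<le>k. I i)"
  have W: "W = line_rates \<union> (\<Union>m\<in>J. R m)"
  proof
    show "W \<subseteq> line_rates \<union> (\<Union>m\<in>J. R m)"
    proof
      fix x assume "x \<in> W"
      then obtain i where i: "i \<le> k" "x \<in> I i" unfolding W_def by blast
      show "x \<in> line_rates \<union> (\<Union>m\<in>J. R m)"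
      proof (cases "i = 0")
        case False
        then have "f i \<in> J" "x \<in> R (f i)" using fJ[of i] i by (auto simp: I_def)
        then show ?thesis by blast
      qed (use i in \<open>simp add: I_def\<close>)
    qed
    show "line_rates \<union> (\<Union>m\<in>J. R m) \<subseteq> W"
    proof
      fix x assume x: "x \<in> line_rates \<union> (\<Union>m\<in>J. R m)"
      show "x \<in> W"
      proof (cases "x \<in> line_rates")
        case True
        then have "x \<in> I 0" by (simp add: I_def)
        then show ?thesis unfolding W_def by blast
      next
        case False
        then obtain m where m: "m \<in> J" "x \<in> R m" using x by blast
        then obtain i where i: "i \<in> {1..k}" "f i = m" using bij_betw_imp_surj_on[OF f] by blast
        then have "x \<in> I i" using m by (simp add: I_def)
        then show ?thesis unfolding W_def using i(1) by auto
      qed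
    qed
  qed
  have mem: "\<rho> \<in> ereal ` W" if "\<rho> \<in> ereal ` line_rates \<or> (\<exists>m\<in>J. \<rho> \<in> ereal ` R m)" for \<rho>
    using that unfolding W by blast
  have upW: "upper_rot h F x \<in> ereal ` W" for x
  proof (cases "\<exists>n. (F ^^ n) x \<in> TR h F")
    case True then show ?thesis using into_TR_rates(1) mem by metis
  next
    case False then show ?thesis using up mem by metis
  qed
  have lowW: "lower_rot h F x \<in> ereal ` W" for x
  proof (cases "\<exists>n. (F ^^ n) x \<in> TR h F")
    case True then show ?thesis using into_TR_rates(2) mem by metis
  next
    case False then show ?thesis using low mem by metis
  qed
  have ex: "\<exists>x. has_rot h F x (ereal \<alpha>)" if a: "\<alpha> \<in> W" for \<alpha>
  proof (cases "\<alpha> \<in> line_rates")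
    case True
    then show ?thesis using line_realise has_rot_of_tendsto by blast
  next
    case False
    then obtain m where "m \<in> J" "\<alpha> \<in> R m" using a unfolding W by blast
    then show ?thesis using real by blast
  qed
  have R1: "Rot h F UNIV = ereal ` W"
  proof
    show "Rot h F UNIV \<subseteq> ereal ` W"
    proof
      fix \<rho> assume "\<rho> \<in> Rot h F UNIV"
      then obtain x where "upper_rot h F x = \<rho>" unfolding Rot_def has_rot_iff by blast
      then show "\<rho> \<in> ereal ` W" using upW[of x] by simp
    qed
    show "ereal ` W \<subseteq> Rot h F UNIV" using ex unfolding Rot_def by blast
  qed
  have all: "range u = ereal ` W"
    if u: "\<And>x. u x \<in> ereal ` W" "\<And>x \<rho>. has_rot h F x \<rho> \<Longrightarrow> u x = \<rho>" for u :: "'a \<Rightarrow> ereal"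
  proof
    show "range u \<subseteq> ereal ` W" using u(1) by blast
    show "ereal ` W \<subseteq> range u"
    proof
      fix \<rho> assume "\<rho> \<in> ereal ` W"
      then obtain x where "has_rot h F x \<rho>" using ex by blast
      from u(2)[OF this] show "\<rho> \<in> range u" by blast
    qed
  qed
  have R2: "Rot_upper h F UNIV = ereal ` W"
    unfolding Rot_upper_def by (rule all) (use upW in \<open>simp_all add: has_rot_iff\<close>)
  have R3: "Rot_lower h F UNIV = ereal ` W"
    unfolding Rot_lower_def by (rule all) (use lowW in \<open>simp_all add: has_rot_iff\<close>)
  have c1: "\<forall>i\<le>k. compact (I i) \<and> is_interval (I i) \<and> I i \<noteq> {}"
  proof (intro allI impI)
    fix i assume "i \<le> k"
    show "compact (I i) \<and> is_interval (I i) \<and> I i \<noteq> {}"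
    proof (cases "i = 0")
      case True
      then show ?thesis using line_rates_compact line_rates_interval line_rates_nonempty by (simp add: I_def)
    next
      case False
      then have "f i \<in> J" using fJ[of i] \<open>i \<le> k\<close> by simp
      from R[OF this] show ?thesis using False by (auto simp: I_def)
    qed
  qed
  have I1: "I i = R (f i)" "f i \<in> J" if "i \<in> {1..k}" for i using that fJ by (auto simp: I_def)
  have c2: "\<forall>i\<in>{1..k}. \<forall>q\<in>I i \<inter> \<rat>. \<exists>x\<in>Xinf h \<tau> F. periodic_mod1 \<tau> F x \<and> has_rot h F x (ereal q)"
    using I1 rat by metis
  have c3: "\<forall>i\<in>{1..k}. I i \<inter> \<int> \<noteq> {}" using I1 R by metis
  have c0: "ereal ` I 0 = Rot h F (range h)" by (simp add: Rot_line I_def)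
  show ?thesis
    by (intro exI[of _ k] exI[of _ I] conjI) (use c0 c1 c2 c3 kN R1 R2 R3 Rot_TR W_def in simp_all)
qed

end

section \<open>Dynamics on the interval outside the closure\<close>

text \<open>For comparing two charts: the change of coordinates is continuous and injective, and it preserves
  the minimum.\<close>

lemma increasing_change:
  fixes f :: "real \<Rightarrow> real"
  assumes J: "is_interval J" "e \<in> J" and cont: "continuous_on J f" and inj: "inj_on f J"
    and min: "\<And>t. t \<in> J \<Longrightarrow> e \<le> t" "\<And>t. t \<in> J \<Longrightarrow> f e \<le> f t"
    and st: "s \<in> J" "t \<in> J" "s < t"
  shows "f s < f t"
proof (cases "s = e")
  case True
  then have "f s \<le> f t" "f s \<noteq> f t" using min(2)[OF st(2)] inj_onD[OF inj _ st(1,2)] st(3) by auto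
  then show ?thesis by simp
next
  case False
  then have es: "e < s" using min(1)[OF st(1)] by simp
  have sub: "{e..t} \<subseteq> J"
  proof
    fix x assume "x \<in> {e..t}"
    then show "x \<in> J" using J(1)[unfolded is_interval_1, rule_format, OF J(2) st(2), of x] by simp
  qed
  have "(f e < f s \<and> f s < f t) \<or> (f t < f s \<and> f s < f e)"
    by (rule continuous_inj_imp_mono[OF es st(3) continuous_on_subset[OF cont sub] inj_on_subset[OF inj sub]])
  then show ?thesis using min(2)[OF st(1)] by auto
qed

locale sigma_chart = lifted_map +
  fixes N :: nat and X :: "nat \<Rightarrow> 'a set" and p :: "nat \<Rightarrow> int"
    and \<phi> :: "real \<Rightarrow> 'a" and g :: "'a \<Rightarrow> real" and e d :: real and a b :: "nat \<Rightarrow> real"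
  assumes chart: "homeomorphism {e..d} (XF h F) \<phi> g" and ed: "e \<le> d"
    and root: "XF h F \<inter> TR h F = {\<phi> e}"
    and ab: "i \<in> {1..N} \<Longrightarrow> e \<le> a i \<and> a i \<le> b i \<and> b i \<le> d"
    and Xi: "i \<in> {1..N} \<Longrightarrow> X i = \<phi> ` {a i..b i}"
    and disj: "i \<in> {1..N} \<Longrightarrow> j \<in> {1..N} \<Longrightarrow> i < j \<Longrightarrow> b i < a j"
    and FX: "i \<in> {1..N} \<Longrightarrow> F ` X i \<subseteq> sh (p i) ` XF h F \<union> TR h F"
    and Fa: "i \<in> {1..N} \<Longrightarrow> F (\<phi> (a i)) = sh (p i) (\<phi> e)"
    and Fout: "F ` (XF h F - (\<Union>i\<in>{1..N}. X i)) \<inter> plus_ints \<tau> (XF h F) = {}"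
begin

lemma phi_g: "x \<in> XF h F \<Longrightarrow> \<phi> (g x) = x" "x \<in> XF h F \<Longrightarrow> g x \<in> {e..d}"
  and g_phi: "t \<in> {e..d} \<Longrightarrow> g (\<phi> t) = t" "t \<in> {e..d} \<Longrightarrow> \<phi> t \<in> XF h F"
  and cont_phi: "continuous_on {e..d} \<phi>" and cont_g: "continuous_on (XF h F) g"
  using chart unfolding homeomorphism_def by (metis, metis imageI, metis, metis imageI, metis, metis)

definition branch :: "nat \<Rightarrow> real \<Rightarrow> real \<Rightarrow> bool" where
  "branch i t t' \<longleftrightarrow> t \<in> {a i..b i} \<and> t' \<in> {e..d} \<and> F (\<phi> t) = sh (p i) (\<phi> t')"

text \<open>The intermediate value theorem is applied to the branch followed by the retraction that sends
  \<open>T_R\<close> to the minimum \<open>e\<close>. It is continuous since \<open>X_F\<close> meets \<open>T_R\<close> only there.\<close>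

lemma branch_lower:
  assumes i: "i \<in> {1..N}" and branch: "branch i t t1" and t2: "e \<le> t2" "t2 \<le> t1"
  shows "\<exists>t'\<le>t. branch i t' t2"
proof (cases "t2 = e")
  case True
  have "branch i (a i) e" unfolding branch_def using ab[OF i] Fa[OF i] ed by auto
  moreover have "a i \<le> t" using branch unfolding branch_def by simp
  ultimately show ?thesis using True by blast
next
  case False
  let ?Y = "sh (p i) ` XF h F"
  \<comment> \<open>The coordinate of \<open>z\<close> on \<open>X_F + p_i\<close>, extended by the minimum to \<open>T_R\<close>.\<close>
  define k where "k z = (if z \<in> ?Y then g (sh (- p i) z) else e)" for z
  have cY: "closed ?Y" by (intro closed_sh compact_imp_closed compact_XF)
  have ck: "continuous_on (?Y \<union> TR h F) k"
    unfolding k_def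
  proof (rule continuous_on_cases[OF cY closed_TR])
    show "continuous_on ?Y (\<lambda>z. g (sh (- p i) z))"
      by (rule continuous_on_compose2[OF cont_g cont_sh]) auto
    show "\<forall>z. z \<in> ?Y \<and> z \<notin> ?Y \<or> z \<in> TR h F \<and> z \<in> ?Y \<longrightarrow> g (sh (- p i) z) = e"
    proof (intro allI impI)
      fix z assume "z \<in> ?Y \<and> z \<notin> ?Y \<or> z \<in> TR h F \<and> z \<in> ?Y"
      then have "sh (- p i) z \<in> XF h F \<inter> TR h F" by (auto simp: TR_sh)
      then have "sh (- p i) z = \<phi> e" unfolding root by simp
      then show "g (sh (- p i) z) = e" using g_phi(1)[of e] ed by simp
    qed
  qed auto
  have t: "a i \<le> t" "t \<le> b i" using branch unfolding branch_def by auto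
  have sub: "{a i..t} \<subseteq> {e..d}" "{a i..t} \<subseteq> {a i..b i}" using ab[OF i] t by auto
  have "continuous_on {a i..t} (\<lambda>s. F (\<phi> s))"
    by (rule continuous_on_compose2[OF cont_F continuous_on_subset[OF cont_phi sub(1)]]) auto
  moreover have "(\<lambda>s. F (\<phi> s)) ` {a i..t} \<subseteq> ?Y \<union> TR h F"
  proof -
    have "(\<lambda>s. F (\<phi> s)) ` {a i..t} \<subseteq> F ` X i" unfolding Xi[OF i] image_image using sub(2) by (rule image_mono)
    then show ?thesis using FX[OF i] by blast
  qed
  ultimately have cpsi: "continuous_on {a i..t} (\<lambda>s. k (F (\<phi> s)))"
    by (rule continuous_on_compose2[OF ck])
  have ksh: "k (sh (p i) (\<phi> s)) = s" if "s \<in> {e..d}" for s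
    using g_phi[OF that] unfolding k_def by auto
  have k1: "k (F (\<phi> (a i))) = e" using Fa[OF i] ksh[of e] ed by simp
  have k2: "k (F (\<phi> t)) = t1" using branch ksh[of t1] unfolding branch_def by auto
  obtain s where s: "a i \<le> s" "s \<le> t" "k (F (\<phi> s)) = t2"
    using IVT'[of "\<lambda>s. k (F (\<phi> s))" "a i" t2 t] k1 k2 t2 t(1) cpsi by auto
  have "F (\<phi> s) \<in> ?Y" using s(3) False unfolding k_def by (auto split: if_splits)
  then obtain z where z: "z \<in> XF h F" "F (\<phi> s) = sh (p i) z" by blast
  then have "g z = t2" using s(3) unfolding k_def by auto
  then have "F (\<phi> s) = sh (p i) (\<phi> t2)" using z phi_g(1) by metis
  moreover have "t2 \<in> {e..d}" using t2 branch unfolding branch_def by auto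
  ultimately have "branch i s t2" unfolding branch_def using s t by auto
  then show ?thesis using s(2) by blast
qed

lemma closed_branch: "i \<in> {1..N} \<Longrightarrow> closed {(t, t'). branch i t t'}"
proof -
  assume i: "i \<in> {1..N}"
  have sub: "{a i..b i} \<subseteq> {e..d}" using ab[OF i] by auto
  let ?S = "{a i..b i} \<times> {e..d}"
  have "continuous_on ?S (\<lambda>z. (F (\<phi> (fst z)), sh (p i) (\<phi> (snd z))))"
    by (intro continuous_on_Pair continuous_on_compose2[OF cont_F] continuous_on_compose2[OF cont_sh]
        continuous_on_compose2[OF cont_phi] continuous_on_fst continuous_on_snd continuous_on_id)
      (use sub in auto)
  from continuous_closed_preimage[OF this _ closed_diagonal]
  have "closed (?S \<inter> (\<lambda>z. (F (\<phi> (fst z)), sh (p i) (\<phi> (snd z)))) -` {y. \<exists>x. y = (x, x)})"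
    by (simp add: closed_Times)
  moreover have "?S \<inter> (\<lambda>z. (F (\<phi> (fst z)), sh (p i) (\<phi> (snd z)))) -` {y. \<exists>x. y = (x, x)} = {(t, t'). branch i t t'}"
    by (auto simp: branch_def)
  ultimately show ?thesis by simp
qed

sublocale br: interval_branches e d a b branch "{1..N}"
proof
  show "branch i t t' \<Longrightarrow> a i \<le> t \<and> t \<le> b i \<and> t \<in> {e..d} \<and> t' \<in> {e..d}" if "i \<in> {1..N}" for i t t'
    using ab[OF that] by (auto simp: branch_def)
qed (use disj closed_branch branch_lower in auto)

sublocale sy: lower_shift "br.itineraries" "{1..N}" by (rule br.itineraries_lower_shift)

lemma orbit_point: "br.orbit s \<xi> \<Longrightarrow> (F ^^ n) (\<phi> (\<xi> 0)) = sh (psum p s n) (\<phi> (\<xi> n)) \<and> \<phi> (\<xi> n) \<in> XF h F"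
proof (induction n)
  case 0
  have "\<xi> 0 \<in> {e..d}" using br.orbit_box[OF 0] by (simp add: br.box_def)
  then show ?case using g_phi(2) by simp
next
  case (Suc n)
  have branch: "branch (s n) (\<xi> n) (\<xi> (Suc n))" using Suc.prems unfolding br.orbit_def by blast
  then have "F (\<phi> (\<xi> n)) = sh (p (s n)) (\<phi> (\<xi> (Suc n)))" "\<xi> (Suc n) \<in> {e..d}" unfolding branch_def by auto
  then show ?case using Suc g_phi(2) by (simp add: F_sh)
qed

lemma orbit_disp:
  assumes "br.orbit s \<xi>"
  shows "\<bar>disp n (\<phi> (\<xi> 0)) - of_int (psum p s n)\<bar> \<le> 1"
proof -
  have n: "(F ^^ n) (\<phi> (\<xi> 0)) = sh (psum p s n) (\<phi> (\<xi> n))" "\<phi> (\<xi> n) \<in> XF h F" "\<phi> (\<xi> 0) \<in> XF h F"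
    using orbit_point[OF assms, of n] orbit_point[OF assms, of 0] by auto
  show ?thesis unfolding disp_def n(1) using XF_r[OF n(2)] XF_r[OF n(3)] by auto
qed

lemma orbit_has_rot:
  assumes o: "br.orbit s \<xi>" and lim: "(\<lambda>n. of_int (psum p s n) / real n) \<longlonglongrightarrow> \<alpha>"
  shows "has_rot h F (\<phi> (\<xi> 0)) (ereal \<alpha>)"
proof (rule has_rot_of_tendsto)
  have "\<bar>of_int (psum p s n) - disp n (\<phi> (\<xi> 0))\<bar> \<le> 1" for n using orbit_disp[OF o, of n] by linarith
  from rates_cong(3)[of "\<lambda>n. of_int (psum p s n)" "\<lambda>n. disp n (\<phi> (\<xi> 0))" 1, OF this] lim
  show "(\<lambda>n. disp n (\<phi> (\<xi> 0)) / real n) \<longlonglongrightarrow> \<alpha>" by blast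
qed

text \<open>A point of \<open>X_F\<close> outside the intervals \<open>X_i\<close> is mapped off the translates of \<open>X_F\<close>, hence into \<open>T_R\<close>. So
  an orbit that avoids \<open>T_R\<close> stays in the translates of these intervals.\<close>

lemma orbit_exists:
  assumes x: "x \<in> XF h F" and out: "\<And>n. (F ^^ n) x \<notin> TR h F"
  shows "\<exists>s \<xi>. br.orbit s \<xi> \<and> \<phi> (\<xi> 0) = x"
proof -
  have "\<exists>m. sh m ((F ^^ n) x) \<in> XF h F" for n using outside_TR out by blast
  then obtain m where m: "\<And>n. sh (m n) ((F ^^ n) x) \<in> XF h F" by metis
  define y where "y n = sh (m n) ((F ^^ n) x)" for n
  have yX: "y n \<in> XF h F" for n using m unfolding y_def by blast
  have yT: "y n \<notin> TR h F" for n using out by (simp add: y_def TR_sh)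
  have Fy: "F (y n) = sh (m n - m (Suc n)) (y (Suc n))" for n by (simp add: y_def F_sh)
  have "\<exists>i. i \<in> {1..N} \<and> y n \<in> X i" for n
  proof (rule ccontr)
    assume "\<not> ?thesis"
    then have "F (y n) \<in> F ` (XF h F - (\<Union>i\<in>{1..N}. X i))" using yX by blast
    moreover have "F (y n) \<in> plus_ints \<tau> (XF h F)" unfolding Fy plus_ints_def using yX by blast
    ultimately show False using Fout by blast
  qed
  then obtain s where s: "\<And>n. s n \<in> {1..N}" "\<And>n. y n \<in> X (s n)" by metis
  have step: "F (y n) = sh (p (s n)) (y (Suc n))" for n
  proof -
    have "F (y n) \<notin> TR h F" unfolding Fy TR_sh by (rule yT)
    then have "F (y n) \<in> sh (p (s n)) ` XF h F" using FX[OF s(1)] s(2) by blast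
    then obtain z where z: "z \<in> XF h F" "F (y n) = sh (p (s n)) z" by blast
    then have "sh (m n - m (Suc n)) (y (Suc n)) = sh (p (s n)) z" using Fy by simp
    then have "y (Suc n) = z" by (rule XF_unique(2)[OF yX z(1)])
    then show ?thesis using z(2) by simp
  qed
  have "br.orbit s (\<lambda>n. g (y n))" unfolding br.orbit_def
  proof (intro allI conjI s(1))
    fix n
    obtain t where t: "t \<in> {a (s n)..b (s n)}" "y n = \<phi> t" using s(2)[of n] Xi[OF s(1)] by blast
    have "t \<in> {e..d}" using t(1) ab[OF s(1)[of n]] by auto
    then have "g (y n) = t" using t(2) g_phi(1) by simp
    then have "g (y n) \<in> {a (s n)..b (s n)}" using t(1) by simp
    then show "branch (s n) (g (y n)) (g (y (Suc n)))"
      unfolding branch_def phi_g(1)[OF yX] using phi_g(2)[OF yX] step by blast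
  qed
  moreover have "\<phi> (g (y 0)) = x"
  proof -
    have "sh 0 (y 0) = sh (m 0) x" by (simp add: y_def)
    then have "y 0 = x" by (rule XF_unique(2)[OF yX x])
    then show ?thesis using phi_g(1)[OF x] by simp
  qed
  ultimately show ?thesis by blast
qed

lemma itinerary_rates:
  assumes out: "\<And>n. (F ^^ n) x \<notin> TR h F"
  shows "\<exists>m. (\<lambda>_. m) \<in> br.itineraries \<and> upper_rot h F x \<in> ereal ` sy.rot_interval p m"
    and "\<exists>m. (\<lambda>_. m) \<in> br.itineraries \<and> lower_rot h F x \<in> ereal ` sy.rot_interval p m"
proof -
  have "x \<notin> TR h F" using out[of 0] by simp
  then obtain l where l: "sh l x \<in> XF h F" using outside_TR by blast
  have "(F ^^ n) (sh l x) \<notin> TR h F" for n using out by (simp add: Fn_sh TR_sh)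
  then obtain s \<xi> where o: "br.orbit s \<xi>" "\<phi> (\<xi> 0) = sh l x" using orbit_exists[OF l] by blast
  have sS: "s \<in> br.itineraries" using o(1) unfolding br.itineraries_def by blast
  have cl: "cluster_rate (\<lambda>n. of_int (psum p s n)) \<alpha>" if "cluster_rate (\<lambda>n. disp n x) \<alpha>" for \<alpha>
    using that
  proof (rule cluster_rate_shift)
    fix n show "\<bar>of_int (psum p s n) - disp (n + 0) x\<bar> \<le> 1"
      using orbit_disp[OF o(1), of n] unfolding o(2) disp_sh by (simp add: abs_minus_commute)
  qed
  have key: "\<exists>m. (\<lambda>_. m) \<in> br.itineraries \<and> \<rho> \<in> ereal ` sy.rot_interval p m"
    if "\<rho> = ereal \<alpha>" "cluster_rate (\<lambda>n. disp n x) \<alpha>" for \<rho> \<alpha>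
    using sy.cluster_rate_mem[OF sS cl[OF that(2)]] that(1) by blast
  show "\<exists>m. (\<lambda>_. m) \<in> br.itineraries \<and> upper_rot h F x \<in> ereal ` sy.rot_interval p m"
    using extreme_rates(1)[of "\<lambda>n. disp n x" speed, OF disp_bound] key unfolding upper_rot_disp by blast
  show "\<exists>m. (\<lambda>_. m) \<in> br.itineraries \<and> lower_rot h F x \<in> ereal ` sy.rot_interval p m"
    using extreme_rates(2)[of "\<lambda>n. disp n x" speed, OF disp_bound] key unfolding lower_rot_disp by blast
qed

lemma periodic_point:
  assumes m: "(\<lambda>_. m) \<in> br.itineraries" and q: "q \<in> sy.rot_interval p m" "q \<in> \<rat>"
  shows "\<exists>x\<in>Xinf h \<tau> F. periodic_mod1 \<tau> F x \<and> has_rot h F x (ereal q)"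
proof -
  obtain u where u: "u \<noteq> []" "per u \<in> br.itineraries" "of_int (wsum p u) = q * real (length u)"
    using sy.rational_cycle[OF m q] by blast
  obtain \<xi> where xi: "br.orbit (per u) \<xi>" "\<xi> (length u) = \<xi> 0" using br.periodic_orbit[OF u(1,2)] by blast
  let ?x = "\<phi> (\<xi> 0)"
  let ?n = "length u"
  have xX: "?x \<in> XF h F" using orbit_point[OF xi(1), of 0] by simp
  have pu: "psum p (per u) ?n = wsum p u" using tk_per[OF u(1), of 1] wsum_tk[of p ?n "per u"] by (simp add: pow_Suc)
  have "(F ^^ n) ?x \<in> plus_ints \<tau> (XF h F)" for n
    using orbit_point[OF xi(1), of n] unfolding plus_ints_def by auto
  then have "?x \<in> Xinf h \<tau> F" using xX unfolding Xinf_def by blast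
  moreover have "periodic_mod1 \<tau> F ?x"
  proof -
    have "(F ^^ ?n) ?x \<in> plus_ints \<tau> {?x}"
      using orbit_point[OF xi(1), of ?n] xi(2) unfolding plus_ints_def by auto
    moreover have "?n \<ge> 1" using u(1) by (simp add: Suc_leI)
    ultimately show ?thesis unfolding periodic_mod1_def by blast
  qed
  moreover have "has_rot h F ?x (ereal q)"
  proof (rule orbit_has_rot[OF xi(1)])
    have lin: "psum p (per u) (k * ?n) = int k * wsum p u" for k
      using tk_per[OF u(1), of k] wsum_tk[of p "k * ?n" "per u"] by simp
    define C where "C = Max ((\<lambda>i. \<bar>of_int (psum p (per u) i) - q * real i\<bar>) ` {..?n})"
    have C: "\<bar>of_int (psum p (per u) i) - q * real i\<bar> \<le> C" if "i \<le> ?n" for i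
      unfolding C_def using that by (intro Max_ge) auto
    have "\<bar>q * real n - of_int (psum p (per u) n)\<bar> \<le> C" for n
    proof -
      define k i where "k = n div ?n" and "i = n mod ?n"
      have n: "n = k * ?n + i" "i \<le> ?n" using u(1) unfolding k_def i_def by (auto simp: less_imp_le)
      have "psum p (per u) n = int k * wsum p u + psum p (per u) i"
        unfolding n(1) psum_add lin drp_per[OF u(1)] ..
      then have "of_int (psum p (per u) n) = real k * (q * real ?n) + of_int (psum p (per u) i)"
        by (simp add: u(3))
      then have "q * real n - of_int (psum p (per u) n) = q * real i - of_int (psum p (per u) i)"
        unfolding n(1) by (simp add: algebra_simps)
      then show ?thesis using C[OF n(2)] by (simp add: abs_minus_commute)
    qed
    note lim_iff = rates_cong(3)[of "\<lambda>n. q * real n" "\<lambda>n. of_int (psum p (per u) n)" C q, OF this]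
    show "(\<lambda>n. of_int (psum p (per u) n) / real n) \<longlonglongrightarrow> q"
    proof -
      have "(\<lambda>n. q * real n / real n) \<longlonglongrightarrow> q"
        by (rule tendsto_eventually, rule eventually_sequentiallyI[of 1]) simp
      then show ?thesis using lim_iff by blast
    qed
  qed
  ultimately show ?thesis by blast
qed

lemma whisker_intervals:
  shows "\<exists>(J :: nat set) (R :: nat \<Rightarrow> real set). J \<subseteq> {1..N}
    \<and> (\<forall>m\<in>J. compact (R m) \<and> is_interval (R m) \<and> R m \<inter> \<int> \<noteq> {})
    \<and> (\<forall>x. (\<forall>n. (F ^^ n) x \<notin> TR h F) \<longrightarrow>
        (\<exists>m\<in>J. upper_rot h F x \<in> ereal ` R m) \<and> (\<exists>m\<in>J. lower_rot h F x \<in> ereal ` R m))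
    \<and> (\<forall>m\<in>J. \<forall>\<alpha>\<in>R m. \<exists>x. has_rot h F x (ereal \<alpha>))
    \<and> (\<forall>m\<in>J. \<forall>q\<in>R m \<inter> \<rat>. \<exists>x\<in>Xinf h \<tau> F. periodic_mod1 \<tau> F x \<and> has_rot h F x (ereal q))"
proof -
  define J where "J = {m. (\<lambda>_. m) \<in> br.itineraries}"
  have "J \<subseteq> {1..N}" using sy.letters unfolding J_def by blast
  moreover have "compact (sy.rot_interval p m) \<and> is_interval (sy.rot_interval p m) \<and> sy.rot_interval p m \<inter> \<int> \<noteq> {}"
    if "m \<in> J" for m
  proof -
    have mS: "(\<lambda>_. m) \<in> br.itineraries" using that unfolding J_def by simp
    have "of_int (wsum p [m]) / real (length [m]) \<in> sy.rot_interval p m"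
      using sy.follow_const[OF mS] by (intro sy.avg_mem sy.self_loop[OF mS]) auto
    then have "of_int (p m) \<in> sy.rot_interval p m \<inter> \<int>" by simp
    then show ?thesis unfolding sy.rot_interval_def by (auto simp: is_interval_1)
  qed
  moreover have "(\<exists>m\<in>J. upper_rot h F x \<in> ereal ` sy.rot_interval p m) \<and> (\<exists>m\<in>J. lower_rot h F x \<in> ereal ` sy.rot_interval p m)"
    if "\<forall>n. (F ^^ n) x \<notin> TR h F" for x
    using itinerary_rates[of x] that unfolding J_def by blast
  moreover have "\<exists>x. has_rot h F x (ereal \<alpha>)" if mJ: "m \<in> J" and al: "\<alpha> \<in> sy.rot_interval p m" for m \<alpha>
  proof -
    have mS: "(\<lambda>_. m) \<in> br.itineraries" using mJ unfolding J_def by simp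
    obtain s where s: "s \<in> br.itineraries" "(\<lambda>n. of_int (psum p s n) / real n) \<longlonglongrightarrow> \<alpha>"
      using sy.realise_rate[OF _ _ al] sy.follow_const[OF mS] sy.self_loop[OF mS] by blast
    obtain \<xi> where "br.orbit s \<xi>" using s(1) unfolding br.itineraries_def by blast
    from orbit_has_rot[OF this s(2)] show ?thesis by blast
  qed
  moreover have "\<exists>x\<in>Xinf h \<tau> F. periodic_mod1 \<tau> F x \<and> has_rot h F x (ereal q)"
    if mJ: "m \<in> J" and q: "q \<in> sy.rot_interval p m \<inter> \<rat>" for m q
    using periodic_point[of m q] mJ q unfolding J_def by blast
  ultimately show ?thesis by (intro exI[of _ J] exI[of _ "sy.rot_interval p"]) blast
qed

end

context lifted_map
begin

text \<open>All charts of \<open>X_F\<close> are replaced by one, in which the intervals \<open>X_i\<close> are \<open>{a i..b i}\<close> and the order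
  of \<open>X_F\<close> is the order of the reals.\<close>

lemma normal_form:
  assumes pd: "partition_datum h \<tau> F N X p" and N: "N \<ge> 1"
  shows "\<exists>\<phi> g e d a b. sigma_chart h \<tau> F N X p \<phi> g e d a b"
proof -
  let ?Y = "XF h F"
  note pd_parts = pd[unfolded partition_datum_def]
  note pd1 = pd_parts[THEN conjunct1]
    and pd2 = pd_parts[THEN conjunct2, THEN conjunct1]
    and pd3 = pd_parts[THEN conjunct2, THEN conjunct2, THEN conjunct1]
    and pd4 = pd_parts[THEN conjunct2, THEN conjunct2, THEN conjunct2, THEN conjunct1]
    and pd5 = pd_parts[THEN conjunct2, THEN conjunct2, THEN conjunct2, THEN conjunct2, THEN conjunct2]
  have sub: "XF_subinterval h F (X i)" if "i \<in> {1..N}" for i using pd1 that by (rule bspec)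
  have "XF_subinterval h F (X 1)" using sub N by simp
  then obtain J \<phi> where chart0: "XF_chart h F J \<phi>" unfolding XF_subinterval_def by blast
  then obtain e g where J: "is_interval J" "homeomorphism J ?Y \<phi> g" "e \<in> J" "\<And>t. t \<in> J \<Longrightarrow> e \<le> t"
    "?Y \<inter> TR h F = {\<phi> e}" unfolding XF_chart_def interval_chart_def by blast
  have gY: "g ` ?Y = J" "continuous_on ?Y g" and phiJ: "\<phi> ` J = ?Y"
    and phig: "\<And>x. x \<in> ?Y \<Longrightarrow> \<phi> (g x) = x" and gphi: "\<And>t. t \<in> J \<Longrightarrow> g (\<phi> t) = t"
    using J(2) by (auto simp: homeomorphism_def)
  have "compact J" using compact_continuous_image[OF gY(2) compact_XF] gY(1) by simp
  then obtain d where d: "d \<in> J" "\<And>t. t \<in> J \<Longrightarrow> t \<le> d"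
    using compact_attains_sup[of J] J(3) by blast
  have Jed: "J = {e..d}"
  proof
    show "J \<subseteq> {e..d}" using J(4) d(2) by auto
    show "{e..d} \<subseteq> J"
    proof
      fix t assume "t \<in> {e..d}"
      then show "t \<in> J" using J(1)[unfolded is_interval_1, rule_format, OF J(3) d(1), of t] by simp
    qed
  qed
  have change: "continuous_on J' (g \<circ> \<phi>') \<and> (\<forall>s\<in>J'. \<phi> (g (\<phi>' s)) = \<phi>' s \<and> \<phi>' s \<in> ?Y)
      \<and> (\<forall>s\<in>J'. \<forall>t\<in>J'. s < t \<longrightarrow> g (\<phi>' s) < g (\<phi>' t)) \<and> is_interval J'"
    if chart': "XF_chart h F J' \<phi>'" for J' \<phi>'
  proof -
    obtain e' g' where J': "is_interval J'" "homeomorphism J' ?Y \<phi>' g'" "e' \<in> J'" "\<And>t. t \<in> J' \<Longrightarrow> e' \<le> t"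
      "?Y \<inter> TR h F = {\<phi>' e'}" using chart' unfolding XF_chart_def interval_chart_def by blast
    have im: "\<phi>' ` J' = ?Y" and cp: "continuous_on J' \<phi>'" and g': "\<And>t. t \<in> J' \<Longrightarrow> g' (\<phi>' t) = t"
      using J'(2) by (auto simp: homeomorphism_def)
    have Y: "\<phi>' s \<in> ?Y" if "s \<in> J'" for s using imageI[OF that, of \<phi>'] unfolding im .
    have cont: "continuous_on J' (g \<circ> \<phi>')" by (rule continuous_on_compose[OF cp]) (simp add: im gY(2))
    have inj: "inj_on (g \<circ> \<phi>') J'"
    proof (rule inj_onI)
      fix s t assume st: "s \<in> J'" "t \<in> J'" "(g \<circ> \<phi>') s = (g \<circ> \<phi>') t"
      then have "\<phi> (g (\<phi>' s)) = \<phi> (g (\<phi>' t))" by (simp only: comp_apply)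
      then have "\<phi>' s = \<phi>' t" unfolding phig[OF Y[OF st(1)]] phig[OF Y[OF st(2)]] .
      then have "g' (\<phi>' s) = g' (\<phi>' t)" by (rule arg_cong)
      then show "s = t" unfolding g'[OF st(1)] g'[OF st(2)] .
    qed
    have "{\<phi>' e'} = {\<phi> e}" unfolding J(5)[symmetric] J'(5)[symmetric] ..
    then have ee: "\<phi>' e' = \<phi> e" by (rule singleton_inject)
    have min: "(g \<circ> \<phi>') e' \<le> (g \<circ> \<phi>') t" if t: "t \<in> J'" for t
    proof -
      have "g (\<phi>' t) \<in> J" using imageI[OF Y[OF t], of g] unfolding gY(1) .
      then have "e \<le> g (\<phi>' t)" by (rule J(4))
      then show ?thesis by (simp add: ee gphi[OF J(3)])
    qed
    have "g (\<phi>' s) < g (\<phi>' t)" if "s \<in> J'" "t \<in> J'" "s < t" for s t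
      using increasing_change[OF J'(1,3) cont inj J'(4) min that] by simp
    then show ?thesis using cont Y phig[OF Y] J'(1) by (intro conjI ballI impI)
  qed
  have less1: "g x < g y" if xy: "XF_less h F x y" for x y
  proof -
    obtain J' \<phi>' s t where c: "XF_chart h F J' \<phi>'" "s \<in> J'" "t \<in> J'" "x = \<phi>' s" "y = \<phi>' t" "s < t"
      using xy unfolding XF_less_def by blast
    have "g (\<phi>' s) < g (\<phi>' t)" using change[OF c(1)] c(2,3,6) by blast
    then show ?thesis unfolding c(4,5) .
  qed
  have less2: "XF_less h F (\<phi> s) (\<phi> t)" if "s \<in> J" "t \<in> J" "s < t" for s t
    unfolding XF_less_def using chart0 that by blast
  have min_eq: "XF_min h F (\<phi> ` {u..v}) = \<phi> u" if uv: "e \<le> u" "u \<le> v" "v \<le> d" for u v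
    unfolding XF_min_def
  proof (rule the_equality)
    have uJ: "{u..v} \<subseteq> J" using uv Jed by auto
    show "\<phi> u \<in> \<phi> ` {u..v} \<and> (\<forall>x\<in>\<phi> ` {u..v}. x = \<phi> u \<or> XF_less h F (\<phi> u) x)"
    proof (intro conjI ballI)
      show "\<phi> u \<in> \<phi> ` {u..v}" using uv by simp
      fix x assume "x \<in> \<phi> ` {u..v}"
      then obtain s where s: "s \<in> {u..v}" "x = \<phi> s" by blast
      show "x = \<phi> u \<or> XF_less h F (\<phi> u) x"
      proof (cases "s = u")
        case False
        then have "u < s" using s(1) by simp
        moreover have "u \<in> {u..v}" using uv by simp
        then have "u \<in> J" by (rule subsetD[OF uJ])
        moreover have "s \<in> J" using s(1) by (rule subsetD[OF uJ])
        ultimately show ?thesis using less2[of u s] s(2) by simp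
      qed (use s in simp)
    qed
    fix m assume m: "m \<in> \<phi> ` {u..v} \<and> (\<forall>x\<in>\<phi> ` {u..v}. x = m \<or> XF_less h F m x)"
    then obtain s where s: "s \<in> {u..v}" "m = \<phi> s" by blast
    have "\<phi> u \<in> \<phi> ` {u..v}" using uv by simp
    then have "\<phi> u = m \<or> XF_less h F m (\<phi> u)" using m by blast
    moreover have "\<not> XF_less h F m (\<phi> u)"
    proof
      assume "XF_less h F m (\<phi> u)"
      then have "g (\<phi> s) < g (\<phi> u)" using less1 s(2) by blast
      moreover have "s \<in> J" "u \<in> J" using s(1) uv by (simp_all add: Jed)
      ultimately show False using gphi s(1) by simp
    qed
    ultimately show "m = \<phi> u" by simp
  qed
  have "\<exists>a b. e \<le> a \<and> a \<le> b \<and> b \<le> d \<and> A = \<phi> ` {a..b}" if A: "XF_subinterval h F A" for A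
  proof -
    obtain J' \<phi>' a' b' where c: "XF_chart h F J' \<phi>'" "a' \<in> J'" "b' \<in> J'" "a' \<le> b'" "A = \<phi>' ` {a'..b'}"
      using A unfolding XF_subinterval_def by blast
    define f where "f = g \<circ> \<phi>'"
    have f: "continuous_on J' f" "\<And>s. s \<in> J' \<Longrightarrow> \<phi> (f s) = \<phi>' s" "\<And>s. s \<in> J' \<Longrightarrow> \<phi>' s \<in> ?Y"
      "\<And>s t. s \<in> J' \<Longrightarrow> t \<in> J' \<Longrightarrow> s < t \<Longrightarrow> f s < f t" "is_interval J'"
      using change[OF c(1)] unfolding f_def by auto
    have sJ: "{a'..b'} \<subseteq> J'"
    proof
      fix t assume "t \<in> {a'..b'}"
      then show "t \<in> J'" using f(5)[unfolded is_interval_1, rule_format, OF c(2,3), of t] by simp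
    qed
    have fJ: "f s \<in> {e..d}" if "s \<in> J'" for s
    proof -
      have "f s \<in> J" unfolding f_def comp_def gY(1)[symmetric] using f(3)[OF that] by (rule imageI)
      then show ?thesis unfolding Jed .
    qed
    have mono: "f s \<le> f t" if "s \<in> J'" "t \<in> J'" "s \<le> t" for s t
      using f(4)[OF that(1,2)] that(3) by (cases "s = t") auto
    have fim: "f ` {a'..b'} = {f a'..f b'}"
    proof
      show "f ` {a'..b'} \<subseteq> {f a'..f b'}"
      proof
        fix y assume "y \<in> f ` {a'..b'}"
        then obtain s where s: "s \<in> {a'..b'}" "y = f s" by blast
        then have "s \<in> J'" using sJ by blast
        then show "y \<in> {f a'..f b'}" using mono[OF c(2), of s] mono[of s b'] c(3) s by auto
      qed
      show "{f a'..f b'} \<subseteq> f ` {a'..b'}"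
      proof
        fix y assume y: "y \<in> {f a'..f b'}"
        have "\<exists>s. a' \<le> s \<and> s \<le> b' \<and> f s = y"
          by (rule IVT') (use y c(4) continuous_on_subset[OF f(1) sJ] in auto)
        then show "y \<in> f ` {a'..b'}" by auto
      qed
    qed
    have "A = \<phi> ` {f a'..f b'}" unfolding fim[symmetric] image_image c(5)
      by (rule image_cong) (use f(2) sJ in auto)
    moreover have "e \<le> f a'" "f a' \<le> f b'" "f b' \<le> d" using fJ[OF c(2)] fJ[OF c(3)] mono[OF c(2,3,4)] by auto
    ultimately show ?thesis by blast
  qed
  then have "\<forall>i. \<exists>ab. i \<in> {1..N} \<longrightarrow> e \<le> fst ab \<and> fst ab \<le> snd ab \<and> snd ab \<le> d \<and> X i = \<phi> ` {fst ab..snd ab}"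
    using sub by fastforce
  then obtain ab where ab: "\<And>i. i \<in> {1..N} \<Longrightarrow>
      e \<le> fst (ab i) \<and> fst (ab i) \<le> snd (ab i) \<and> snd (ab i) \<le> d \<and> X i = \<phi> ` {fst (ab i)..snd (ab i)}"
    by metis
  define a b where "a i = fst (ab i)" and "b i = snd (ab i)" for i
  have ab': "e \<le> a i" "a i \<le> b i" "b i \<le> d" "X i = \<phi> ` {a i..b i}" if "i \<in> {1..N}" for i
    using ab[OF that] unfolding a_def b_def by auto
  have next_i: "b i < a (Suc i)" if i: "i \<in> {1..<N}" for i
  proof -
    have i1: "i \<in> {1..N}" "Suc i \<in> {1..N}" using i by auto
    have "\<phi> (b i) \<in> X i" "\<phi> (a (Suc i)) \<in> X (Suc i)" using ab'[OF i1(1)] ab'[OF i1(2)] by auto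
    moreover have "\<forall>x\<in>X i. \<forall>y\<in>X (i + 1). XF_less h F x y" using pd2 i by (rule bspec)
    ultimately have "XF_less h F (\<phi> (b i)) (\<phi> (a (Suc i)))" by simp
    then have "g (\<phi> (b i)) < g (\<phi> (a (Suc i)))" by (rule less1)
    moreover have "b i \<in> J" "a (Suc i) \<in> J" using ab'[OF i1(1)] ab'[OF i1(2)] unfolding Jed by auto
    ultimately show ?thesis using gphi by simp
  qed
  have disj: "b i < a j" if "i \<in> {1..N}" "j \<in> {1..N}" "i < j" for i j
  proof -
    have "Suc i \<le> j \<Longrightarrow> j \<le> N \<Longrightarrow> b i < a j" for j
    proof (induction j rule: dec_induct)
      case base then show ?case using next_i[of i] that(1) by simp
    next
      case (step j)
      then have "b i < a j" by simp
      also have "a j \<le> b j" using ab'(2)[of j] step that(1) by simp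
      also have "b j < a (Suc j)" using next_i[of j] step that(1) by simp
      finally show ?case .
    qed
    then show ?thesis using that by simp
  qed
  have Ymin: "XF_min h F ?Y = \<phi> e" using min_eq[of e d] J(4)[OF d(1)] phiJ Jed by simp
  have "sigma_chart h \<tau> F N X p \<phi> g e d a b"
  proof
    show "homeomorphism {e..d} ?Y \<phi> g" using J(2) unfolding Jed .
    show "e \<le> d" using J(4)[OF d(1)] .
    show "?Y \<inter> TR h F = {\<phi> e}" by (rule J(5))
    show "e \<le> a i \<and> a i \<le> b i \<and> b i \<le> d" if "i \<in> {1..N}" for i using ab'[OF that] by simp
    show "X i = \<phi> ` {a i..b i}" if "i \<in> {1..N}" for i using ab'[OF that] by simp
    show "b i < a j" if "i \<in> {1..N}" "j \<in> {1..N}" "i < j" for i j by (rule disj[OF that])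
    show "F ` X i \<subseteq> sh (p i) ` ?Y \<union> TR h F" if "i \<in> {1..N}" for i
      using pd3 that by (rule bspec)
    show "F (\<phi> (a i)) = sh (p i) (\<phi> e)" if i: "i \<in> {1..N}" for i
    proof -
      have "F (XF_min h F (X i)) = sh (p i) (XF_min h F ?Y)" using pd4 i by (rule bspec)
      moreover have "XF_min h F (X i) = \<phi> (a i)" unfolding ab'(4)[OF i] using ab'(1-3)[OF i] by (rule min_eq)
      ultimately show ?thesis using Ymin by simp
    qed
    show "F ` (?Y - (\<Union>i\<in>{1..N}. X i)) \<inter> plus_ints \<tau> ?Y = {}"
      by (rule pd5)
  qed
  then show ?thesis by blast
qed

end

theorem theorem4p8:
  fixes h :: "real \<Rightarrow> 'a::t2_space" and \<tau> F :: "'a \<Rightarrow> 'a" and N :: nat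
  assumes "lifted_graph h \<tau>"
    and "sigma_like h \<tau> F"
    and "\<exists>X p. partition_datum h \<tau> F N X p"
  shows "\<exists>(k::nat) (I :: nat \<Rightarrow> real set).
    (\<forall>i\<le>k. compact (I i) \<and> is_interval (I i) \<and> I i \<noteq> {}) \<and>
    ereal ` I 0 = Rot h F (range h) \<and>
    Rot h F (range h) = Rot h F (TR h F) \<and>
    Rot h F UNIV = Rot_upper h F UNIV \<and>
    Rot_upper h F UNIV = Rot_lower h F UNIV \<and>
    Rot_lower h F UNIV = ereal ` (\<Union>i\<le>k. I i) \<and>
    (\<forall>i\<in>{1..k}. \<forall>q\<in>I i \<inter> \<rat>.
       \<exists>x\<in>Xinf h \<tau> F. periodic_mod1 \<tau> F x \<and> has_rot h F x (ereal q)) \<and>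
    (\<forall>i\<in>{1..k}. I i \<inter> \<int> \<noteq> {}) \<and>
    k \<le> N"
proof -
  have "continuous_on UNIV F" "degree_one \<tau> F" using assms(2) by (simp_all add: sigma_like_def)
  then interpret lifted_map h \<tau> F using assms(1) by unfold_locales
  obtain X p where pd: "partition_datum h \<tau> F N X p" using assms(3) by blast
  show ?thesis
  proof (cases "N = 0")
    case True
    have enters: "\<exists>n. (F ^^ n) x \<in> TR h F" for x
    proof (rule ccontr)
      assume out: "\<nexists>n. (F ^^ n) x \<in> TR h F"
      then have "(F ^^ 0) x \<notin> TR h F" by blast
      then obtain m where m: "sh m x \<in> XF h F" using outside_TR by auto
      have "F ` XF h F \<inter> plus_ints \<tau> (XF h F) = {}" using pd True unfolding partition_datum_def by simp
      then have "F (sh m x) \<notin> plus_ints \<tau> (XF h F)" using m by blast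
      then have "F (sh m x) \<in> TR h F" using outside_TR[of "F (sh m x)"] unfolding plus_ints_iff by blast
      then have "(F ^^ 1) x \<in> TR h F" by (simp add: F_sh TR_sh)
      then show False using out by blast
    qed
    show ?thesis by (rule assembly[of "{}" N "\<lambda>_. {}"]) (use enters in auto)
  next
    case False
    then have "N \<ge> 1" by simp
    from normal_form[OF pd this] obtain \<phi> g e d a b where sc: "sigma_chart h \<tau> F N X p \<phi> g e d a b" by blast
    interpret sigma_chart h \<tau> F N X p \<phi> g e d a b by (rule sc)
    obtain J R where JR: "J \<subseteq> {1..N}"
      "\<And>m. m \<in> J \<Longrightarrow> compact (R m) \<and> is_interval (R m) \<and> R m \<inter> \<int> \<noteq> {}"
      "\<And>x. (\<And>n. (F ^^ n) x \<notin> TR h F) \<Longrightarrow>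
        (\<exists>m\<in>J. upper_rot h F x \<in> ereal ` R m) \<and> (\<exists>m\<in>J. lower_rot h F x \<in> ereal ` R m)"
      "\<And>m \<alpha>. m \<in> J \<Longrightarrow> \<alpha> \<in> R m \<Longrightarrow> \<exists>x. has_rot h F x (ereal \<alpha>)"
      "\<And>m q. m \<in> J \<Longrightarrow> q \<in> R m \<inter> \<rat> \<Longrightarrow> \<exists>x\<in>Xinf h \<tau> F. periodic_mod1 \<tau> F x \<and> has_rot h F x (ereal q)"
      using whisker_intervals by metis
    show ?thesis by (rule assembly[OF JR(1,2)]) (use JR(3-5) in blast)+
  qed
qed

end
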